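(* Let $\pi:A\to M$ be an affine bundle of rank $>0$ and let $([\![\cdot,\cdot]\!]^+,\rho^+)$ be a Lie algebroid structure on the vector bundle $A^+\to M$. Then there exists a unique affine Jacobi structure $(\Lambda_A,E_A)$ on $A$ such that $$\widetilde{\{a,b\}_{(\Lambda_A,E_A)}}=[\![\tilde a,\tilde b]\!]^+\qquad\text{for all affine functions } a,b:A\to\mathbb{R}.$$
   Context: Everything is smooth. A Jacobi structure on a manifold $N$ is a pair $(\Lambda,E)$ of a bivector field and a vector field such that the Jacobi bracket $\{f,g\}_{(\Lambda,E)}=\Lambda(df,dg)+fE(g)-gE(f)$ on $C^\infty(N,\mathbb{R})$ satisfies the Jacobi identity. An affine bundle $\pi:A\to M$ is a locally trivial bundle whose fibres $A_p$ are affine spaces modelled on the fibres of a vector bundle $V(A)\to M$, with affine transition maps. A function $A\to\mathbb{R}$ is affine if it is smooth and its restriction to every fibre is an affine function. A Jacobi structure on $A$ is affine if the Jacobi bracket of two affine functions is an affine function. $A^+=\bigcup_{p\in M}\mathrm{Aff}(A_p,\mathbb{R})\to M$ is the vector bundle whose fibre at $p$ is the space of affine functions $A_p\to\mathbb{R}$. Sections of $A^+$ correspond bijectively to affine functions on $A$; $\tilde a\in\Gamma(A^+)$ denotes the section corresponding to the affine function $a:A\to\mathbb{R}$. A Lie algebroid structure on a vector bundle $V\to M$ is a Lie bracket $[\![\cdot,\cdot]\!]$ on $\Gamma(V)$ together with a vector bundle morphism $\rho:V\to TM$ such that $[\![X,fY]\!]=f[\![X,Y]\!]+\rho(X)(f)Y$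 for all $X,Y\in\Gamma(V)$, $f\in C^\infty(M,\mathbb{R})$. *)

theory Defs
  imports "HOL-Analysis.Analysis" "HOL-Library.Function_Algebras"
begin

section \<open>Model spaces\<close>

text \<open>
  Manifolds are modelled on an arbitrary finite-dimensional real inner product space. In contrast
  to \<^class>\<open>euclidean_space\<close>, whose \<^const>\<open>Basis\<close> is nonempty, the class below
  also admits the zero space, so that manifolds of dimension 0 are included.
\<close>

class finite_dim_inner = real_inner +
  assumes finite_dim_explicit: "\<exists>B. finite B \<and> (\<forall>x. \<exists>c. x = (\<Sum>b\<in>B. c b *\<^sub>R b))"

lemma finite_dim: "\<exists>B. finite B \<and> span B = (UNIV :: 'a::finite_dim_inner set)"
proof -
  obtain B :: "'a set" where B: "finite B" "\<And>x. \<exists>c. x = (\<Sum>b\<in>B. c b *\<^sub>R b)"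
    using finite_dim_explicit by blast
  have "x \<in> span B" for x
  proof -
    obtain c where "x = (\<Sum>b\<in>B. c b *\<^sub>R b)" using B(2) by blast
    then show ?thesis by (simp add: span_sum span_scale span_base)
  qed
  then show ?thesis using B(1) by blast
qed

subclass (in euclidean_space) finite_dim_inner
proof
  show "\<exists>B. finite B \<and> (\<forall>x. \<exists>c. x = (\<Sum>b\<in>B. c b *\<^sub>R b))"
    by (rule exI[of _ Basis], intro conjI allI finite_Basis,
        rule exI[of _ "inner _"], rule euclidean_representation[symmetric])
qed

instance prod :: (finite_dim_inner, finite_dim_inner) finite_dim_inner
proof
  obtain B :: "'a set" where B: "finite B" "span B = UNIV"
    using finite_dim by blast
  obtain C :: "'b set" where C: "finite C" "span C = UNIV"
    using finite_dim by blast
  let ?D = "(\<lambda>b. (b, 0)) ` B \<union> (\<lambda>c. (0, c)) ` C"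
  have l: "linear (\<lambda>b::'a. (b, 0::'b))" "linear (\<lambda>c::'b. (0::'a, c))"
    by (auto intro!: linearI)
  have "x \<in> span ?D" for x :: "'a \<times> 'b"
  proof -
    have "(fst x, 0) \<in> span ((\<lambda>b. (b, 0::'b)) ` B)" "(0, snd x) \<in> span ((\<lambda>c. (0::'a, c)) ` C)"
      by (simp_all add: linear_span_image[OF l(1)] linear_span_image[OF l(2)] B C)
    then have "(fst x, 0) \<in> span ?D" "(0, snd x) \<in> span ?D"
      by (auto intro: subsetD[OF span_mono[OF Un_upper1]] subsetD[OF span_mono[OF Un_upper2]])
    then have "(fst x, 0) + (0, snd x) \<in> span ?D"
      by (rule span_add)
    then show ?thesis by simp
  qed
  moreover have fin: "finite ?D" using B C by simp
  ultimately have "\<exists>c. x = (\<Sum>d\<in>?D. c d *\<^sub>R d)" for x :: "'a \<times> 'b"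
    unfolding span_finite[OF fin] by blast
  with fin show "\<exists>D. finite D \<and> (\<forall>x :: 'a \<times> 'b. \<exists>c. x = (\<Sum>d\<in>D. c d *\<^sub>R d))"
    by blast
qed

text \<open>Functions into a real vector space form a real vector space under pointwise operations.\<close>

instantiation "fun" :: (type, real_vector) real_vector
begin

definition scaleR_fun :: "real \<Rightarrow> ('a \<Rightarrow> 'b) \<Rightarrow> 'a \<Rightarrow> 'b"
  where "scaleR_fun c f = (\<lambda>x. c *\<^sub>R f x)"

instance
  by standard (simp_all add: scaleR_fun_def plus_fun_def fun_eq_iff algebra_simps)

end

definition lin_on :: "'v::real_vector set \<Rightarrow> ('v \<Rightarrow> 'w::real_vector) \<Rightarrow> bool"
  where "lin_on S f \<longleftrightarrow> (\<forall>x\<in>S. \<forall>y\<in>S. f (x + y) = f x + f y) \<and> (\<forall>c. \<forall>x\<in>S. f (c *\<^sub>R x) = c *\<^sub>R f x)"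


section \<open>Smooth manifolds and smooth maps\<close>

text \<open>
  On open sets of a finite-dimensional space, \<open>Ck_on k\<close> is the usual class of \<open>k\<close> times
  continuously differentiable maps, expressed through iterated directional derivatives.
\<close>

primrec Ck_on :: "nat \<Rightarrow> 'a::real_normed_vector set \<Rightarrow> ('a \<Rightarrow> 'b::real_normed_vector) \<Rightarrow> bool" where
  "Ck_on 0 S f \<longleftrightarrow> continuous_on S f"
| "Ck_on (Suc k) S f \<longleftrightarrow> (\<forall>x\<in>S. f differentiable (at x)) \<and>
     (\<forall>v. Ck_on k S (\<lambda>x. frechet_derivative f (at x) v))"

definition smooth_on :: "'a::real_normed_vector set \<Rightarrow> ('a \<Rightarrow> 'b::real_normed_vector) \<Rightarrow> bool"
  where "smooth_on S f \<longleftrightarrow> (\<forall>k. Ck_on k S f)"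

text \<open>
  A manifold is given by an atlas; its points are those covered by the charts and its topology
  is the one determined by the charts. Only the values of a chart on its domain matter.
\<close>

type_synonym ('m, 'e) chart = "'m set \<times> ('m \<Rightarrow> 'e)"
type_synonym ('m, 'e) atlas = "('m, 'e) chart set"

definition carrier :: "('m, 'e) atlas \<Rightarrow> 'm set"
  where "carrier M = \<Union> (fst ` M)"

definition mfd_open :: "('m, 'e::finite_dim_inner) atlas \<Rightarrow> 'm set \<Rightarrow> bool"
  where "mfd_open M W \<longleftrightarrow> W \<subseteq> carrier M \<and> (\<forall>(U, \<phi>)\<in>M. open (\<phi> ` (U \<inter> W)))"

definition smooth_manifold :: "('m, 'e::finite_dim_inner) atlas \<Rightarrow> bool"
  where "smooth_manifold M \<longleftrightarrow>
     (\<forall>(U, \<phi>)\<in>M. inj_on \<phi> U \<and> open (\<phi> ` U)) \<and>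
     (\<forall>(U, \<phi>)\<in>M. \<forall>(V, \<psi>)\<in>M. open (\<phi> ` (U \<inter> V)) \<and> smooth_on (\<phi> ` (U \<inter> V)) (\<psi> \<circ> inv_into U \<phi>)) \<and>
     Hausdorff_space (topology (mfd_open M)) \<and>
     second_countable (topology (mfd_open M))"

text \<open>The openness requirement is continuity of \<open>f\<close>.\<close>

definition smooth_map ::
  "('m, 'e::finite_dim_inner) atlas \<Rightarrow> ('n, 'd::finite_dim_inner) atlas \<Rightarrow> ('m \<Rightarrow> 'n) \<Rightarrow> bool"
  where "smooth_map M N f \<longleftrightarrow> f ` carrier M \<subseteq> carrier N \<and>
     (\<forall>(U, \<phi>)\<in>M. \<forall>(V, \<psi>)\<in>N.
        open (\<phi> ` (U \<inter> f -` V)) \<and> smooth_on (\<phi> ` (U \<inter> f -` V)) (\<psi> \<circ> f \<circ> inv_into U \<phi>))"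

definition diffeo ::
  "('m, 'e::finite_dim_inner) atlas \<Rightarrow> ('n, 'd::finite_dim_inner) atlas \<Rightarrow> ('m \<Rightarrow> 'n) \<Rightarrow> bool"
  where "diffeo M N f \<longleftrightarrow> bij_betw f (carrier M) (carrier N) \<and>
     smooth_map M N f \<and> smooth_map N M (inv_into (carrier M) f)"

definition linear_atlas :: "('e, 'e) atlas"
  where "linear_atlas = {(UNIV, id)}"

definition open_atlas :: "('m, 'e) atlas \<Rightarrow> 'm set \<Rightarrow> ('m, 'e) atlas"
  where "open_atlas M W = {(U \<inter> W, \<phi>) | U \<phi>. (U, \<phi>) \<in> M}"

definition prod_atlas :: "('m, 'e) atlas \<Rightarrow> ('n, 'd) atlas \<Rightarrow> ('m \<times> 'n, 'e \<times> 'd) atlas"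
  where "prod_atlas M N = {(U \<times> V, map_prod \<phi> \<psi>) | U \<phi> V \<psi>. (U, \<phi>) \<in> M \<and> (V, \<psi>) \<in> N}"

definition smooth_functions :: "('m, 'e::finite_dim_inner) atlas \<Rightarrow> ('m \<Rightarrow> real) set"
  where "smooth_functions M = {f. smooth_map M linear_atlas f}"


section \<open>Vector bundles\<close>

text \<open>
  The fibres of a vector bundle are subspaces \<open>F p\<close> of an ambient real vector space
  (which carries no further structure, and through which distinct fibres are not related);
  the total space is the disjoint union of the fibres, a manifold with atlas \<open>E\<close>.
\<close>

definition vb_trivialization ::
  "('m, 'e::finite_dim_inner) atlas \<Rightarrow> ('m \<Rightarrow> 'v::real_vector set) \<Rightarrow>
   ('m \<times> 'v, 'e \<times> 'f::finite_dim_inner) atlas \<Rightarrow> 'm set \<Rightarrow> ('m \<times> 'v \<Rightarrow> 'f) \<Rightarrow> bool"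
  where "vb_trivialization M F E W \<tau> \<longleftrightarrow> mfd_open M W \<and>
     diffeo (open_atlas E (fst -` W)) (prod_atlas (open_atlas M W) linear_atlas) (\<lambda>x. (fst x, \<tau> x)) \<and>
     (\<forall>p\<in>W. lin_on (F p) (\<lambda>v. \<tau> (p, v)))"

definition vector_bundle ::
  "('m, 'e::finite_dim_inner) atlas \<Rightarrow> ('m \<Rightarrow> 'v::real_vector set) \<Rightarrow>
   ('m \<times> 'v, 'e \<times> 'f::finite_dim_inner) atlas \<Rightarrow> bool"
  where "vector_bundle M F E \<longleftrightarrow> smooth_manifold M \<and> smooth_manifold E \<and>
     carrier E = Sigma (carrier M) F \<and> smooth_map E M fst \<and>
     (\<forall>p\<in>carrier M. subspace (F p)) \<and>
     (\<forall>p\<in>carrier M. \<exists>W \<tau>. p \<in> W \<and> vb_trivialization M F E W \<tau>)"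

text \<open>Sections are normalised to vanish off the base, so that equality of sections is equality
  of functions.\<close>

definition sections ::
  "('m, 'e::finite_dim_inner) atlas \<Rightarrow> ('m \<Rightarrow> 'v::real_vector set) \<Rightarrow>
   ('m \<times> 'v, 'd::finite_dim_inner) atlas \<Rightarrow> ('m \<Rightarrow> 'v) set"
  where "sections M F E = {s. (\<forall>p\<in>carrier M. s p \<in> F p) \<and> (\<forall>p. p \<notin> carrier M \<longrightarrow> s p = 0) \<and>
     smooth_map M E (\<lambda>p. (p, s p))}"

definition vb_morphism ::
  "('m, 'e::finite_dim_inner) atlas \<Rightarrow>
   ('m \<Rightarrow> 'v::real_vector set) \<Rightarrow> ('m \<times> 'v, 'd::finite_dim_inner) atlas \<Rightarrow>
   ('m \<Rightarrow> 'w::real_vector set) \<Rightarrow> ('m \<times> 'w, 'c::finite_dim_inner) atlas \<Rightarrow>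
   ('m \<Rightarrow> 'v \<Rightarrow> 'w) \<Rightarrow> bool"
  where "vb_morphism M F E F' E' \<rho> \<longleftrightarrow>
     (\<forall>p\<in>carrier M. \<rho> p ` F p \<subseteq> F' p \<and> lin_on (F p) (\<rho> p)) \<and>
     smooth_map E E' (\<lambda>(p, v). (p, \<rho> p v))"


section \<open>The tangent bundle, vector fields and bivector fields\<close>

text \<open>
  Tangent vectors at \<open>p\<close> are the directional derivatives at \<open>p\<close>, acting on smooth functions
  (and set to 0 on other functions).
\<close>

type_synonym 'm tvec = "('m \<Rightarrow> real) \<Rightarrow> real"
type_synonym 'm covec = "'m tvec \<Rightarrow> real"
type_synonym 'm bivec = "'m covec \<Rightarrow> 'm covec \<Rightarrow> real"

definition dir_deriv ::
  "('m, 'e::finite_dim_inner) atlas \<Rightarrow> ('m, 'e) chart \<Rightarrow> 'm \<Rightarrow> 'e \<Rightarrow> 'm tvec"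
  where "dir_deriv M c p w = (\<lambda>f. if f \<in> smooth_functions M
     then frechet_derivative (f \<circ> inv_into (fst c) (snd c)) (at (snd c p)) w else 0)"

definition tangent_space :: "('m, 'e::finite_dim_inner) atlas \<Rightarrow> 'm \<Rightarrow> 'm tvec set"
  where "tangent_space M p = {dir_deriv M c p w | c w. c \<in> M \<and> p \<in> fst c}"

definition components ::
  "('m, 'e::finite_dim_inner) atlas \<Rightarrow> ('m, 'e) chart \<Rightarrow> 'm \<Rightarrow> 'm tvec \<Rightarrow> 'e"
  where "components M c p v = (THE w. v = dir_deriv M c p w)"

definition tangent_atlas ::
  "('m, 'e::finite_dim_inner) atlas \<Rightarrow> ('m \<times> 'm tvec, 'e \<times> 'e) atlas"
  where "tangent_atlas M = {(Sigma U (tangent_space M), \<lambda>(p, v). (\<phi> p, components M (U, \<phi>) p v)) | U \<phi>.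
     (U, \<phi>) \<in> M}"

definition vector_fields :: "('m, 'e::finite_dim_inner) atlas \<Rightarrow> ('m \<Rightarrow> 'm tvec) set"
  where "vector_fields M = sections M (tangent_space M) (tangent_atlas M)"

definition cotangent_space :: "('m, 'e::finite_dim_inner) atlas \<Rightarrow> 'm \<Rightarrow> 'm covec set"
  where "cotangent_space M p = {\<alpha>. lin_on (tangent_space M p) \<alpha> \<and>
     (\<forall>v. v \<notin> tangent_space M p \<longrightarrow> \<alpha> v = 0)}"

definition differential :: "('m, 'e::finite_dim_inner) atlas \<Rightarrow> ('m \<Rightarrow> real) \<Rightarrow> 'm \<Rightarrow> 'm covec"
  where "differential M f p = (\<lambda>v. if v \<in> tangent_space M p then v f else 0)"

text \<open>The value at \<open>p\<close> of the differential of the local coordinate function \<open>\<eta> \<bullet> \<phi>\<close>.\<close>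

definition coord_covec ::
  "('m, 'e::finite_dim_inner) atlas \<Rightarrow> ('m, 'e) chart \<Rightarrow> 'e \<Rightarrow> 'm \<Rightarrow> 'm covec"
  where "coord_covec M c \<eta> p =
     (\<lambda>v. if v \<in> tangent_space M p then \<eta> \<bullet> components M c p v else 0)"

text \<open>
  Bivectors at \<open>p\<close> are the skew-symmetric bilinear forms on the cotangent space at \<open>p\<close>
  (normalised to be 0 off the cotangent space). A bivector field is smooth if its coefficients
  in every chart are.
\<close>

definition bivectors :: "('m, 'e::finite_dim_inner) atlas \<Rightarrow> 'm \<Rightarrow> 'm bivec set"
  where "bivectors M p = {B.
     (\<forall>\<alpha>\<in>cotangent_space M p. lin_on (cotangent_space M p) (B \<alpha>)) \<and>
     (\<forall>\<alpha>\<in>cotangent_space M p. \<forall>\<beta>\<in>cotangent_space M p. B \<alpha> \<beta> = - B \<beta> \<alpha>) \<and>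
     (\<forall>\<alpha> \<beta>. \<alpha> \<notin> cotangent_space M p \<or> \<beta> \<notin> cotangent_space M p \<longrightarrow> B \<alpha> \<beta> = 0)}"

definition bivector_fields :: "('m, 'e::finite_dim_inner) atlas \<Rightarrow> ('m \<Rightarrow> 'm bivec) set"
  where "bivector_fields M = {\<Lambda>.
     (\<forall>p\<in>carrier M. \<Lambda> p \<in> bivectors M p) \<and> (\<forall>p. p \<notin> carrier M \<longrightarrow> \<Lambda> p = 0) \<and>
     (\<forall>(U, \<phi>)\<in>M. \<forall>\<eta> \<theta>. smooth_on (\<phi> ` U)
        ((\<lambda>p. \<Lambda> p (coord_covec M (U, \<phi>) \<eta> p) (coord_covec M (U, \<phi>) \<theta> p)) \<circ> inv_into U \<phi>))}"


section \<open>Jacobi structures\<close>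

definition jacobi_bracket ::
  "('m, 'e::finite_dim_inner) atlas \<Rightarrow> ('m \<Rightarrow> 'm bivec) \<times> ('m \<Rightarrow> 'm tvec) \<Rightarrow>
   ('m \<Rightarrow> real) \<Rightarrow> ('m \<Rightarrow> real) \<Rightarrow> 'm \<Rightarrow> real"
  where "jacobi_bracket N J f g = (\<lambda>x.
     fst J x (differential N f x) (differential N g x) + f x * snd J x g - g x * snd J x f)"

definition jacobi_structure ::
  "('m, 'e::finite_dim_inner) atlas \<Rightarrow> ('m \<Rightarrow> 'm bivec) \<times> ('m \<Rightarrow> 'm tvec) \<Rightarrow> bool"
  where "jacobi_structure N J \<longleftrightarrow> fst J \<in> bivector_fields N \<and> snd J \<in> vector_fields N \<and>
     (\<forall>f\<in>smooth_functions N. \<forall>g\<in>smooth_functions N. \<forall>h\<in>smooth_functions N. \<forall>x\<in>carrier N.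
        jacobi_bracket N J f (jacobi_bracket N J g h) x
        + jacobi_bracket N J g (jacobi_bracket N J h f) x
        + jacobi_bracket N J h (jacobi_bracket N J f g) x = 0)"


section \<open>Lie algebroids\<close>

definition lie_bracket_on :: "'s::real_vector set \<Rightarrow> ('s \<Rightarrow> 's \<Rightarrow> 's) \<Rightarrow> bool"
  where "lie_bracket_on S br \<longleftrightarrow>
     (\<forall>X\<in>S. \<forall>Y\<in>S. br X Y \<in> S) \<and>
     (\<forall>X\<in>S. lin_on S (br X)) \<and> (\<forall>Y\<in>S. lin_on S (\<lambda>X. br X Y)) \<and>
     (\<forall>X\<in>S. br X X = 0) \<and>
     (\<forall>X\<in>S. \<forall>Y\<in>S. \<forall>Z\<in>S. br X (br Y Z) + br Y (br Z X) + br Z (br X Y) = 0)"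

text \<open>A Lie algebroid structure on the vector bundle with fibres \<open>F\<close> and total space \<open>E\<close> over \<open>M\<close>.\<close>

definition lie_algebroid_structure ::
  "('m, 'e::finite_dim_inner) atlas \<Rightarrow> ('m \<Rightarrow> 'v::real_vector set) \<Rightarrow>
   ('m \<times> 'v, 'd::finite_dim_inner) atlas \<Rightarrow>
   (('m \<Rightarrow> 'v) \<Rightarrow> ('m \<Rightarrow> 'v) \<Rightarrow> ('m \<Rightarrow> 'v)) \<Rightarrow> ('m \<Rightarrow> 'v \<Rightarrow> 'm tvec) \<Rightarrow> bool"
  where "lie_algebroid_structure M F E br \<rho> \<longleftrightarrow>
     lie_bracket_on (sections M F E) br \<and>
     vb_morphism M F E (tangent_space M) (tangent_atlas M) \<rho> \<and>
     (\<forall>X\<in>sections M F E. \<forall>Y\<in>sections M F E. \<forall>f\<in>smooth_functions M. \<forall>p\<in>carrier M.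
        br X (\<lambda>q. f q *\<^sub>R Y q) p = f p *\<^sub>R br X Y p + \<rho> p (X p) f *\<^sub>R Y p)"


section \<open>Affine bundles\<close>

text \<open>
  The data of an affine bundle \<open>\<pi> : A \<rightarrow> M\<close> modelled on a vector bundle \<open>V \<rightarrow> M\<close>:
  the atlases of \<open>M\<close> and \<open>A\<close>, the projection, the fibres and total space of \<open>V\<close>, and the
  translation of a point of \<open>A\<close> over \<open>p\<close> by a vector of the fibre of \<open>V\<close> over \<open>p\<close>.
  The type \<open>'f\<close> is the typical fibre.
\<close>

record ('m, 'e, 'a, 'f, 'v) affine_bundle_data =
  base :: "('m, 'e) atlas"
  total :: "('a, 'e \<times> 'f) atlas"
  proj :: "'a \<Rightarrow> 'm"
  vfibre :: "'m \<Rightarrow> 'v set"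
  vtotal :: "('m \<times> 'v, 'e \<times> 'f) atlas"
  translate :: "'a \<Rightarrow> 'v \<Rightarrow> 'a"

definition afibre :: "('m, 'e, 'a, 'f, 'v) affine_bundle_data \<Rightarrow> 'm \<Rightarrow> 'a set"
  where "afibre A p = {x \<in> carrier (total A). proj A x = p}"

definition affine_trivialization ::
  "('m, 'e::finite_dim_inner, 'a, 'f::finite_dim_inner, 'v::real_vector) affine_bundle_data \<Rightarrow>
   'm set \<Rightarrow> ('a \<Rightarrow> 'f) \<Rightarrow> bool"
  where "affine_trivialization A W t \<longleftrightarrow> mfd_open (base A) W \<and>
     diffeo (open_atlas (total A) (proj A -` W)) (prod_atlas (open_atlas (base A) W) linear_atlas)
       (\<lambda>x. (proj A x, t x)) \<and>
     (\<exists>\<tau>. vb_trivialization (base A) (vfibre A) (vtotal A) W \<tau> \<and>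
        (\<forall>p\<in>W. \<forall>x\<in>afibre A p. \<forall>v\<in>vfibre A p. t (translate A x v) = t x + \<tau> (p, v)))"

definition affine_bundle ::
  "('m, 'e::finite_dim_inner, 'a, 'f::finite_dim_inner, 'v::real_vector) affine_bundle_data \<Rightarrow> bool"
  where "affine_bundle A \<longleftrightarrow>
     smooth_manifold (base A) \<and> smooth_manifold (total A) \<and>
     smooth_map (total A) (base A) (proj A) \<and>
     vector_bundle (base A) (vfibre A) (vtotal A) \<and>
     (\<forall>p\<in>carrier (base A).
        (\<forall>x\<in>afibre A p. \<forall>v\<in>vfibre A p. translate A x v \<in> afibre A p) \<and>
        (\<forall>x\<in>afibre A p. translate A x 0 = x) \<and>
        (\<forall>x\<in>afibre A p. \<forall>v\<in>vfibre A p. \<forall>w\<in>vfibre A p.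
           translate A (translate A x v) w = translate A x (v + w)) \<and>
        (\<forall>x\<in>afibre A p. \<forall>y\<in>afibre A p. \<exists>!v. v \<in> vfibre A p \<and> y = translate A x v)) \<and>
     (\<forall>p\<in>carrier (base A). \<exists>W t. p \<in> W \<and> affine_trivialization A W t)"

definition affine_bundle_rank ::
  "('m, 'e, 'a, 'f::finite_dim_inner, 'v) affine_bundle_data \<Rightarrow> nat"
  where "affine_bundle_rank A = dim (UNIV :: 'f set)"

definition affine_on_fibre ::
  "('m, 'e, 'a, 'f, 'v::real_vector) affine_bundle_data \<Rightarrow> 'm \<Rightarrow> ('a \<Rightarrow> real) \<Rightarrow> bool"
  where "affine_on_fibre A p f \<longleftrightarrow> (\<exists>l. lin_on (vfibre A p) l \<and>
     (\<forall>x\<in>afibre A p. \<forall>v\<in>vfibre A p. f (translate A x v) = f x + l v))"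

definition affine_functions ::
  "('m, 'e::finite_dim_inner, 'a, 'f::finite_dim_inner, 'v::real_vector) affine_bundle_data \<Rightarrow>
   ('a \<Rightarrow> real) set"
  where "affine_functions A =
     {a \<in> smooth_functions (total A). \<forall>p\<in>carrier (base A). affine_on_fibre A p a}"

definition affine_jacobi_structure ::
  "('m, 'e::finite_dim_inner, 'a, 'f::finite_dim_inner, 'v::real_vector) affine_bundle_data \<Rightarrow>
   ('a \<Rightarrow> 'a bivec) \<times> ('a \<Rightarrow> 'a tvec) \<Rightarrow> bool"
  where "affine_jacobi_structure A J \<longleftrightarrow> jacobi_structure (total A) J \<and>
     (\<forall>a\<in>affine_functions A. \<forall>b\<in>affine_functions A.
        jacobi_bracket (total A) J a b \<in> affine_functions A)"

text \<open>
  The bundle of affine functions on the fibres. An affine function on the fibre over \<open>p\<close> is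
  represented by its extension by 0. Over a chart \<open>\<phi>\<close> of the base and an affine trivialization
  \<open>t\<close> it has the form \<open>x \<mapsto> w \<bullet> t x + c\<close>, and \<open>(\<phi> p, (w, c))\<close> are its coordinates.
\<close>

definition dual_fibre ::
  "('m, 'e, 'a, 'f, 'v::real_vector) affine_bundle_data \<Rightarrow> 'm \<Rightarrow> ('a \<Rightarrow> real) set"
  where "dual_fibre A p = {f. affine_on_fibre A p f \<and> (\<forall>x. x \<notin> afibre A p \<longrightarrow> f x = 0)}"

definition dual_total ::
  "('m, 'e::finite_dim_inner, 'a, 'f::finite_dim_inner, 'v::real_vector) affine_bundle_data \<Rightarrow>
   ('m \<times> ('a \<Rightarrow> real), 'e \<times> ('f \<times> real)) atlas"
  where "dual_total A =
     {(Sigma (U \<inter> W) (dual_fibre A),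
       \<lambda>(p, f). (\<phi> p, THE wc. \<forall>x\<in>afibre A p. f x = fst wc \<bullet> t x + snd wc)) | U \<phi> W t.
      (U, \<phi>) \<in> base A \<and> affine_trivialization A W t}"

text \<open>The section corresponding to an affine function.\<close>

definition tilde ::
  "('m, 'e, 'a, 'f, 'v) affine_bundle_data \<Rightarrow> ('a \<Rightarrow> real) \<Rightarrow> 'm \<Rightarrow> 'a \<Rightarrow> real"
  where "tilde A a = (\<lambda>p x. if x \<in> afibre A p then a x else 0)"

end

theory Submission
  imports Defs
begin

text \<open>
  Transport the algebroid bracket to a Lie bracket \<open>lie\<close> on affine functions. By the Leibniz rule
  \<open>lie a b x\<close> depends only on the 1-jets of \<open>a\<close> and \<open>b\<close> at \<open>x\<close>, and affine functions realise every
  1-jet at every point. Hence there is exactly one way to define \<open>E\<close> and \<open>\<Lambda>\<close>: \<open>E(a) = lie 1 a\<close>, and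
  \<open>\<Lambda>(da, db) = lie a b\<close> at common zeros of \<open>a\<close> and \<open>b\<close>. Each operator \<open>{f, -}\<close> is of first order, so,
  by the symmetry of second derivatives, the Jacobiator is of first order in each argument; since
  it vanishes on affine functions, replacing the arguments one at a time by arbitrary smooth
  functions shows that it vanishes identically.
\<close>

section \<open>Calculus in finite-dimensional inner product spaces\<close>

text \<open>The Leibniz rule speaks only of multiples by functions on the base. Products of affine
  functions are in general not affine, so the bracket cannot simply be extended by a derivation
  rule, and the passage through 1-jets takes its place. Cutoffs must come from the base as well,
  since a cutoff along the fibres destroys affineness. The linear functions of a bundle chart are
  affine, however, and stay so after multiplication by a cutoff pulled back from the base: these are
  the global affine functions that realise all 1-jets. Bundle charts need not belong to the atlas of
  the total space, hence a local theory for all compatible charts. Tangent vectors act on global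
  functions only, hence the repeated passage from local coordinates to cut-off ones. The constant 1
  has zero differential, so its bracket with g is E(g) alone: this separates E from the bivector.
  The same constant later tests the zeroth-order coefficient of the Jacobiator.\<close>

lemma ex_orthonormal_basis:
  "\<exists>B :: 'a::finite_dim_inner set. finite B \<and> (\<forall>b\<in>B. \<forall>c\<in>B. b \<bullet> c = (if b = c then 1 else 0)) \<and> span B = UNIV"
proof -
  obtain B :: "'a set" where B: "finite B" "span B = UNIV"
    using finite_dim by blast
  obtain C where C: "finite C" "span C = span B" "pairwise orthogonal C"
    using basis_orthogonal[OF B(1)] by blast
  \<comment> \<open>The orthogonal set may contain 0, which cannot be normalised; dropping it does
    not change the span.\<close>
  define D where "D = (\<lambda>c. c /\<^sub>R norm c) ` (C - {0})"
  have "finite D" using C by (simp add: D_def)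
  moreover have "b \<bullet> c = (if b = c then 1 else 0)" if bc: "b \<in> D" "c \<in> D" for b c
  proof -
    obtain b' where b': "b' \<in> C" "b' \<noteq> 0" "b = b' /\<^sub>R norm b'" using bc by (auto simp: D_def)
    obtain c' where c': "c' \<in> C" "c' \<noteq> 0" "c = c' /\<^sub>R norm c'" using bc by (auto simp: D_def)
    show ?thesis
    proof (cases "b' = c'")
      case True
      then show ?thesis using b' c' by (simp add: power2_norm_eq_inner[symmetric] power2_eq_square)
    next
      case False
      then have o: "b' \<bullet> c' = 0" using C b' c' by (auto simp: pairwise_def orthogonal_def)
      then have "b \<bullet> c = 0" using b' c' by simp
      moreover have "b \<bullet> b \<noteq> 0" using b' by simp
      ultimately show ?thesis by auto
    qed
  qed
  moreover have "span D = UNIV"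
  proof -
    have "C \<subseteq> span D"
    proof
      fix c assume c: "c \<in> C"
      show "c \<in> span D"
      proof (cases "c = 0")
        case True then show ?thesis by (simp add: span_zero)
      next
        case False
        then have "c /\<^sub>R norm c \<in> span D" using c by (intro span_base) (auto simp: D_def)
        then have "norm c *\<^sub>R (c /\<^sub>R norm c) \<in> span D" by (rule span_scale)
        then show ?thesis using False by simp
      qed
    qed
    then have "span C \<subseteq> span D" by (metis span_mono span_span)
    then show ?thesis using B C by auto
  qed
  ultimately show ?thesis by blast
qed

text \<open>Possibly empty, because the model space may be the zero space. Sums over it play the
  role of sums over \<open>Basis\<close>.\<close>

definition onb :: "'a::finite_dim_inner set"
  where "onb = (SOME B. finite B \<and> (\<forall>b\<in>B. \<forall>c\<in>B. b \<bullet> c = (if b = c then 1 else 0)) \<and> span B = UNIV)"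

lemma onb: "finite (onb :: 'a::finite_dim_inner set)"
    "b \<in> (onb :: 'a::finite_dim_inner set) \<Longrightarrow> c \<in> onb \<Longrightarrow> b \<bullet> c = (if b = c then 1 else 0)"
    "span (onb :: 'a::finite_dim_inner set) = UNIV"
  using someI_ex[OF ex_orthonormal_basis] unfolding onb_def[symmetric] by blast+

lemma onb_expand: "(\<Sum>b\<in>onb. (x \<bullet> b) *\<^sub>R b) = (x :: 'a::finite_dim_inner)"
proof -
  have "x \<in> span onb" by (simp add: onb)
  then show ?thesis
  proof (induction rule: span_induct_alt)
    case base
    then show ?case by simp
  next
    case (step c y z)
    have "(\<Sum>b\<in>onb. ((c *\<^sub>R y + z) \<bullet> b) *\<^sub>R b) =
        c *\<^sub>R (\<Sum>b\<in>onb. (y \<bullet> b) *\<^sub>R b) + (\<Sum>b\<in>onb. (z \<bullet> b) *\<^sub>R b)"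
      by (simp add: inner_add_left scaleR_add_left sum.distrib scaleR_sum_right)
    also have "(\<Sum>b\<in>onb. (y \<bullet> b) *\<^sub>R b) = (\<Sum>b\<in>onb. if b = y then y else 0)"
      by (intro sum.cong) (auto simp: onb step)
    also have "\<dots> = y" using step by (simp add: onb)
    finally show ?case using step by simp
  qed
qed

lemma linear_onb: "linear f \<Longrightarrow> f x = (\<Sum>b\<in>onb. (x \<bullet> b) *\<^sub>R f b)"
  for f :: "'a::finite_dim_inner \<Rightarrow> 'b::real_vector"
  by (subst onb_expand[symmetric]) (simp add: linear_sum linear_scale)

lemma riesz: "linear f \<Longrightarrow> \<exists>w. \<forall>x. f x = w \<bullet> x" for f :: "'a::finite_dim_inner \<Rightarrow> real"
proof -
  assume f: "linear f"
  have "f x = (\<Sum>b\<in>onb. f b *\<^sub>R b) \<bullet> x" for x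
    by (subst linear_onb[OF f]) (simp add: inner_sum_left inner_commute[of x] mult.commute)
  then show ?thesis by blast
qed

text \<open>Cubes are finite Minkowski sums of compact segments, and the ball is a closed subset of
  a cube. Compactness is what later makes the image of a chart ball closed in the manifold.\<close>

lemma compact_cball_finite_dim: "compact (cball (x :: 'a::finite_dim_inner) r)"
proof -
  have cube: "finite B \<Longrightarrow> compact {\<Sum>b\<in>B. c b *\<^sub>R b | c. \<forall>b\<in>B. \<bar>c b\<bar> \<le> r}" for B :: "'a set"
  proof (induction B rule: finite_induct)
    case empty
    then show ?case by simp
  next
    case (insert a B)
    have "compact ((\<lambda>s. s *\<^sub>R a) ` {-r..r})"
      by (intro compact_continuous_image continuous_intros compact_Icc)
    from compact_sums[OF this insert.IH]
    have "compact {x + y |x y. x \<in> (\<lambda>s. s *\<^sub>R a) ` {-r..r} \<and> y \<in> {\<Sum>b\<in>B. c b *\<^sub>R b | c. \<forall>b\<in>B. \<bar>c b\<bar> \<le> r}}" .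
    also have "{x + y |x y. x \<in> (\<lambda>s. s *\<^sub>R a) ` {-r..r} \<and> y \<in> {\<Sum>b\<in>B. c b *\<^sub>R b | c. \<forall>b\<in>B. \<bar>c b\<bar> \<le> r}}
        = {\<Sum>b\<in>insert a B. c b *\<^sub>R b | c. \<forall>b\<in>insert a B. \<bar>c b\<bar> \<le> r}" (is "?L = ?R")
    proof
      show "?L \<subseteq> ?R"
      proof
        fix z assume "z \<in> ?L"
        then obtain s c where sc: "\<bar>s\<bar> \<le> r" "\<forall>b\<in>B. \<bar>c b\<bar> \<le> r" "z = s *\<^sub>R a + (\<Sum>b\<in>B. c b *\<^sub>R b)"
          by (force simp: abs_le_iff)
        have "(\<Sum>b\<in>B. (c(a := s)) b *\<^sub>R b) = (\<Sum>b\<in>B. c b *\<^sub>R b)"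
          using insert.hyps by (intro sum.cong) auto
        then have "z = (\<Sum>b\<in>insert a B. (c(a := s)) b *\<^sub>R b)" using insert.hyps sc by simp
        then show "z \<in> ?R" using sc by (intro CollectI exI[of _ "c(a := s)"]) auto
      qed
      show "?R \<subseteq> ?L" using insert.hyps by (force simp: abs_le_iff)
    qed
    finally show ?case .
  qed
  \<comment> \<open>By Cauchy-Schwarz, coordinates against unit vectors are bounded by the norm, so
    the cube can have the radius of the ball.\<close>
  have 0: "cball (0 :: 'a) r \<subseteq> {\<Sum>b\<in>onb. c b *\<^sub>R b | c. \<forall>b\<in>onb. \<bar>c b\<bar> \<le> r}"
  proof
    fix y :: 'a assume y: "y \<in> cball 0 r"
    have "\<bar>y \<bullet> b\<bar> \<le> r" if "b \<in> onb" for b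
    proof -
      have "norm b = 1" using that by (simp add: norm_eq_sqrt_inner onb)
      then show ?thesis using Cauchy_Schwarz_ineq2[of y b] y by simp
    qed
    then show "y \<in> {\<Sum>b\<in>onb. c b *\<^sub>R b | c. \<forall>b\<in>onb. \<bar>c b\<bar> \<le> r}"
      by (intro CollectI exI[of _ "\<lambda>b. y \<bullet> b"]) (simp add: onb_expand)
  qed
  have "cball 0 r = {\<Sum>b\<in>onb. c b *\<^sub>R b | c. \<forall>b\<in>(onb :: 'a set). \<bar>c b\<bar> \<le> r} \<inter> cball 0 r"
    using 0 by blast
  then have "compact (cball (0::'a) r)"
    by (metis (no_types, lifting) compact_Int_closed cube[OF onb(1)] closed_cball)
  then have "compact ((+) x ` cball 0 r)" by (rule compact_translation)
  then show ?thesis by simp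
qed

section \<open>Calculus of k times continuously differentiable and of smooth maps\<close>

lemma Ck_on_subset: "Ck_on k S f \<Longrightarrow> T \<subseteq> S \<Longrightarrow> Ck_on k T f"
  by (induction k arbitrary: f) (auto intro: continuous_on_subset)

lemma Ck_on_cong:
  assumes "open S"
  shows "(\<And>x. x \<in> S \<Longrightarrow> f x = g x) \<Longrightarrow> Ck_on k S f \<Longrightarrow> Ck_on k S g"
proof (induction k arbitrary: f g)
  case 0
  then show ?case using continuous_on_cong[of S S f g] by simp
next
  case (Suc k)
  have d: "(g has_derivative frechet_derivative f (at x)) (at x)" if "x \<in> S" for x
    using that Suc.prems assms has_derivative_transform_within_open[of f _ x UNIV S g]
    by (simp add: frechet_derivative_works)
  have "frechet_derivative f (at x) v = frechet_derivative g (at x) v" if "x \<in> S" for x v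
    using frechet_derivative_at[OF d[OF that]] by simp
  then have "Ck_on k S (\<lambda>x. frechet_derivative g (at x) v)" for v
    using Suc.IH[of "\<lambda>x. frechet_derivative f (at x) v" "\<lambda>x. frechet_derivative g (at x) v"] Suc.prems(2)
    by simp
  then show ?case using d by (auto simp: differentiable_def)
qed

lemma Ck_on_local: "(\<And>x. x \<in> S \<Longrightarrow> \<exists>T. open T \<and> x \<in> T \<and> Ck_on k T f) \<Longrightarrow> Ck_on k S f"
proof (induction k arbitrary: f)
  case 0
  then show ?case
    by simp (metis continuous_at_imp_continuous_on continuous_on_eq_continuous_at)
next
  case (Suc k)
  have "f differentiable at x" if "x \<in> S" for x using Suc.prems[OF that] by auto
  moreover have "Ck_on k S (\<lambda>x. frechet_derivative f (at x) v)" for v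
    by (rule Suc.IH) (use Suc.prems in fastforce)
  ultimately show ?case by simp
qed

lemma Ck_on_Suc_imp: "Ck_on (Suc k) S f \<Longrightarrow> Ck_on k S f"
proof (induction k arbitrary: f)
  case 0
  then show ?case by (auto intro!: continuous_at_imp_continuous_on differentiable_imp_continuous_within)
next
  case (Suc k)
  then show ?case by (metis Ck_on.simps(2))
qed

lemma Ck_on_SucD:
  assumes "Ck_on (Suc k) S f"
  shows "x \<in> S \<Longrightarrow> (f has_derivative frechet_derivative f (at x)) (at x)"
    and "Ck_on k S (\<lambda>x. frechet_derivative f (at x) v)"
  using assms by (simp_all add: frechet_derivative_works[symmetric])

text \<open>Lets the inductions below use any explicit formula for the derivative in place of the
  chosen \<open>frechet_derivative\<close>.\<close>

lemma Ck_on_SucI: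
  assumes "open S" and d: "\<And>x. x \<in> S \<Longrightarrow> (f has_derivative f' x) (at x)" and "\<And>v. Ck_on k S (\<lambda>x. f' x v)"
  shows "Ck_on (Suc k) S f"
proof -
  have "f' x v = frechet_derivative f (at x) v" if "x \<in> S" for x v
    by (rule fun_cong[OF frechet_derivative_at[OF d[OF that]]])
  then have "Ck_on k S (\<lambda>x. frechet_derivative f (at x) v)" for v
    by (rule Ck_on_cong[OF assms(1) _ assms(3)])
  moreover have "f differentiable at x" if "x \<in> S" for x
    using d[OF that] unfolding differentiable_def by blast
  ultimately show ?thesis by simp
qed

lemma Ck_on_const: "Ck_on k S (\<lambda>x. c)"
  by (induction k arbitrary: c) auto

lemma Ck_on_ident: "Ck_on k S (\<lambda>x. x)"
  by (cases k) (auto intro: Ck_on_const)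

lemma Ck_on_bounded_linear:
  assumes "open S" "bounded_linear h"
  shows "Ck_on k S f \<Longrightarrow> Ck_on k S (\<lambda>x. h (f x))"
proof (induction k arbitrary: f)
  case 0
  then show ?case by (simp add: bounded_linear.continuous_on assms)
next
  case (Suc k)
  note f = Ck_on_SucD[OF Suc.prems]
  show ?case
    by (rule Ck_on_SucI[OF assms(1) bounded_linear.has_derivative[OF assms(2) f(1)] Suc.IH[OF f(2)]])
qed

lemma Ck_on_add:
  assumes "open S"
  shows "Ck_on k S f \<Longrightarrow> Ck_on k S g \<Longrightarrow> Ck_on k S (\<lambda>x. f x + g x)"
proof (induction k arbitrary: f g)
  case 0
  then show ?case by (simp add: continuous_on_add)
next
  case (Suc k)
  note f = Ck_on_SucD[OF Suc.prems(1)] and g = Ck_on_SucD[OF Suc.prems(2)]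
  show ?case
    by (rule Ck_on_SucI[OF assms has_derivative_add[OF f(1) g(1)] Suc.IH[OF f(2) g(2)]])
qed

lemma Ck_on_sum:
  assumes "open S" "\<And>i. i \<in> I \<Longrightarrow> Ck_on k S (f i)"
  shows "Ck_on k S (\<lambda>x. \<Sum>i\<in>I. f i x)"
  using assms(2) by (induction I rule: infinite_finite_induct) (auto intro: Ck_on_add[OF assms(1)] Ck_on_const)

lemma Ck_on_bilinear:
  assumes "open S" "bounded_bilinear h"
  shows "Ck_on k S f \<Longrightarrow> Ck_on k S g \<Longrightarrow> Ck_on k S (\<lambda>x. h (f x) (g x))"
proof (induction k arbitrary: f g)
  case 0
  then show ?case by (simp add: bounded_bilinear.continuous_on assms)
next
  case (Suc k)
  note f = Ck_on_SucD[OF Suc.prems(1)] and g = Ck_on_SucD[OF Suc.prems(2)]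
  show ?case
    by (rule Ck_on_SucI[OF assms(1) bounded_bilinear.FDERIV[OF assms(2) f(1) g(1)]])
      (assumption+, rule Ck_on_add[OF assms(1) Suc.IH[OF Ck_on_Suc_imp[OF Suc.prems(1)] g(2)]
          Suc.IH[OF f(2) Ck_on_Suc_imp[OF Suc.prems(2)]]])
qed

text \<open>The chain rule produces the derivative of \<open>g\<close> at \<open>f x\<close> in a
  direction that itself varies with \<open>x\<close>. Expanding this direction in the orthonormal
  basis leaves a finite sum of scalar functions times \<open>g\<close>-derivatives in fixed
  directions composed with \<open>f\<close>, and to those the induction hypothesis applies. This is
  where the middle space has to be finite-dimensional.\<close>

lemma Ck_on_compose:
  fixes f :: "'a::real_normed_vector \<Rightarrow> 'b::finite_dim_inner"
  assumes "open S" "open T" "f ` S \<subseteq> T"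
  shows "Ck_on k T g \<Longrightarrow> Ck_on k S f \<Longrightarrow> Ck_on k S (\<lambda>x. g (f x))"
proof (induction k arbitrary: g)
  case 0
  then show ?case using continuous_on_compose2 assms by auto
next
  case (Suc k)
  note g = Ck_on_SucD[OF Suc.prems(1)] and f = Ck_on_SucD[OF Suc.prems(2)]
  have d: "((\<lambda>x. g (f x)) has_derivative
      (\<lambda>v. \<Sum>b\<in>onb. (frechet_derivative f (at x) v \<bullet> b) *\<^sub>R frechet_derivative g (at (f x)) b)) (at x)"
    if "x \<in> S" for x
  proof -
    have fx: "f x \<in> T" using that assms(3) by auto
    have "linear (frechet_derivative g (at (f x)))"
      using has_derivative_bounded_linear[OF g(1)[OF fx]] by (rule bounded_linear.linear)
    from linear_onb[OF this, symmetric] show ?thesis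
      using diff_chain_at[OF f(1)[OF that] g(1)[OF fx]] by (simp add: o_def)
  qed
  show ?case
    by (rule Ck_on_SucI[OF assms(1) d])
      (assumption, rule Ck_on_sum[OF assms(1) Ck_on_bilinear[OF assms(1) bounded_bilinear_scaleR
          Ck_on_bounded_linear[OF assms(1) bounded_linear_inner_left f(2)]
          Suc.IH[OF g(2) Ck_on_Suc_imp[OF Suc.prems(2)]]]])
qed

lemma smooth_on_subset: "smooth_on S f \<Longrightarrow> T \<subseteq> S \<Longrightarrow> smooth_on T f"
  unfolding smooth_on_def using Ck_on_subset by blast

lemma smooth_on_cong: "open S \<Longrightarrow> (\<And>x. x \<in> S \<Longrightarrow> f x = g x) \<Longrightarrow> smooth_on S f \<Longrightarrow> smooth_on S g"
  unfolding smooth_on_def using Ck_on_cong by metis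

lemma smooth_on_local: "(\<And>x. x \<in> S \<Longrightarrow> \<exists>T. open T \<and> x \<in> T \<and> smooth_on T f) \<Longrightarrow> smooth_on S f"
  unfolding smooth_on_def by (meson Ck_on_local)

lemma smooth_on_const: "smooth_on S (\<lambda>x. c)"
  unfolding smooth_on_def by (simp add: Ck_on_const)

lemma smooth_on_ident: "smooth_on S (\<lambda>x. x)"
  unfolding smooth_on_def by (simp add: Ck_on_ident)

lemma smooth_on_bounded_linear: "open S \<Longrightarrow> bounded_linear h \<Longrightarrow> smooth_on S f \<Longrightarrow> smooth_on S (\<lambda>x. h (f x))"
  unfolding smooth_on_def using Ck_on_bounded_linear by blast

lemma smooth_on_add: "open S \<Longrightarrow> smooth_on S f \<Longrightarrow> smooth_on S g \<Longrightarrow> smooth_on S (\<lambda>x. f x + g x)"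
  unfolding smooth_on_def using Ck_on_add by blast

lemma smooth_on_sum: "open S \<Longrightarrow> (\<And>i. i \<in> I \<Longrightarrow> smooth_on S (f i)) \<Longrightarrow> smooth_on S (\<lambda>x. \<Sum>i\<in>I. f i x)"
  unfolding smooth_on_def by (simp add: Ck_on_sum)

lemma smooth_on_bilinear:
  "open S \<Longrightarrow> bounded_bilinear h \<Longrightarrow> smooth_on S f \<Longrightarrow> smooth_on S g \<Longrightarrow> smooth_on S (\<lambda>x. h (f x) (g x))"
  unfolding smooth_on_def using Ck_on_bilinear by blast

lemma smooth_on_compose:
  fixes f :: "'a::real_normed_vector \<Rightarrow> 'b::finite_dim_inner"
  shows "open S \<Longrightarrow> open T \<Longrightarrow> f ` S \<subseteq> T \<Longrightarrow> smooth_on T g \<Longrightarrow> smooth_on S f \<Longrightarrow> smooth_on S (\<lambda>x. g (f x))"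
  unfolding smooth_on_def using Ck_on_compose by blast

lemma smooth_on_Pair:
  assumes "open S" "smooth_on S f" "smooth_on S g"
  shows "smooth_on S (\<lambda>x. (f x, g x))"
proof -
  have "smooth_on S (\<lambda>x. (f x, 0) + (0, g x))"
    using assms by (intro smooth_on_add smooth_on_bounded_linear[of S "\<lambda>y. (y, 0)"]
        smooth_on_bounded_linear[of S "\<lambda>y. (0, y)"] bounded_linear_Pair bounded_linear_ident bounded_linear_zero)
  then show ?thesis by simp
qed

lemma smooth_on_frechet_derivative: "smooth_on S f \<Longrightarrow> smooth_on S (\<lambda>x. frechet_derivative f (at x) v)"
  unfolding smooth_on_def by (metis Ck_on.simps(2))

lemma smooth_on_differentiable: "smooth_on S f \<Longrightarrow> x \<in> S \<Longrightarrow> f differentiable (at x)"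
  unfolding smooth_on_def by (metis Ck_on.simps(2))

lemma smooth_on_has_derivative:
  "smooth_on S f \<Longrightarrow> x \<in> S \<Longrightarrow> (f has_derivative frechet_derivative f (at x)) (at x)"
  by (simp add: frechet_derivative_works[symmetric] smooth_on_differentiable)

lemma smooth_on_continuous_on: "smooth_on S f \<Longrightarrow> continuous_on S f"
  unfolding smooth_on_def by (metis Ck_on.simps(1))

section \<open>Symmetry of second derivatives\<close>

lemma has_real_derivative_line:
  fixes f :: "'a::real_normed_vector \<Rightarrow> real"
  assumes "(f has_derivative f') (at (y + s *\<^sub>R u))"
  shows "((\<lambda>s. f (y + s *\<^sub>R u)) has_real_derivative f' u) (at s)"
proof -
  have "((\<lambda>s. y + s *\<^sub>R u) has_derivative (\<lambda>d. d *\<^sub>R u)) (at s)"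
    by (auto intro!: derivative_eq_intros)
  from diff_chain_at[OF this assms]
  have "((\<lambda>s. f (y + s *\<^sub>R u)) has_derivative (\<lambda>d. f' (d *\<^sub>R u))) (at s)" by (simp add: o_def)
  moreover have "linear f'" using assms has_derivative_bounded_linear bounded_linear.linear by blast
  moreover have "(\<lambda>d. d * f' u) = (*) (f' u)" by (auto simp: fun_eq_iff)
  ultimately show ?thesis by (simp add: has_field_derivative_def linear_scale)
qed

text \<open>The mean value theorem twice: along \<open>u\<close> for the increment in direction
  \<open>v\<close>, then along \<open>v\<close> for the derivative in direction
  \<open>u\<close>.\<close>

lemma second_difference:
  fixes f :: "'a::real_normed_vector \<Rightarrow> real"
  assumes S: "smooth_on S f" and h: "h > 0"
    and in_S: "\<And>s t. 0 \<le> s \<Longrightarrow> s \<le> h \<Longrightarrow> 0 \<le> t \<Longrightarrow> t \<le> h \<Longrightarrow> x + s *\<^sub>R u + t *\<^sub>R v \<in> S"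
  shows "\<exists>s t. 0 \<le> s \<and> s \<le> h \<and> 0 \<le> t \<and> t \<le> h \<and>
    f (x + h *\<^sub>R u + h *\<^sub>R v) - f (x + h *\<^sub>R u) - f (x + h *\<^sub>R v) + f x =
    h * h * frechet_derivative (\<lambda>y. frechet_derivative f (at y) u) (at (x + s *\<^sub>R u + t *\<^sub>R v)) v"
proof -
  define F where "F = (\<lambda>y. frechet_derivative f (at y) u)"
  have F: "smooth_on S F" unfolding F_def by (rule smooth_on_frechet_derivative[OF S])
  have d: "((\<lambda>s. f (x + s *\<^sub>R u + h *\<^sub>R v) - f (x + s *\<^sub>R u)) has_real_derivative
      F (x + s *\<^sub>R u + h *\<^sub>R v) - F (x + s *\<^sub>R u)) (at s)" if s: "0 \<le> s" "s \<le> h" for s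
  proof -
    have "(f has_derivative frechet_derivative f (at (x + h *\<^sub>R v + s *\<^sub>R u))) (at (x + h *\<^sub>R v + s *\<^sub>R u))"
      using s h in_S[of s h] by (intro smooth_on_has_derivative[OF S]) (auto simp: algebra_simps)
    from has_real_derivative_line[OF this]
    have 1: "((\<lambda>s. f (x + s *\<^sub>R u + h *\<^sub>R v)) has_real_derivative F (x + s *\<^sub>R u + h *\<^sub>R v)) (at s)"
      by (simp add: F_def algebra_simps)
    have "(f has_derivative frechet_derivative f (at (x + s *\<^sub>R u))) (at (x + s *\<^sub>R u))"
      using s h in_S[of s 0] by (intro smooth_on_has_derivative[OF S]) auto
    from DERIV_diff[OF 1 has_real_derivative_line[OF this]] show ?thesis
      by (simp add: F_def)
  qed
  from MVT2[OF h d] obtain s where s: "0 < s" "s < h"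
    "f (x + h *\<^sub>R u + h *\<^sub>R v) - f (x + h *\<^sub>R u) - (f (x + h *\<^sub>R v) - f x) =
      h * (F (x + s *\<^sub>R u + h *\<^sub>R v) - F (x + s *\<^sub>R u))" by auto
  have "((\<lambda>t. F (x + s *\<^sub>R u + t *\<^sub>R v)) has_real_derivative
     frechet_derivative F (at (x + s *\<^sub>R u + t *\<^sub>R v)) v) (at t)" if "0 \<le> t" "t \<le> h" for t
    using that s in_S[of s t] by (intro has_real_derivative_line smooth_on_has_derivative[OF F]) auto
  from MVT2[OF h this] obtain t where t: "0 < t" "t < h"
    "F (x + s *\<^sub>R u + h *\<^sub>R v) - F (x + s *\<^sub>R u) = h * frechet_derivative F (at (x + s *\<^sub>R u + t *\<^sub>R v)) v"
    by auto
  show ?thesis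
    using s t by (intro exI[of _ s] exI[of _ t]) (auto simp: F_def)
qed

text \<open>The second difference is symmetric in \<open>u\<close> and \<open>v\<close>, while
  divided by the square of the step it tends to either mixed derivative, since both are
  continuous.\<close>

lemma frechet_derivative_commute:
  fixes f :: "'a::real_normed_vector \<Rightarrow> real"
  assumes S: "open S" "smooth_on S f" "x \<in> S"
  shows "frechet_derivative (\<lambda>y. frechet_derivative f (at y) u) (at x) v =
    frechet_derivative (\<lambda>y. frechet_derivative f (at y) v) (at x) u"
proof -
  define G where "G = (\<lambda>u v y. frechet_derivative (\<lambda>y. frechet_derivative f (at y) u) (at y) v)"
  have close: "\<exists>h0>0. \<forall>h. 0 < h \<and> h \<le> h0 \<longrightarrow>
      \<bar>f (x + h *\<^sub>R u + h *\<^sub>R v) - f (x + h *\<^sub>R u) - f (x + h *\<^sub>R v) + f x - h * h * G u v x\<bar> \<le> h * h * e"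
    if e: "e > 0" for u v e
  proof -
    have "smooth_on S (G u v)" unfolding G_def by (intro smooth_on_frechet_derivative S)
    then have "isCont (G u v) x"
      using smooth_on_continuous_on S continuous_on_eq_continuous_at by blast
    then obtain d1 where d1: "d1 > 0" "\<And>y. dist y x < d1 \<Longrightarrow> \<bar>G u v y - G u v x\<bar> < e"
      using e unfolding continuous_at dist_real_def by (auto simp: continuous_at_eps_delta dist_real_def tendsto_iff eventually_at) (metis e dist_self abs_zero diff_self)
    obtain d2 where d2: "d2 > 0" "ball x d2 \<subseteq> S" using S open_contains_ball by blast
    \<comment> \<open>Keeps the whole parallelogram spanned by \<open>h0 *\<^sub>R u\<close> and
      \<open>h0 *\<^sub>R v\<close> within \<open>d1\<close> of \<open>x\<close>, for continuity,
      and within \<open>d2\<close>, to stay in \<open>S\<close>. The summand 1 makes the denominator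
      positive and the estimate strict.\<close>
    define h0 where "h0 = min d1 d2 / (norm u + norm v + 1)"
    have h0: "h0 > 0" using d1 d2 by (simp add: h0_def add_nonneg_pos)
    have near: "dist (x + s *\<^sub>R u + t *\<^sub>R v) x < min d1 d2" if "0 \<le> s" "s \<le> h0" "0 \<le> t" "t \<le> h0" for s t
    proof -
      have "dist (x + s *\<^sub>R u + t *\<^sub>R v) x = norm (s *\<^sub>R u + t *\<^sub>R v)"
        by (simp add: dist_norm add.assoc)
      also have "\<dots> \<le> norm (s *\<^sub>R u) + norm (t *\<^sub>R v)" by (rule norm_triangle_ineq)
      also have "\<dots> \<le> h0 * norm u + h0 * norm v" using that by (simp add: add_mono mult_right_mono)
      also have "\<dots> < h0 * (norm u + norm v + 1)" using h0 by (simp add: algebra_simps)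
      also have "\<dots> = min d1 d2" unfolding h0_def
        by (metis add_nonneg_pos add_nonneg_nonneg less_irrefl nonzero_divide_eq_eq norm_ge_zero zero_less_one)
      finally show ?thesis .
    qed
    have "\<bar>f (x + h *\<^sub>R u + h *\<^sub>R v) - f (x + h *\<^sub>R u) - f (x + h *\<^sub>R v) + f x - h * h * G u v x\<bar> \<le> h * h * e"
      if h: "0 < h" "h \<le> h0" for h
    proof -
      have "x + s *\<^sub>R u + t *\<^sub>R v \<in> S" if "0 \<le> s" "s \<le> h" "0 \<le> t" "t \<le> h" for s t
        using near[of s t] that h d2 by (auto simp: subset_eq dist_commute)
      from second_difference[OF S(2) h(1) this] obtain s t where st: "0 \<le> s" "s \<le> h" "0 \<le> t" "t \<le> h"
        "f (x + h *\<^sub>R u + h *\<^sub>R v) - f (x + h *\<^sub>R u) - f (x + h *\<^sub>R v) + f x = h * h * G u v (x + s *\<^sub>R u + t *\<^sub>R v)"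
        unfolding G_def by blast
      have "\<bar>G u v (x + s *\<^sub>R u + t *\<^sub>R v) - G u v x\<bar> < e"
        using near[of s t] st h by (intro d1) auto
      then have "\<bar>h * h * (G u v (x + s *\<^sub>R u + t *\<^sub>R v) - G u v x)\<bar> \<le> h * h * e"
        using h by (simp add: abs_mult)
      then show ?thesis using st by (simp add: algebra_simps)
    qed
    then show ?thesis using h0 by blast
  qed
  have "\<bar>G u v x - G v u x\<bar> \<le> 2 * e" if e: "e > 0" for e
  proof -
    from close[OF e, of u v] obtain h1 where h1: "h1 > 0" "\<forall>h. 0 < h \<and> h \<le> h1 \<longrightarrow>
      \<bar>f (x + h *\<^sub>R u + h *\<^sub>R v) - f (x + h *\<^sub>R u) - f (x + h *\<^sub>R v) + f x - h * h * G u v x\<bar> \<le> h * h * e" by blast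
    from close[OF e, of v u] obtain h2 where h2: "h2 > 0" "\<forall>h. 0 < h \<and> h \<le> h2 \<longrightarrow>
      \<bar>f (x + h *\<^sub>R v + h *\<^sub>R u) - f (x + h *\<^sub>R v) - f (x + h *\<^sub>R u) + f x - h * h * G v u x\<bar> \<le> h * h * e" by blast
    define h where "h = min h1 h2"
    have h: "0 < h" "h \<le> h1" "h \<le> h2" using h1 h2 by (auto simp: h_def)
    define D where "D = f (x + h *\<^sub>R u + h *\<^sub>R v) - f (x + h *\<^sub>R u) - f (x + h *\<^sub>R v) + f x"
    have "\<bar>D - h * h * G u v x\<bar> \<le> h * h * e" "\<bar>D - h * h * G v u x\<bar> \<le> h * h * e"
      using h1(2)[rule_format, of h] h2(2)[rule_format, of h] h by (simp_all add: D_def algebra_simps)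
    then have "\<bar>h * h * (G u v x - G v u x)\<bar> \<le> h * h * (2 * e)" unfolding right_diff_distrib by linarith
    then have "h * h * \<bar>G u v x - G v u x\<bar> \<le> h * h * (2 * e)" using h by (simp add: abs_mult)
    then show ?thesis using h by simp
  qed
  then have "\<bar>G u v x - G v u x\<bar> \<le> e" if "e > 0" for e
    using that by (metis half_gt_zero mult_2 field_sum_of_halves)
  then have "G u v x = G v u x"
    by (metis abs_le_zero_iff dense_ge eq_iff_diff_eq_0 zero_less_abs_iff less_irrefl linorder_not_le)
  then show ?thesis by (simp add: G_def)
qed

section \<open>Flat functions and bump functions\<close>

text \<open>The family is closed under differentiation, which makes each member smooth.\<close>

definition flat :: "nat \<Rightarrow> real \<Rightarrow> real"
  where "flat n t = (if t > 0 then (1 / t) ^ n * exp (- (1 / t)) else 0)"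

text \<open>From the right, the substitution of 1/t turns this into a power against an exponential
  at infinity; from the left the function is 0.\<close>

lemma flat_tendsto_0: "(flat n \<longlongrightarrow> 0) (at 0)"
proof -
  have "((\<lambda>t. inverse t ^ n / exp (inverse t)) \<longlongrightarrow> 0) (at_right (0::real))"
    using filterlim_compose[OF tendsto_power_div_exp_0 filterlim_inverse_at_top_right] .
  then have "(flat n \<longlongrightarrow> 0) (at_right 0)"
    by (rule Lim_transform_eventually)
      (auto simp: flat_def eventually_at_right_less exp_minus field_simps inverse_eq_divide intro!: eventually_at_rightI[of 0 1])
  moreover have "(flat n \<longlongrightarrow> 0) (at_left 0)"
    by (rule Lim_transform_eventually[OF tendsto_const])
      (auto simp: flat_def intro!: eventually_at_leftI[of "-1"])
  ultimately show ?thesis by (simp add: filterlim_split_at)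
qed

lemma flat_has_derivative:
  "(flat n has_real_derivative flat (n + 2) t - n * flat (n + 1) t) (at t)"
proof (cases t "0::real" rule: linorder_cases)
  case less
  have "((\<lambda>_. 0) has_real_derivative 0) (at t)" by simp
  then have "(flat n has_real_derivative 0) (at t)"
    by (rule has_field_derivative_transform_within_open[of _ _ _ "{..<0}"]) (use less in \<open>auto simp: flat_def\<close>)
  then show ?thesis using less by (simp add: flat_def)
next
  case equal
  \<comment> \<open>The difference quotient of \<open>flat n\<close> at 0 is
    \<open>flat (Suc n)\<close>, whose limit is already known.\<close>
  have "(\<lambda>h. (flat n (0 + h) - flat n 0) / h) \<midarrow>0\<rightarrow> 0"
    by (rule Lim_transform_eventually[OF flat_tendsto_0[of "Suc n"]])
      (auto simp: flat_def intro!: eventuallyI)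
  then have "(flat n has_real_derivative 0) (at 0)" unfolding DERIV_def .
  then show ?thesis using equal by (simp add: flat_def)
next
  case greater
  have "((\<lambda>t. (1 / t) ^ n * exp (- (1 / t))) has_real_derivative
      (1 / t) ^ (n + 2) * exp (- (1 / t)) - n * ((1 / t) ^ (n + 1) * exp (- (1 / t)))) (at t)"
    using greater by (cases n) (auto intro!: derivative_eq_intros simp: field_simps power2_eq_square, metis One_nat_def power_eq_if)
  then have "(flat n has_real_derivative
      (1 / t) ^ (n + 2) * exp (- (1 / t)) - n * ((1 / t) ^ (n + 1) * exp (- (1 / t)))) (at t)"
    by (rule has_field_derivative_transform_within_open[of _ _ _ "{0<..}"]) (use greater in \<open>auto simp: flat_def\<close>)
  then show ?thesis using greater by (simp add: flat_def)
qed

lemma smooth_on_flat: "smooth_on UNIV (flat n)"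
proof -
  have "Ck_on k UNIV (flat n)" for k
  proof (induction k arbitrary: n)
    case 0
    then show ?case
      using DERIV_isCont[OF flat_has_derivative] by (simp add: continuous_at_imp_continuous_on)
  next
    case (Suc k)
    have "Ck_on k UNIV (\<lambda>t. (flat (n + 2) t + (- real n) * flat (n + 1) t) * v)" for v
      by (intro Ck_on_bounded_linear[OF open_UNIV bounded_linear_mult_left] Ck_on_add
          Ck_on_bounded_linear[OF open_UNIV bounded_linear_mult_right] open_UNIV Suc.IH)
    then show ?case
      by (intro Ck_on_SucI[OF open_UNIV flat_has_derivative[unfolded has_field_derivative_def]]) auto
  qed
  then show ?thesis by (simp add: smooth_on_def)
qed

text \<open>With s = |y - x|^2 / r^2, the inner term \<open>flat 0 (s - 1/2)\<close> is 0 for s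
  \<le> 1/2 and at least \<open>flat 0 (1/2)\<close> for s \<ge> 1. So the outer
  \<open>flat 0\<close> is at its plateau in the first case, which contains the ball of radius r/2,
  and is 0 in the second. The denominator is a constant normalising the plateau to 1, so smoothness
  involves no quotient of functions.\<close>

definition bump :: "'a::real_inner \<Rightarrow> real \<Rightarrow> 'a \<Rightarrow> real"
  where "bump x r y = flat 0 (flat 0 (1/2) - flat 0 ((y - x) \<bullet> (y - x) / r\<^sup>2 - 1/2)) / flat 0 (flat 0 (1/2))"

lemma bump_smooth: "smooth_on UNIV (bump (x :: 'a::finite_dim_inner) r)"
proof -
  have f: "smooth_on UNIV (\<lambda>y. flat 0 (g y))" if "smooth_on UNIV g" for g :: "'a \<Rightarrow> real"
    by (rule smooth_on_compose[OF open_UNIV open_UNIV subset_UNIV smooth_on_flat that])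
  have s: "smooth_on UNIV (\<lambda>y. y + - x)"
    by (intro smooth_on_add smooth_on_ident smooth_on_const open_UNIV)
  have 1: "smooth_on UNIV (\<lambda>y. (y + - x) \<bullet> (y + - x) * (1 / r\<^sup>2) + - (1/2))"
    by (intro smooth_on_add smooth_on_const open_UNIV smooth_on_bounded_linear[OF open_UNIV bounded_linear_mult_left]
        smooth_on_bilinear[OF open_UNIV bounded_bilinear_inner] s)
  have "smooth_on UNIV (\<lambda>y. flat 0 (flat 0 (1/2) + (- 1) * flat 0 ((y + - x) \<bullet> (y + - x) * (1 / r\<^sup>2) + - (1/2))) * (1 / flat 0 (flat 0 (1/2))))"
    by (intro f smooth_on_add smooth_on_const open_UNIV smooth_on_bounded_linear[OF open_UNIV bounded_linear_mult_left]
        smooth_on_bounded_linear[OF open_UNIV bounded_linear_mult_right] 1)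
  then show ?thesis by (simp add: bump_def[abs_def])
qed

lemma flat_0: "t > 0 \<Longrightarrow> flat 0 t > 0" "t \<le> 0 \<Longrightarrow> flat 0 t = 0" "0 < s \<Longrightarrow> s \<le> t \<Longrightarrow> flat 0 s \<le> flat 0 t"
  by (auto simp: flat_def frac_le)

lemma bump_eq_1: "r > 0 \<Longrightarrow> norm (y - x) \<le> r / 2 \<Longrightarrow> bump x r y = 1"
proof -
  assume r: "r > 0" "norm (y - x) \<le> r / 2"
  then have "(norm (y - x))\<^sup>2 \<le> (r / 2)\<^sup>2" by (intro power_mono) auto
  then have "(y - x) \<bullet> (y - x) / r\<^sup>2 - 1/2 \<le> 0"
    using r inner_ge_zero[of "y - x"] by (simp add: power2_norm_eq_inner power_divide divide_le_eq del: inner_ge_zero)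
  then have "flat 0 ((y - x) \<bullet> (y - x) / r\<^sup>2 - 1/2) = 0" by (rule flat_0)
  moreover have "flat 0 (flat 0 (1/2)) > 0" by (intro flat_0) simp
  ultimately show ?thesis by (simp add: bump_def)
qed

lemma bump_eq_0: "r > 0 \<Longrightarrow> norm (y - x) \<ge> r \<Longrightarrow> bump x r y = 0"
proof -
  assume r: "r > 0" "norm (y - x) \<ge> r"
  then have "(norm (y - x))\<^sup>2 \<ge> r\<^sup>2" by (intro power_mono) auto
  then have "(y - x) \<bullet> (y - x) / r\<^sup>2 - 1/2 \<ge> 1/2"
    using r by (simp add: power2_norm_eq_inner field_simps)
  then have "flat 0 (1/2) \<le> flat 0 ((y - x) \<bullet> (y - x) / r\<^sup>2 - 1/2)" by (intro flat_0) auto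
  then show ?thesis by (simp add: bump_def flat_0)
qed

section \<open>Smooth functions on manifolds\<close>

text \<open>Smoothness of vector-valued functions on a part \<open>X\<close> of the manifold, so
  that local arguments can stay in the original atlas without passing to open submanifolds.\<close>

definition msmooth :: "('m, 'e::finite_dim_inner) atlas \<Rightarrow> 'm set \<Rightarrow> ('m \<Rightarrow> 'b::real_normed_vector) \<Rightarrow> bool"
  where "msmooth M X f \<longleftrightarrow> (\<forall>(U, \<phi>)\<in>M. smooth_on (\<phi> ` (U \<inter> X)) (f \<circ> inv_into U \<phi>))"

text \<open>Charts compatible with the atlas, whether or not they belong to it.\<close>

definition gchart :: "('m, 'e::finite_dim_inner) atlas \<Rightarrow> 'm set \<Rightarrow> ('m \<Rightarrow> 'e) \<Rightarrow> bool"
  where "gchart M U \<phi> \<longleftrightarrow> mfd_open M U \<and> inj_on \<phi> U \<and> msmooth M U \<phi> \<and>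
    (\<forall>(V, \<psi>)\<in>M. open (\<phi> ` (U \<inter> V)) \<and> smooth_on (\<phi> ` (U \<inter> V)) (\<psi> \<circ> inv_into U \<phi>))"

lemma chart_subset_carrier: "(U, \<phi>) \<in> M \<Longrightarrow> U \<subseteq> carrier M"
  by (force simp: carrier_def)

lemma chartE:
  assumes "x \<in> carrier M"
  obtains U \<phi> where "(U, \<phi>) \<in> M" "x \<in> U"
  using assms by (force simp: carrier_def)

text \<open>Splits smoothness between manifolds into openness of the preimages of chart domains and
  smoothness of vector-valued functions. Sections of the tangent bundle and of the bundle of affine
  functions are treated in this form.\<close>

lemma smooth_map_iff:
  "smooth_map M N f \<longleftrightarrow> f ` carrier M \<subseteq> carrier N \<and>
    (\<forall>(V, \<psi>)\<in>N. mfd_open M (carrier M \<inter> f -` V) \<and> msmooth M (carrier M \<inter> f -` V) (\<psi> \<circ> f))"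
proof -
  have "U \<inter> (carrier M \<inter> X) = U \<inter> X" if "(U, \<phi>) \<in> M" for U \<phi> X
    using chart_subset_carrier[OF that] by blast
  then show ?thesis
    unfolding smooth_map_def mfd_open_def msmooth_def by (fastforce simp: o_assoc)
qed

lemma smooth_functions_iff: "f \<in> smooth_functions M \<longleftrightarrow> mfd_open M (carrier M) \<and> msmooth M (carrier M) f"
  by (simp add: smooth_functions_def smooth_map_iff linear_atlas_def carrier_def)

lemma mfd_open_image: "mfd_open M X \<Longrightarrow> (U, \<phi>) \<in> M \<Longrightarrow> open (\<phi> ` (U \<inter> X))"
  by (auto simp: mfd_open_def)

lemma mfd_open_subset: "mfd_open M X \<Longrightarrow> X \<subseteq> carrier M"
  by (simp add: mfd_open_def)

lemma msmooth_mono: "msmooth M X f \<Longrightarrow> Y \<subseteq> X \<Longrightarrow> msmooth M Y f"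
  unfolding msmooth_def by (fast intro: smooth_on_subset)

lemma msmooth_const: "msmooth M X (\<lambda>x. c)"
  unfolding msmooth_def by (auto simp: o_def smooth_on_const)

section \<open>Open sets and smooth functions\<close>

locale mfd =
  fixes M :: "('m, 'e::finite_dim_inner) atlas"
  assumes smooth_manifold: "smooth_manifold M"
begin

lemma chart_inj: "(U, \<phi>) \<in> M \<Longrightarrow> inj_on \<phi> U"
  using smooth_manifold unfolding smooth_manifold_def by auto

lemma open_chart: "(U, \<phi>) \<in> M \<Longrightarrow> mfd_open M U"
  using smooth_manifold unfolding smooth_manifold_def mfd_open_def
  by (auto dest: chart_subset_carrier)

lemma open_carrier: "mfd_open M (carrier M)"
proof -
  have "U \<inter> carrier M = U" if "(U, \<phi>) \<in> M" for U \<phi>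
    using chart_subset_carrier[OF that] by blast
  then show ?thesis using smooth_manifold unfolding smooth_manifold_def mfd_open_def by force
qed

lemma chart_image_Int: "(U, \<phi>) \<in> M \<Longrightarrow> \<phi> ` (U \<inter> (X \<inter> Y)) = \<phi> ` (U \<inter> X) \<inter> \<phi> ` (U \<inter> Y)"
  using chart_inj unfolding inj_on_def by blast

lemma open_Int: "mfd_open M X \<Longrightarrow> mfd_open M Y \<Longrightarrow> mfd_open M (X \<inter> Y)"
  unfolding mfd_open_def by (fastforce simp: chart_image_Int)

lemma open_Union: "(\<And>X. X \<in> \<X> \<Longrightarrow> mfd_open M X) \<Longrightarrow> mfd_open M (\<Union>\<X>)"
proof -
  assume *: "\<And>X. X \<in> \<X> \<Longrightarrow> mfd_open M X"
  have "open (\<phi> ` (U \<inter> \<Union>\<X>))" if "(U, \<phi>) \<in> M" for U \<phi>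
  proof -
    have "\<phi> ` (U \<inter> \<Union>\<X>) = (\<Union>X\<in>\<X>. \<phi> ` (U \<inter> X))" by blast
    moreover have "open (\<Union>X\<in>\<X>. \<phi> ` (U \<inter> X))" by (intro open_UN ballI mfd_open_image[OF * that])
    ultimately show ?thesis by simp
  qed
  moreover have "\<Union>\<X> \<subseteq> carrier M" using * mfd_open_subset by blast
  ultimately show ?thesis unfolding mfd_open_def by blast
qed

lemma openI: "(\<And>x. x \<in> X \<Longrightarrow> \<exists>Y. mfd_open M Y \<and> x \<in> Y \<and> Y \<subseteq> X) \<Longrightarrow> mfd_open M X"
proof -
  assume *: "\<And>x. x \<in> X \<Longrightarrow> \<exists>Y. mfd_open M Y \<and> x \<in> Y \<and> Y \<subseteq> X"
  then have "X = \<Union>{Y. mfd_open M Y \<and> Y \<subseteq> X}" by blast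
  then show ?thesis using open_Union[of "{Y. mfd_open M Y \<and> Y \<subseteq> X}"] by auto
qed

lemma openin_mfd: "openin (topology (mfd_open M)) = mfd_open M"
  by (rule topology_inverse') (auto simp: istopology_def intro: open_Int open_Union)

lemma topspace_mfd: "topspace (topology (mfd_open M)) = carrier M"
  unfolding topspace_def openin_mfd using open_carrier by (auto dest: mfd_open_subset)

lemma msmooth_local:
  assumes "\<And>x. x \<in> X \<Longrightarrow> \<exists>Y. mfd_open M Y \<and> x \<in> Y \<and> msmooth M Y f"
  shows "msmooth M X f"
  unfolding msmooth_def
proof clarify
  fix U \<phi> assume U: "(U, \<phi>) \<in> M"
  show "smooth_on (\<phi> ` (U \<inter> X)) (f \<circ> inv_into U \<phi>)"
  proof (rule smooth_on_local)
    fix y assume "y \<in> \<phi> ` (U \<inter> X)"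
    then obtain x where x: "x \<in> U" "x \<in> X" "y = \<phi> x" by auto
    obtain Y where Y: "mfd_open M Y" "x \<in> Y" "msmooth M Y f" using assms[OF x(2)] by blast
    show "\<exists>T. open T \<and> y \<in> T \<and> smooth_on T (f \<circ> inv_into U \<phi>)"
      using Y x U by (intro exI[of _ "\<phi> ` (U \<inter> Y)"]) (auto simp: mfd_open_image msmooth_def)
  qed
qed

lemma msmooth_cong: "mfd_open M X \<Longrightarrow> (\<And>x. x \<in> X \<Longrightarrow> f x = g x) \<Longrightarrow> msmooth M X f \<Longrightarrow> msmooth M X g"
  unfolding msmooth_def
  by clarify (rule smooth_on_cong[of _ "f \<circ> inv_into _ _"], auto simp: mfd_open_image chart_inj)

lemma msmooth_compose:
  fixes f :: "'m \<Rightarrow> 'b::finite_dim_inner"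
  assumes "mfd_open M X" "open T" "f ` X \<subseteq> T" "smooth_on T g" "msmooth M X f"
  shows "msmooth M X (\<lambda>x. g (f x))"
  unfolding msmooth_def o_def
proof clarify
  fix U \<phi> assume U: "(U, \<phi>) \<in> M"
  have "(\<lambda>x. f (inv_into U \<phi> x)) ` (\<phi> ` (U \<inter> X)) \<subseteq> T" using assms(3) chart_inj[OF U] by auto
  moreover have "smooth_on (\<phi> ` (U \<inter> X)) (\<lambda>x. f (inv_into U \<phi> x))"
    using assms(5) U unfolding msmooth_def o_def by blast
  ultimately show "smooth_on (\<phi> ` (U \<inter> X)) (\<lambda>x. g (f (inv_into U \<phi> x)))"
    using smooth_on_compose[OF mfd_open_image[OF assms(1) U] assms(2) _ assms(4)] by blast
qed

lemma msmooth_bounded_linear: "mfd_open M X \<Longrightarrow> bounded_linear h \<Longrightarrow> msmooth M X f \<Longrightarrow> msmooth M X (\<lambda>x. h (f x))"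
  unfolding msmooth_def o_def
  by clarify (rule smooth_on_bounded_linear, auto simp: mfd_open_image)

lemma msmooth_add: "mfd_open M X \<Longrightarrow> msmooth M X f \<Longrightarrow> msmooth M X g \<Longrightarrow> msmooth M X (\<lambda>x. f x + g x)"
  unfolding msmooth_def o_def
  by clarify (rule smooth_on_add, auto simp: mfd_open_image)

lemma msmooth_sum: "mfd_open M X \<Longrightarrow> (\<And>i. i \<in> I \<Longrightarrow> msmooth M X (f i)) \<Longrightarrow> msmooth M X (\<lambda>x. \<Sum>i\<in>I. f i x)"
  unfolding msmooth_def o_def
  by clarify (rule smooth_on_sum, auto simp: mfd_open_image)

lemma msmooth_bilinear:
  "mfd_open M X \<Longrightarrow> bounded_bilinear h \<Longrightarrow> msmooth M X f \<Longrightarrow> msmooth M X g \<Longrightarrow> msmooth M X (\<lambda>x. h (f x) (g x))"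
  unfolding msmooth_def o_def
  by clarify (rule smooth_on_bilinear, auto simp: mfd_open_image)

lemma msmooth_Pair: "mfd_open M X \<Longrightarrow> msmooth M X f \<Longrightarrow> msmooth M X g \<Longrightarrow> msmooth M X (\<lambda>x. (f x, g x))"
  unfolding msmooth_def o_def
  by clarify (rule smooth_on_Pair, auto simp: mfd_open_image)

lemma msmooth_uminus: "mfd_open M X \<Longrightarrow> msmooth M X f \<Longrightarrow> msmooth M X (\<lambda>x. - f x)"
  by (rule msmooth_bounded_linear[OF _ bounded_linear_minus[OF bounded_linear_ident]])

lemma msmooth_diff: "mfd_open M X \<Longrightarrow> msmooth M X f \<Longrightarrow> msmooth M X g \<Longrightarrow> msmooth M X (\<lambda>x. f x - g x)"
  using msmooth_add[of X f "\<lambda>x. - g x"] msmooth_uminus[of X g] by simp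

lemmas msmooth_mult = msmooth_bilinear[OF _ bounded_bilinear_mult]
lemmas msmooth_scaleR = msmooth_bilinear[OF _ bounded_bilinear_scaleR]
lemmas msmooth_inner = msmooth_bilinear[OF _ bounded_bilinear_inner]

lemma open_vimage: "mfd_open M X \<Longrightarrow> msmooth M X f \<Longrightarrow> open T \<Longrightarrow> mfd_open M (X \<inter> f -` T)"
  unfolding mfd_open_def[of M "X \<inter> f -` T"]
proof safe
  assume X: "mfd_open M X" and f: "msmooth M X f" and T: "open T"
  show "x \<in> carrier M" if "x \<in> X" for x using that X mfd_open_subset by blast
  fix U \<phi> assume U: "(U, \<phi>) \<in> M"
  have "\<phi> ` (U \<inter> (X \<inter> f -` T)) = \<phi> ` (U \<inter> X) \<inter> (f \<circ> inv_into U \<phi>) -` T"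
    using chart_inj[OF U] by auto
  moreover have "open (\<phi> ` (U \<inter> X) \<inter> (f \<circ> inv_into U \<phi>) -` T)"
    using X f T U by (intro continuous_open_preimage smooth_on_continuous_on) (auto simp: mfd_open_image msmooth_def)
  ultimately show "open (\<phi> ` (U \<inter> (X \<inter> f -` T)))" by simp
qed

lemma smooth_functions_iff: "f \<in> smooth_functions M \<longleftrightarrow> msmooth M (carrier M) f"
  by (simp add: smooth_functions_iff open_carrier)

lemma smooth_functions_msmooth: "f \<in> smooth_functions M \<Longrightarrow> X \<subseteq> carrier M \<Longrightarrow> msmooth M X f"
  using smooth_functions_iff msmooth_mono by blast

lemma smooth_const: "(\<lambda>x. c) \<in> smooth_functions M"
  by (simp add: smooth_functions_iff msmooth_const)

lemma smooth_add: "f \<in> smooth_functions M \<Longrightarrow> g \<in> smooth_functions M \<Longrightarrow> (\<lambda>x. f x + g x) \<in> smooth_functions M"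
  by (simp add: smooth_functions_iff msmooth_add open_carrier)

lemma smooth_diff: "f \<in> smooth_functions M \<Longrightarrow> g \<in> smooth_functions M \<Longrightarrow> (\<lambda>x. f x - g x) \<in> smooth_functions M"
  by (simp add: smooth_functions_iff msmooth_diff open_carrier)

lemma smooth_mult: "f \<in> smooth_functions M \<Longrightarrow> g \<in> smooth_functions M \<Longrightarrow> (\<lambda>x. f x * g x) \<in> smooth_functions M"
  by (simp add: smooth_functions_iff msmooth_mult open_carrier)

lemma smooth_uminus: "f \<in> smooth_functions M \<Longrightarrow> (\<lambda>x. - f x) \<in> smooth_functions M"
  by (simp add: smooth_functions_iff msmooth_uminus open_carrier)

lemma smooth_sum: "(\<And>i. i \<in> I \<Longrightarrow> f i \<in> smooth_functions M) \<Longrightarrow> (\<lambda>x. \<Sum>i\<in>I. f i x) \<in> smooth_functions M"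
  by (simp add: smooth_functions_iff msmooth_sum open_carrier)

lemma smooth_cong: "f \<in> smooth_functions M \<Longrightarrow> (\<And>x. x \<in> carrier M \<Longrightarrow> f x = g x) \<Longrightarrow> g \<in> smooth_functions M"
  using msmooth_cong[OF open_carrier, of f g] by (simp add: smooth_functions_iff)

lemma chart_transition:
  assumes "(U, \<phi>) \<in> M" "(V, \<psi>) \<in> M"
  shows "open (\<phi> ` (U \<inter> V))" "smooth_on (\<phi> ` (U \<inter> V)) (\<psi> \<circ> inv_into U \<phi>)"
  using smooth_manifold assms unfolding smooth_manifold_def by blast+

section \<open>Compatible charts\<close>

lemma gchart_chart:
  assumes U: "(U, \<phi>) \<in> M"
  shows "gchart M U \<phi>"
  unfolding gchart_def msmooth_def
  using open_chart[OF U] chart_inj[OF U] chart_transition[OF U] chart_transition[OF _ U] by blast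

lemma gchart_subset: "gchart M U \<phi> \<Longrightarrow> U \<subseteq> carrier M"
  by (simp add: gchart_def mfd_open_def)

lemma gchart_inj: "gchart M U \<phi> \<Longrightarrow> inj_on \<phi> U"
  by (simp add: gchart_def)

lemma gchart_open: "gchart M U \<phi> \<Longrightarrow> mfd_open M U"
  by (simp add: gchart_def)

lemma gchart_msmooth: "gchart M U \<phi> \<Longrightarrow> msmooth M U \<phi>"
  by (simp add: gchart_def)

lemma gchart_transition:
  assumes "gchart M U \<phi>" "(V, \<psi>) \<in> M"
  shows "open (\<phi> ` (U \<inter> V))" "smooth_on (\<phi> ` (U \<inter> V)) (\<psi> \<circ> inv_into U \<phi>)"
  using assms unfolding gchart_def by blast+

text \<open>Near each of its points the image contains the preimage of an open set under the
  continuous transition map to a chart of the atlas.\<close>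

lemma gchart_open_image:
  assumes U: "gchart M U \<phi>" and X: "mfd_open M X"
  shows "open (\<phi> ` (U \<inter> X))"
proof (subst open_subopen, intro ballI)
  fix y assume "y \<in> \<phi> ` (U \<inter> X)"
  then obtain x where x: "x \<in> U" "x \<in> X" "y = \<phi> x" by auto
  obtain V \<psi> where V: "(V, \<psi>) \<in> M" "x \<in> V"
    by (rule chartE[OF subsetD[OF gchart_subset[OF U] x(1)]])
  let ?P = "\<phi> ` (U \<inter> V) \<inter> (\<psi> \<circ> inv_into U \<phi>) -` (\<psi> ` (V \<inter> X))"
  have "?P \<subseteq> \<phi> ` (U \<inter> X)"
  proof clarify
    fix z w assume z: "z \<in> U" "z \<in> V" "w \<in> V" "w \<in> X" "(\<psi> \<circ> inv_into U \<phi>) (\<phi> z) = \<psi> w"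
    then have "z = w" using inj_onD[OF chart_inj[OF V(1)], of z w] gchart_inj[OF U] by simp
    then show "\<phi> z \<in> \<phi> ` (U \<inter> X)" using z by simp
  qed
  moreover have "y \<in> ?P" using x V gchart_inj[OF U] by simp
  moreover have "open ?P"
    by (intro continuous_open_preimage smooth_on_continuous_on gchart_transition[OF U V(1)] mfd_open_image[OF X V(1)])
  ultimately show "\<exists>T. open T \<and> y \<in> T \<and> T \<subseteq> \<phi> ` (U \<inter> X)" by blast
qed

lemma gchart_open_range: "gchart M U \<phi> \<Longrightarrow> open (\<phi> ` U)"
  using gchart_open_image[OF _ open_carrier] gchart_subset by (metis inf.orderE)

text \<open>Locally, \<open>f\<close> read in the compatible chart is \<open>f\<close> read in a
  chart of the atlas composed with a smooth transition map.\<close>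

lemma gchart_smooth:
  assumes U: "gchart M U \<phi>" and X: "mfd_open M X" and f: "msmooth M X f"
  shows "smooth_on (\<phi> ` (U \<inter> X)) (f \<circ> inv_into U \<phi>)"
proof (rule smooth_on_local)
  fix y assume "y \<in> \<phi> ` (U \<inter> X)"
  then obtain x where x: "x \<in> U" "x \<in> X" "y = \<phi> x" by auto
  obtain V \<psi> where V: "(V, \<psi>) \<in> M" "x \<in> V"
    by (rule chartE[OF subsetD[OF gchart_subset[OF U] x(1)]])
  let ?T = "\<phi> ` (U \<inter> (V \<inter> X))"
  have T: "open ?T" by (rule gchart_open_image[OF U open_Int[OF open_chart[OF V(1)] X]])
  have "smooth_on ?T (\<lambda>y. (f \<circ> inv_into V \<psi>) ((\<psi> \<circ> inv_into U \<phi>) y))"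
  proof (rule smooth_on_compose[OF T, of "\<psi> ` (V \<inter> X)"])
    show "smooth_on ?T (\<psi> \<circ> inv_into U \<phi>)"
      by (rule smooth_on_subset[OF gchart_transition(2)[OF U V(1)]]) auto
    show "smooth_on (\<psi> ` (V \<inter> X)) (f \<circ> inv_into V \<psi>)" using f V by (auto simp: msmooth_def)
  qed (use gchart_inj[OF U] mfd_open_image[OF X V(1)] in auto)
  then have "smooth_on ?T (f \<circ> inv_into U \<phi>)"
    by (rule smooth_on_cong[OF T, rotated]) (use gchart_inj[OF U] chart_inj[OF V(1)] in auto)
  then show "\<exists>T. open T \<and> y \<in> T \<and> smooth_on T (f \<circ> inv_into U \<phi>)"
    using T x V by blast
qed

lemma gchart_smooth_function:
  assumes "gchart M U \<phi>" "f \<in> smooth_functions M"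
  shows "smooth_on (\<phi> ` U) (f \<circ> inv_into U \<phi>)"
  using gchart_smooth[OF assms(1) open_carrier] assms gchart_subset smooth_functions_iff
  by (metis inf.orderE)

lemma msmooth_gchart_compose:
  "gchart M U \<phi> \<Longrightarrow> smooth_on (\<phi> ` U) g \<Longrightarrow> msmooth M U (\<lambda>x. g (\<phi> x))"
  by (rule msmooth_compose[of _ "\<phi> ` U"]) (auto simp: gchart_open_range gchart_def)

section \<open>Cutoff functions and extension by zero\<close>

lemma msmooth_cutoff:
  fixes f :: "'m \<Rightarrow> real"
  assumes "mfd_open M X" "K \<subseteq> X" "mfd_open M (carrier M - K)" "\<kappa> \<in> smooth_functions M"
    "\<And>y. y \<in> carrier M - K \<Longrightarrow> \<kappa> y = 0" "msmooth M X f"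
  shows "(\<lambda>y. if y \<in> X then \<kappa> y * f y else 0) \<in> smooth_functions M"
  unfolding smooth_functions_iff
proof (rule msmooth_local)
  fix x assume x: "x \<in> carrier M"
  show "\<exists>Y. mfd_open M Y \<and> x \<in> Y \<and> msmooth M Y (\<lambda>y. if y \<in> X then \<kappa> y * f y else 0)"
  proof (cases "x \<in> X")
    case True
    have "msmooth M X (\<lambda>y. \<kappa> y * f y)"
      by (intro msmooth_mult smooth_functions_msmooth mfd_open_subset assms)
    then have "msmooth M X (\<lambda>y. if y \<in> X then \<kappa> y * f y else 0)"
      by (rule msmooth_cong[OF assms(1), rotated]) simp
    then show ?thesis using True assms by blast
  next
    \<comment> \<open>A point off \<open>X\<close> lies in the open complement of \<open>K\<close>,
      on which the extended function is identically 0.\<close>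
    case False
    have "msmooth M (carrier M - K) (\<lambda>y. if y \<in> X then \<kappa> y * f y else 0)"
      by (rule msmooth_cong[OF assms(3) _ msmooth_const[of _ _ 0]]) (simp add: assms)
    then show ?thesis using False assms x by blast
  qed
qed

text \<open>A compact set in the image of a chart is carried to a compact set of the manifold, and
  this is closed because the manifold is Hausdorff. Otherwise extending by 0 outside a chart ball
  could break smoothness at points that the chart does not see.\<close>

lemma chart_ball_closed:
  assumes V: "(V, \<psi>) \<in> M" and C: "compact C" "C \<subseteq> \<psi> ` V"
  shows "mfd_open M (carrier M - inv_into V \<psi> ` C)"
proof -
  let ?T = "topology (mfd_open M)"
  have "continuous_map (top_of_set (\<psi> ` V)) ?T (inv_into V \<psi>)"
    unfolding continuous_map topspace_mfd openin_mfd
  proof (intro conjI allI impI)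
    show "inv_into V \<psi> ` topspace (top_of_set (\<psi> ` V)) \<subseteq> carrier M"
      using chart_inj[OF V] chart_subset_carrier[OF V] by auto
    fix W assume W: "mfd_open M W"
    have "{x \<in> topspace (top_of_set (\<psi> ` V)). inv_into V \<psi> x \<in> W} = \<psi> ` (V \<inter> W)"
      using chart_inj[OF V] by auto
    then show "openin (top_of_set (\<psi> ` V)) {x \<in> topspace (top_of_set (\<psi> ` V)). inv_into V \<psi> x \<in> W}"
      using mfd_open_image[OF W V] by (metis (no_types, lifting) open_subset image_mono inf_le1)
  qed
  then have "compactin ?T (inv_into V \<psi> ` C)"
    by (rule image_compactin[rotated]) (simp add: compactin_subtopology compactin_euclidean_iff C)
  moreover have "Hausdorff_space ?T" using smooth_manifold by (simp add: smooth_manifold_def)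
  ultimately have "closedin ?T (inv_into V \<psi> ` C)" by (rule compactin_imp_closedin[rotated])
  then show ?thesis by (metis closedin_def openin_mfd topspace_mfd)
qed

text \<open>A bump function in a chart, extended by 0. The closed set \<open>K\<close> is returned
  too, because \<open>msmooth_cutoff\<close> needs it to extend functions that are smooth only on
  \<open>X\<close>.\<close>

lemma cutoff_exists:
  assumes X: "mfd_open M X" "x \<in> X"
  obtains \<kappa> Y K where "\<kappa> \<in> smooth_functions M" "mfd_open M Y" "x \<in> Y" "Y \<subseteq> K" "K \<subseteq> X"
    "mfd_open M (carrier M - K)" "\<And>y. y \<in> Y \<Longrightarrow> \<kappa> y = 1" "\<And>y. y \<notin> K \<Longrightarrow> \<kappa> y = (0::real)"
proof -
  obtain V \<psi> where V: "(V, \<psi>) \<in> M" "x \<in> V"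
    by (rule chartE[OF subsetD[OF mfd_open_subset[OF X(1)] X(2)]])
  have VX: "open (\<psi> ` (V \<inter> X))" by (rule mfd_open_image[OF X(1) V(1)])
  then obtain r where r: "r > 0" "cball (\<psi> x) r \<subseteq> \<psi> ` (V \<inter> X)"
    using X V open_contains_cball by (metis IntI image_eqI)
  define K where "K = inv_into V \<psi> ` cball (\<psi> x) r"
  define f where "f = (\<lambda>y. bump (\<psi> x) r (\<psi> y))"
  define Y where "Y = V \<inter> X \<inter> \<psi> -` ball (\<psi> x) (r / 2)"
  note inj = chart_inj[OF V(1)]
  have KX: "K \<subseteq> V \<inter> X" using r inj by (force simp: K_def)
  have inK: "y \<in> K \<longleftrightarrow> \<psi> y \<in> cball (\<psi> x) r" if y: "y \<in> V" for y
  proof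
    assume "y \<in> K"
    then obtain z where z: "z \<in> cball (\<psi> x) r" "y = inv_into V \<psi> z" by (auto simp: K_def)
    then have "\<psi> y = z" using r f_inv_into_f[of z \<psi> V] by blast
    then show "\<psi> y \<in> cball (\<psi> x) r" using z by simp
  next
    assume "\<psi> y \<in> cball (\<psi> x) r"
    then show "y \<in> K" unfolding K_def using y inj by (metis image_eqI inv_into_f_f)
  qed
  have Y: "mfd_open M Y"
    unfolding Y_def
    by (rule open_vimage[OF open_Int[OF open_chart[OF V(1)] X(1)]
          msmooth_mono[OF gchart_msmooth[OF gchart_chart[OF V(1)]] Int_lower1] open_ball])
  have K: "mfd_open M (carrier M - K)"
    unfolding K_def using r by (intro chart_ball_closed[OF V(1)] compact_cball_finite_dim) auto
  let ?\<kappa> = "\<lambda>y. if y \<in> V \<inter> X then 1 * f y else 0"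
  have f0: "y \<notin> K \<Longrightarrow> ?\<kappa> y = 0" for y
    using inK[of y] r by (auto simp: f_def dist_norm norm_minus_commute intro!: bump_eq_0)
  have "msmooth M V f"
    unfolding f_def by (intro msmooth_gchart_compose[OF gchart_chart[OF V(1)], of "bump (\<psi> x) r"] smooth_on_subset[OF bump_smooth]) auto
  then have fs: "msmooth M (V \<inter> X) f" by (rule msmooth_mono) auto
  have "?\<kappa> \<in> smooth_functions M"
    unfolding smooth_functions_iff
  proof (rule msmooth_local)
    fix z assume z: "z \<in> carrier M"
    have "msmooth M (V \<inter> X) ?\<kappa>"
      by (rule msmooth_cong[OF open_Int[OF open_chart[OF V(1)] X(1)] _ fs]) simp
    moreover have "msmooth M (carrier M - K) ?\<kappa>"
      by (rule msmooth_cong[OF K _ msmooth_const[of _ _ 0]]) (use f0 in fastforce)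
    ultimately show "\<exists>Y. mfd_open M Y \<and> z \<in> Y \<and> msmooth M Y ?\<kappa>"
      using K z KX open_Int[OF open_chart[OF V(1)] X(1)] by (cases "z \<in> K") blast+
  qed
  moreover have "?\<kappa> y = 1" if "y \<in> Y" for y
    using that r by (auto simp: Y_def f_def dist_norm norm_minus_commute intro!: bump_eq_1)
  moreover have "Y \<subseteq> K"
  proof
    fix y assume "y \<in> Y"
    then show "y \<in> K" using inK[of y] r by (auto simp: Y_def)
  qed
  moreover have "x \<in> Y" using X V r by (simp add: Y_def)
  ultimately show ?thesis using that[of ?\<kappa> Y K] K Y KX f0 by blast
qed

end

section \<open>Tangent vectors and bivectors in compatible charts\<close>

lemma sum_fun_apply: "(\<Sum>i\<in>I. f i) x = (\<Sum>i\<in>I. f i x)"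
  by (induction I rule: infinite_finite_induct) simp_all

lemma lin_on_add: "lin_on S f \<Longrightarrow> x \<in> S \<Longrightarrow> y \<in> S \<Longrightarrow> f (x + y) = f x + f y"
  by (simp add: lin_on_def)

lemma lin_on_scale: "lin_on S f \<Longrightarrow> x \<in> S \<Longrightarrow> f (c *\<^sub>R x) = c *\<^sub>R f x"
  by (simp add: lin_on_def)

lemma lin_on_sum:
  assumes S: "subspace S" and f: "lin_on S f" and v: "\<And>i. i \<in> I \<Longrightarrow> v i \<in> S"
  shows "f (\<Sum>i\<in>I. c i *\<^sub>R v i) = (\<Sum>i\<in>I. c i *\<^sub>R f (v i))"
proof -
  have 0: "f 0 = 0" using lin_on_scale[OF f subspace_0[OF S], of 0] by simp
  show ?thesis
    using v
  proof (induction I rule: infinite_finite_induct)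
    case (insert i I)
    have m: "(\<Sum>i\<in>I. c i *\<^sub>R v i) \<in> S" "c i *\<^sub>R v i \<in> S"
      using insert.prems by (auto intro!: subspace_sum subspace_scale S)
    have "f (\<Sum>i\<in>insert i I. c i *\<^sub>R v i) = f (c i *\<^sub>R v i) + f (\<Sum>i\<in>I. c i *\<^sub>R v i)"
      using insert.hyps m lin_on_add[OF f] by simp
    then show ?case using insert lin_on_scale[OF f] by simp
  qed (simp_all add: 0)
qed

lemma subspace_cotangent_space: "subspace (cotangent_space M p)"
  by (rule subspaceI) (auto simp: cotangent_space_def lin_on_def scaleR_fun_def algebra_simps)

lemma inner_eqI: "(\<And>b. b \<bullet> v = b \<bullet> w) \<Longrightarrow> v = w" for v w :: "'a::real_inner"
  using vector_eq_ldot[of v w] by simp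

context mfd
begin

lemma dir_deriv_smooth:
  "f \<in> smooth_functions M \<Longrightarrow>
    dir_deriv M (U, \<phi>) x w f = frechet_derivative (f \<circ> inv_into U \<phi>) (at (\<phi> x)) w"
  by (simp add: dir_deriv_def)

lemma gchart_has_derivative:
  assumes "gchart M U \<phi>" "x \<in> U" "f \<in> smooth_functions M"
  shows "((f \<circ> inv_into U \<phi>) has_derivative (\<lambda>w. dir_deriv M (U, \<phi>) x w f)) (at (\<phi> x))"
  using smooth_on_has_derivative[OF gchart_smooth_function[OF assms(1,3)], of "\<phi> x"] assms(2)
  by (simp add: dir_deriv_smooth[OF assms(3)])

lemma dir_derivI:
  assumes "((f \<circ> inv_into U \<phi>) has_derivative D) (at (\<phi> x))" "f \<in> smooth_functions M"
  shows "dir_deriv M (U, \<phi>) x w f = D w"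
  using frechet_derivative_at[OF assms(1)] by (simp add: dir_deriv_smooth[OF assms(2)])

text \<open>The chain rule for the transition map. Through it every compatible chart, not only those
  in the atlas, parametrises the tangent space.\<close>

lemma dir_deriv_change:
  assumes U: "gchart M U \<phi>" and V: "gchart M V \<psi>" and x: "x \<in> U" "x \<in> V"
  shows "dir_deriv M (V, \<psi>) x w =
    dir_deriv M (U, \<phi>) x (frechet_derivative (\<phi> \<circ> inv_into V \<psi>) (at (\<psi> x)) w)"
proof
  fix f
  show "dir_deriv M (V, \<psi>) x w f =
    dir_deriv M (U, \<phi>) x (frechet_derivative (\<phi> \<circ> inv_into V \<psi>) (at (\<psi> x)) w) f"
  proof (cases "f \<in> smooth_functions M")
    case f: True
    let ?g = "\<phi> \<circ> inv_into V \<psi>"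
    have "smooth_on (\<psi> ` (V \<inter> U)) ?g"
      by (rule gchart_smooth[OF V gchart_open[OF U] gchart_msmooth[OF U]])
    then have g: "(?g has_derivative frechet_derivative ?g (at (\<psi> x))) (at (\<psi> x))"
      by (rule smooth_on_has_derivative) (use x in auto)
    have gx: "?g (\<psi> x) = \<phi> x" using gchart_inj[OF V] x by simp
    have "(f \<circ> inv_into U \<phi> \<circ> ?g has_derivative
        (\<lambda>w. dir_deriv M (U, \<phi>) x w f) \<circ> frechet_derivative ?g (at (\<psi> x))) (at (\<psi> x))"
      using gchart_has_derivative[OF U x(1) f] by (intro diff_chain_at g) (simp only: gx)
    then have "(f \<circ> inv_into V \<psi> has_derivative
        (\<lambda>w. dir_deriv M (U, \<phi>) x w f) \<circ> frechet_derivative ?g (at (\<psi> x))) (at (\<psi> x))"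
      by (rule has_derivative_transform_within_open[OF _ gchart_open_image[OF V gchart_open[OF U]]])
        (use x gchart_inj[OF U] gchart_inj[OF V] in auto)
    from dir_derivI[OF this f] show ?thesis by simp
  qed (simp add: dir_deriv_def)
qed

lemma tangent_space_gchart:
  assumes U: "gchart M U \<phi>" and x: "x \<in> U"
  shows "tangent_space M x = range (dir_deriv M (U, \<phi>) x)"
proof
  show "tangent_space M x \<subseteq> range (dir_deriv M (U, \<phi>) x)"
  proof
    fix v assume "v \<in> tangent_space M x"
    then obtain c w where c: "v = dir_deriv M c x w" "c \<in> M" "x \<in> fst c"
      by (auto simp: tangent_space_def)
    then show "v \<in> range (dir_deriv M (U, \<phi>) x)"
      using dir_deriv_change[OF U gchart_chart[of "fst c" "snd c"] x, of w] by auto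
  qed
  obtain V \<psi> where V: "(V, \<psi>) \<in> M" "x \<in> V"
    by (rule chartE[OF subsetD[OF gchart_subset[OF U] x(1)]])
  show "range (dir_deriv M (U, \<phi>) x) \<subseteq> tangent_space M x"
    using dir_deriv_change[OF gchart_chart[OF V(1)] U V(2) x] V unfolding tangent_space_def by fastforce
qed

lemma dir_deriv_in_tangent_space: "gchart M U \<phi> \<Longrightarrow> x \<in> U \<Longrightarrow> dir_deriv M (U, \<phi>) x w \<in> tangent_space M x"
  by (simp add: tangent_space_gchart)

lemma tangentE:
  assumes "gchart M U \<phi>" "x \<in> U" "v \<in> tangent_space M x"
  obtains w where "v = dir_deriv M (U, \<phi>) x w"
  using assms by (auto simp: tangent_space_gchart)

lemma linear_dir_deriv:
  assumes "gchart M U \<phi>" "x \<in> U"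
  shows "linear (dir_deriv M (U, \<phi>) x)"
proof -
  have l: "linear (\<lambda>w. dir_deriv M (U, \<phi>) x w f)" if "f \<in> smooth_functions M" for f
    using gchart_has_derivative[OF assms that] has_derivative_bounded_linear bounded_linear.linear by blast
  have n: "dir_deriv M (U, \<phi>) x w f = 0" if "f \<notin> smooth_functions M" for f w
    using that by (simp add: dir_deriv_def)
  show ?thesis
  proof (rule linearI; rule ext)
    fix v w f r
    show "dir_deriv M (U, \<phi>) x (v + w) f = (dir_deriv M (U, \<phi>) x v + dir_deriv M (U, \<phi>) x w) f"
      using l[of f] n[of f] linear_add[OF l[of f], of v w] by (cases "f \<in> smooth_functions M") auto
    show "dir_deriv M (U, \<phi>) x (r *\<^sub>R v) f = (r *\<^sub>R dir_deriv M (U, \<phi>) x v) f"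
      using l[of f] n[of f] linear_scale[OF l[of f], of r v]
      by (cases "f \<in> smooth_functions M") (auto simp: scaleR_fun_def)
  qed
qed

lemma tangent_gchart_exists:
  assumes "x \<in> carrier M"
  obtains U \<phi> where "gchart M U \<phi>" "x \<in> U"
  using chartE[OF assms] gchart_chart by metis

lemma subspace_tangent_space:
  assumes x: "x \<in> carrier M"
  shows "subspace (tangent_space M x)"
proof -
  obtain U \<phi> where U: "gchart M U \<phi>" "x \<in> U" by (rule tangent_gchart_exists[OF x])
  show ?thesis
    unfolding tangent_space_gchart[OF U]
    by (rule linear_subspace_image[OF linear_dir_deriv[OF U] subspace_UNIV])
qed

lemma tangent_has_derivative:
  assumes x: "x \<in> carrier M" and v: "v \<in> tangent_space M x"
  obtains U \<phi> w where "gchart M U \<phi>" "x \<in> U" "v = dir_deriv M (U, \<phi>) x w"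
  using tangent_gchart_exists[OF x] tangentE[OF _ _ v] by metis

lemma tangent_local:
  assumes v: "v \<in> tangent_space M x" and "f \<in> smooth_functions M" "g \<in> smooth_functions M"
    and Y: "mfd_open M Y" "x \<in> Y" and eq: "\<And>y. y \<in> Y \<Longrightarrow> f y = g y"
  shows "v f = v g"
proof -
  have x: "x \<in> carrier M" using Y mfd_open_subset by blast
  obtain U \<phi> w where U: "gchart M U \<phi>" "x \<in> U" "v = dir_deriv M (U, \<phi>) x w"
    by (rule tangent_has_derivative[OF x v])
  have "(g \<circ> inv_into U \<phi> has_derivative (\<lambda>w. dir_deriv M (U, \<phi>) x w f)) (at (\<phi> x))"
    by (rule has_derivative_transform_within_open[OF gchart_has_derivative[OF U(1,2) assms(2)]
          gchart_open_image[OF U(1) Y(1)]])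
      (use U Y eq gchart_inj[OF U(1)] in auto)
  from dir_derivI[OF this assms(3)] show ?thesis by (simp add: U)
qed

lemma tangent_const:
  assumes x: "x \<in> carrier M" and v: "v \<in> tangent_space M x"
  shows "v (\<lambda>y. c) = 0"
proof -
  obtain U \<phi> w where U: "gchart M U \<phi>" "x \<in> U" "v = dir_deriv M (U, \<phi>) x w"
    by (rule tangent_has_derivative[OF x v])
  have "((\<lambda>y. c) \<circ> inv_into U \<phi> has_derivative (\<lambda>w. 0)) (at (\<phi> x))" by (simp add: o_def)
  from dir_derivI[OF this smooth_const] show ?thesis by (simp add: U)
qed

lemma tangent_add:
  assumes x: "x \<in> carrier M" and v: "v \<in> tangent_space M x"
    and f: "f \<in> smooth_functions M" and g: "g \<in> smooth_functions M"
  shows "v (\<lambda>y. f y + g y) = v f + v g"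
proof -
  obtain U \<phi> w where U: "gchart M U \<phi>" "x \<in> U" "v = dir_deriv M (U, \<phi>) x w"
    by (rule tangent_has_derivative[OF x v])
  have "((\<lambda>y. f y + g y) \<circ> inv_into U \<phi> has_derivative
      (\<lambda>w. dir_deriv M (U, \<phi>) x w f + dir_deriv M (U, \<phi>) x w g)) (at (\<phi> x))"
    using has_derivative_add[OF gchart_has_derivative[OF U(1,2) f] gchart_has_derivative[OF U(1,2) g]]
    by (simp add: o_def)
  from dir_derivI[OF this smooth_add[OF f g]] show ?thesis by (simp add: U)
qed

lemma tangent_mult:
  assumes x: "x \<in> carrier M" and v: "v \<in> tangent_space M x"
    and f: "f \<in> smooth_functions M" and g: "g \<in> smooth_functions M"
  shows "v (\<lambda>y. f y * g y) = f x * v g + v f * g x"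
proof -
  obtain U \<phi> w where U: "gchart M U \<phi>" "x \<in> U" "v = dir_deriv M (U, \<phi>) x w"
    by (rule tangent_has_derivative[OF x v])
  have "((\<lambda>y. f y * g y) \<circ> inv_into U \<phi> has_derivative
      (\<lambda>w. f x * dir_deriv M (U, \<phi>) x w g + dir_deriv M (U, \<phi>) x w f * g x)) (at (\<phi> x))"
    using has_derivative_mult[OF gchart_has_derivative[OF U(1,2) f] gchart_has_derivative[OF U(1,2) g]]
      gchart_inj[OF U(1)] U(2)
    by (simp add: o_def)
  from dir_derivI[OF this smooth_mult[OF f g]] show ?thesis by (simp add: U)
qed

lemma tangent_cmult:
  assumes x: "x \<in> carrier M" and v: "v \<in> tangent_space M x" and f: "f \<in> smooth_functions M"
  shows "v (\<lambda>y. c * f y) = c * v f"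
  using tangent_mult[OF x v smooth_const f, of c] tangent_const[OF x v] by simp

lemma tangent_diff:
  assumes x: "x \<in> carrier M" and v: "v \<in> tangent_space M x"
    and f: "f \<in> smooth_functions M" and g: "g \<in> smooth_functions M"
  shows "v (\<lambda>y. f y - g y) = v f - v g"
  using tangent_add[OF x v f smooth_mult[OF smooth_const g], of "-1"] tangent_cmult[OF x v g, of "-1"] by simp

lemma tangent_sum:
  assumes x: "x \<in> carrier M" and v: "v \<in> tangent_space M x"
    and f: "\<And>i. i \<in> I \<Longrightarrow> f i \<in> smooth_functions M"
  shows "v (\<lambda>y. \<Sum>i\<in>I. f i y) = (\<Sum>i\<in>I. v (f i))"
  using f
proof (induction I rule: infinite_finite_induct)
  case (insert i I)
  then have "v (\<lambda>y. f i y + (\<Sum>i\<in>I. f i y)) = v (f i) + v (\<lambda>y. \<Sum>i\<in>I. f i y)"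
    by (intro tangent_add[OF x v] smooth_sum) auto
  then show ?case using insert by simp
qed (simp_all add: tangent_const[OF x v])

text \<open>Tangent vectors are defined on global smooth functions, so the coordinates of a chart
  cannot be differentiated themselves. \<open>G\<close> consists of global functions that agree with
  them on the smaller open set \<open>Y\<close>. The index ranges over all vectors, not over a
  basis, so that every covector is the differential of a single \<open>G b\<close>.\<close>

definition coords :: "'m set \<Rightarrow> ('m \<Rightarrow> 'e) \<Rightarrow> 'm set \<Rightarrow> ('e \<Rightarrow> 'm \<Rightarrow> real) \<Rightarrow> bool"
  where "coords U \<phi> Y G \<longleftrightarrow> gchart M U \<phi> \<and> mfd_open M Y \<and> Y \<subseteq> U \<and>
    (\<forall>b. G b \<in> smooth_functions M \<and> (\<forall>y\<in>Y. G b y = b \<bullet> \<phi> y))"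

lemma coordsD:
  assumes "coords U \<phi> Y G"
  shows "gchart M U \<phi>" "mfd_open M Y" "Y \<subseteq> U" "G b \<in> smooth_functions M" "y \<in> Y \<Longrightarrow> G b y = b \<bullet> \<phi> y"
    "y \<in> Y \<Longrightarrow> y \<in> U" "y \<in> Y \<Longrightarrow> y \<in> carrier M"
  using assms mfd_open_subset unfolding coords_def by blast+

lemma coords_exist:
  assumes U: "gchart M U \<phi>" and x: "x \<in> U"
  obtains G Y where "coords U \<phi> Y G" "x \<in> Y"
proof -
  obtain \<kappa> Y K where c: "\<kappa> \<in> smooth_functions M" "mfd_open M Y" "x \<in> Y" "Y \<subseteq> K" "K \<subseteq> U"
    "mfd_open M (carrier M - K)" "\<And>y. y \<in> Y \<Longrightarrow> \<kappa> y = 1" "\<And>y. y \<notin> K \<Longrightarrow> \<kappa> y = (0::real)"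
    using cutoff_exists[OF gchart_open[OF U] x] by metis
  have "(\<lambda>y. if y \<in> U then \<kappa> y * (b \<bullet> \<phi> y) else 0) \<in> smooth_functions M" for b
    by (rule msmooth_cutoff[OF gchart_open[OF U] c(5,6,1)])
      (auto intro!: c msmooth_inner[OF gchart_open[OF U]] msmooth_const gchart_msmooth[OF U])
  then have "coords U \<phi> Y (\<lambda>b y. if y \<in> U then \<kappa> y * (b \<bullet> \<phi> y) else 0)"
    unfolding coords_def using U c by auto
  then show ?thesis using that c by blast
qed

lemma coords_dir_deriv:
  assumes G: "coords U \<phi> Y G" and y: "y \<in> Y"
  shows "dir_deriv M (U, \<phi>) y w (G b) = b \<bullet> w"
proof -
  note U = coordsD(1)[OF G]
  have "((\<lambda>z. b \<bullet> z) has_derivative (\<lambda>w. b \<bullet> w)) (at (\<phi> y))" by (auto intro!: derivative_eq_intros)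
  then have "(G b \<circ> inv_into U \<phi> has_derivative (\<lambda>w. b \<bullet> w)) (at (\<phi> y))"
    by (rule has_derivative_transform_within_open[OF _ gchart_open_image[OF U coordsD(2)[OF G]]])
      (use y coordsD[OF G] gchart_inj[OF U] in auto)
  from dir_derivI[OF this coordsD(4)[OF G]] show ?thesis .
qed

lemma tangent_eqI:
  assumes G: "coords U \<phi> Y G" and y: "y \<in> Y"
    and v: "v \<in> tangent_space M y" and w: "w \<in> tangent_space M y"
    and eq: "\<And>b. v (G b) = w (G b)"
  shows "v = w"
proof -
  obtain v' where v': "v = dir_deriv M (U, \<phi>) y v'"
    by (rule tangentE[OF coordsD(1)[OF G] coordsD(6)[OF G y] v])
  obtain w' where w': "w = dir_deriv M (U, \<phi>) y w'"
    by (rule tangentE[OF coordsD(1)[OF G] coordsD(6)[OF G y] w])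
  have "b \<bullet> v' = b \<bullet> w'" for b
    using eq[of b] by (simp add: v' w' coords_dir_deriv[OF G y])
  then have "v' = w'" by (rule inner_eqI)
  then show ?thesis by (simp add: v' w')
qed

text \<open>Evaluating on coordinate functions recovers the direction, so the description operator
  in \<open>components\<close> has a unique witness.\<close>

lemma components_dir_deriv:
  assumes U: "gchart M U \<phi>" and x: "x \<in> U"
  shows "components M (U, \<phi>) x (dir_deriv M (U, \<phi>) x w) = w"
proof -
  obtain G Y where G: "coords U \<phi> Y G" "x \<in> Y" by (rule coords_exist[OF U x])
  have "w = w'" if "dir_deriv M (U, \<phi>) x w = dir_deriv M (U, \<phi>) x w'" for w'
  proof -
    have "b \<bullet> w = b \<bullet> w'" for b using fun_cong[OF that, of "G b"] by (simp add: coords_dir_deriv[OF G])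
    then show ?thesis by (rule inner_eqI)
  qed
  then show ?thesis unfolding components_def by (intro the_equality) auto
qed

lemma coords_components:
  assumes G: "coords U \<phi> Y G" and y: "y \<in> Y" and v: "v \<in> tangent_space M y"
  shows "b \<bullet> components M (U, \<phi>) y v = v (G b)"
  using tangentE[OF coordsD(1)[OF G] coordsD(6)[OF G y] v]
  by (metis components_dir_deriv[OF coordsD(1)[OF G] coordsD(6)[OF G y]] coords_dir_deriv[OF G y])

lemma coord_covec_coords:
  assumes G: "coords U \<phi> Y G" and y: "y \<in> Y"
  shows "coord_covec M (U, \<phi>) b y = differential M (G b) y"
  by (auto simp: fun_eq_iff coord_covec_def differential_def coords_components[OF G y])

section \<open>Partial derivatives and smooth vector fields\<close>

definition partial :: "'m set \<Rightarrow> ('m \<Rightarrow> 'e) \<Rightarrow> 'e \<Rightarrow> ('m \<Rightarrow> real) \<Rightarrow> 'm \<Rightarrow> real"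
  where "partial U \<phi> b f y = dir_deriv M (U, \<phi>) y b f"

lemma msmooth_partial:
  assumes U: "gchart M U \<phi>" and f: "f \<in> smooth_functions M"
  shows "msmooth M U (partial U \<phi> b f)"
  unfolding partial_def[abs_def] dir_deriv_smooth[OF f]
  by (rule msmooth_gchart_compose[OF U smooth_on_frechet_derivative[OF gchart_smooth_function[OF U f]]])

lemma tangent_expand:
  assumes G: "coords U \<phi> Y G" and y: "y \<in> Y" and v: "v \<in> tangent_space M y"
    and f: "f \<in> smooth_functions M"
  shows "v f = (\<Sum>b\<in>onb. partial U \<phi> b f y * v (G b))"
proof -
  note Uy = coordsD(1)[OF G] coordsD(6)[OF G y]
  obtain w where w: "v = dir_deriv M (U, \<phi>) y w" by (rule tangentE[OF Uy v])
  have "linear (\<lambda>w. dir_deriv M (U, \<phi>) y w f)"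
    using gchart_has_derivative[OF Uy f] has_derivative_bounded_linear bounded_linear.linear by blast
  from linear_onb[OF this, of w] show ?thesis
    by (simp add: w partial_def coords_dir_deriv[OF G y] inner_commute mult.commute)
qed

text \<open>First partial derivatives are smooth only on \<open>U\<close>. The second ones are
  therefore taken of global functions \<open>g b\<close> that agree with the first ones near
  \<open>y\<close>; in the chart this becomes the symmetry of second derivatives.\<close>

lemma partial_commute:
  assumes G: "coords U \<phi> Y G" and y: "y \<in> Y" and f: "f \<in> smooth_functions M"
    and g: "\<And>b. g b \<in> smooth_functions M" "mfd_open M Z" "y \<in> Z" "\<And>z b. z \<in> Z \<Longrightarrow> g b z = partial U \<phi> b f z"
  shows "partial U \<phi> a (g b) y = partial U \<phi> b (g a) y"
proof -
  note U = coordsD(1)[OF G] and yU = coordsD(6)[OF G y]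
  let ?f = "f \<circ> inv_into U \<phi>"
  have s: "smooth_on (\<phi> ` U) ?f" by (rule gchart_smooth_function[OF U f])
  have "partial U \<phi> a (g b) y = frechet_derivative (\<lambda>z. frechet_derivative ?f (at z) b) (at (\<phi> y)) a" for a b
  proof -
    have "((\<lambda>z. frechet_derivative ?f (at z) b) has_derivative
        frechet_derivative (\<lambda>z. frechet_derivative ?f (at z) b) (at (\<phi> y))) (at (\<phi> y))"
      by (rule smooth_on_has_derivative[OF smooth_on_frechet_derivative[OF s]]) (use yU in auto)
    then have "(g b \<circ> inv_into U \<phi> has_derivative
        frechet_derivative (\<lambda>z. frechet_derivative ?f (at z) b) (at (\<phi> y))) (at (\<phi> y))"
      by (rule has_derivative_transform_within_open[OF _ gchart_open_image[OF U g(2)]])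
        (use yU g gchart_inj[OF U] f in \<open>auto simp: partial_def dir_deriv_smooth\<close>)
    from dir_derivI[OF this g(1)] show ?thesis by (simp add: partial_def)
  qed
  then show ?thesis
    using frechet_derivative_commute[OF gchart_open_range[OF U] s, of "\<phi> y"] yU by simp
qed

text \<open>Near each point the components of \<open>V\<close> in a chart are its values on globally
  extended coordinates, so smooth values yield a smooth section in the sense of
  \<open>tangent_atlas\<close>.\<close>

lemma vector_fieldsI:
  assumes V: "\<And>x. x \<in> carrier M \<Longrightarrow> V x \<in> tangent_space M x" "\<And>x. x \<notin> carrier M \<Longrightarrow> V x = 0"
    and smooth: "\<And>f. f \<in> smooth_functions M \<Longrightarrow> (\<lambda>x. V x f) \<in> smooth_functions M"
  shows "V \<in> vector_fields M"
proof -
  have "smooth_map M (tangent_atlas M) (\<lambda>p. (p, V p))"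
    unfolding smooth_map_iff
  proof (intro conjI ballI)
    show "(\<lambda>p. (p, V p)) ` carrier M \<subseteq> carrier (tangent_atlas M)"
    proof
      fix z assume "z \<in> (\<lambda>p. (p, V p)) ` carrier M"
      then obtain p where p: "p \<in> carrier M" "z = (p, V p)" by blast
      obtain U \<phi> where U: "(U, \<phi>) \<in> M" "p \<in> U" by (rule chartE[OF p(1)])
      then have "(Sigma U (tangent_space M), \<lambda>(p, v). (\<phi> p, components M (U, \<phi>) p v)) \<in> tangent_atlas M"
        by (auto simp: tangent_atlas_def)
      then have "Sigma U (tangent_space M) \<subseteq> carrier (tangent_atlas M)" by (rule chart_subset_carrier)
      then show "z \<in> carrier (tangent_atlas M)" using p U V(1)[OF p(1)] by auto
    qed
  next
    fix c assume "c \<in> tangent_atlas M"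
    then obtain U \<phi> where c: "c = (Sigma U (tangent_space M), \<lambda>(p, v). (\<phi> p, components M (U, \<phi>) p v))"
      and U: "(U, \<phi>) \<in> M" by (auto simp: tangent_atlas_def)
    have eq: "carrier M \<inter> (\<lambda>p. (p, V p)) -` Sigma U (tangent_space M) = U"
      using chart_subset_carrier[OF U] V by auto
    have "msmooth M U (\<lambda>p. (\<phi> p, components M (U, \<phi>) p (V p)))"
    proof (rule msmooth_Pair[OF open_chart[OF U] gchart_msmooth[OF gchart_chart[OF U]]], rule msmooth_local)
      fix x assume x: "x \<in> U"
      obtain G Y where G: "coords U \<phi> Y G" "x \<in> Y" by (rule coords_exist[OF gchart_chart[OF U] x])
      have sm: "msmooth M Y (\<lambda>p. \<Sum>b\<in>onb. V p (G b) *\<^sub>R b)"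
        by (intro msmooth_sum msmooth_scaleR msmooth_const smooth_functions_msmooth smooth
            coordsD[OF G(1)] mfd_open_subset)
      have "(\<Sum>b\<in>onb. V p (G b) *\<^sub>R b) = components M (U, \<phi>) p (V p)" if "p \<in> Y" for p
      proof -
        have "b \<bullet> components M (U, \<phi>) p (V p) = V p (G b)" for b
          by (rule coords_components[OF G(1) that V(1)[OF coordsD(7)[OF G(1) that]]])
        then show ?thesis using onb_expand[of "components M (U, \<phi>) p (V p)"] by (simp add: inner_commute)
      qed
      from msmooth_cong[OF coordsD(2)[OF G(1)] this sm]
      have "msmooth M Y (\<lambda>p. components M (U, \<phi>) p (V p))" .
      then show "\<exists>Y. mfd_open M Y \<and> x \<in> Y \<and> msmooth M Y (\<lambda>p. components M (U, \<phi>) p (V p))"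
        using G(2) coordsD(2)[OF G(1)] by blast
    qed
    then show "case c of (V', \<psi>) \<Rightarrow> mfd_open M (carrier M \<inter> (\<lambda>p. (p, V p)) -` V') \<and>
        msmooth M (carrier M \<inter> (\<lambda>p. (p, V p)) -` V') (\<psi> \<circ> (\<lambda>p. (p, V p)))"
      by (simp add: c eq open_chart[OF U] o_def)
  qed
  then show ?thesis using V by (simp add: vector_fields_def sections_def)
qed

section \<open>Covectors and bivectors in coordinates\<close>

lemma differential_in_cotangent_space:
  "x \<in> carrier M \<Longrightarrow> differential M f x \<in> cotangent_space M x"
  using subspace_add[OF subspace_tangent_space] subspace_scale[OF subspace_tangent_space]
  by (auto simp: cotangent_space_def differential_def lin_on_def scaleR_fun_def)

lemma differential_eqI:
  "(\<And>v. v \<in> tangent_space M x \<Longrightarrow> v f = v g) \<Longrightarrow> differential M f x = differential M g x"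
  by (auto simp: differential_def fun_eq_iff)

lemma differential_expand:
  assumes G: "coords U \<phi> Y G" and y: "y \<in> Y" and f: "f \<in> smooth_functions M"
  shows "differential M f y = (\<Sum>b\<in>onb. partial U \<phi> b f y *\<^sub>R differential M (G b) y)"
  using tangent_expand[OF G y _ f]
  by (auto simp: fun_eq_iff sum_fun_apply scaleR_fun_def differential_def)

text \<open>The Riesz vector of the covector, read in the chart, is the index of the coordinate
  function sought.\<close>

lemma cotangent_coords:
  assumes G: "coords U \<phi> Y G" and y: "y \<in> Y" and \<alpha>: "\<alpha> \<in> cotangent_space M y"
  obtains b where "\<alpha> = differential M (G b) y"
proof -
  note Uy = coordsD(1)[OF G] coordsD(6)[OF G y]
  have "linear (\<lambda>w. \<alpha> (dir_deriv M (U, \<phi>) y w))"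
    using \<alpha> dir_deriv_in_tangent_space[OF Uy] linear_dir_deriv[OF Uy]
    by (intro linearI) (auto simp: cotangent_space_def lin_on_def linear_add linear_scale)
  then obtain b where b: "\<And>w. \<alpha> (dir_deriv M (U, \<phi>) y w) = b \<bullet> w" using riesz by blast
  have "\<alpha> v = differential M (G b) y v" for v
  proof (cases "v \<in> tangent_space M y")
    case True
    then obtain w where w: "v = dir_deriv M (U, \<phi>) y w" by (rule tangentE[OF Uy])
    then show ?thesis using True by (simp add: differential_def b coords_dir_deriv[OF G y])
  qed (use \<alpha> in \<open>auto simp: differential_def cotangent_space_def\<close>)
  then show ?thesis using that by blast
qed

text \<open>By definition a bivector is linear in its second argument only; skew-symmetry carries
  this over to the first.\<close>

lemma bivector_sum:
  assumes B: "B \<in> bivectors M x" and v: "\<And>i. i \<in> I \<Longrightarrow> v i \<in> cotangent_space M x"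
    and w: "\<And>j. j \<in> J \<Longrightarrow> w j \<in> cotangent_space M x"
  shows "B (\<Sum>i\<in>I. c i *\<^sub>R v i) (\<Sum>j\<in>J. d j *\<^sub>R w j) = (\<Sum>i\<in>I. \<Sum>j\<in>J. c i * d j * B (v i) (w j))"
proof -
  note S = subspace_cotangent_space[of M x]
  have l: "\<And>\<alpha>. \<alpha> \<in> cotangent_space M x \<Longrightarrow> lin_on (cotangent_space M x) (B \<alpha>)"
    and s: "\<And>\<alpha> \<beta>. \<alpha> \<in> cotangent_space M x \<Longrightarrow> \<beta> \<in> cotangent_space M x \<Longrightarrow> B \<alpha> \<beta> = - B \<beta> \<alpha>"
    using B unfolding bivectors_def by blast+
  have W: "(\<Sum>j\<in>J. d j *\<^sub>R w j) \<in> cotangent_space M x" and V: "(\<Sum>i\<in>I. c i *\<^sub>R v i) \<in> cotangent_space M x"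
    using v w by (auto intro!: subspace_sum S subspace_scale)
  have "B (\<Sum>i\<in>I. c i *\<^sub>R v i) (\<Sum>j\<in>J. d j *\<^sub>R w j) = - (\<Sum>i\<in>I. c i * B (\<Sum>j\<in>J. d j *\<^sub>R w j) (v i))"
    using lin_on_sum[OF S l[OF W] v] by (simp add: s[OF V W])
  also have "\<dots> = (\<Sum>i\<in>I. c i * B (v i) (\<Sum>j\<in>J. d j *\<^sub>R w j))"
    using s[OF W v] by (simp add: sum_negf[symmetric])
  also have "\<dots> = (\<Sum>i\<in>I. c i * (\<Sum>j\<in>J. d j * B (v i) (w j)))"
    by (rule sum.cong) (use lin_on_sum[OF S l[OF v], of _ J w d] w in auto)
  finally show ?thesis by (simp add: sum_distrib_left mult.assoc)
qed

lemma bivector_expand: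
  assumes G: "coords U \<phi> Y G" and y: "y \<in> Y" and B: "B \<in> bivectors M y"
    and f: "f \<in> smooth_functions M" and g: "g \<in> smooth_functions M"
  shows "B (differential M f y) (differential M g y) =
    (\<Sum>b\<in>onb. \<Sum>c\<in>onb. partial U \<phi> b f y * partial U \<phi> c g y * B (differential M (G b) y) (differential M (G c) y))"
  unfolding differential_expand[OF G y f] differential_expand[OF G y g]
  by (rule bivector_sum[OF B differential_in_cotangent_space differential_in_cotangent_space])
    (rule coordsD(7)[OF G y])+

text \<open>Near each point the coordinate covectors of a chart are differentials of global smooth
  functions, so the coefficients are covered by the assumption.\<close>

lemma bivector_fieldsI:
  assumes L: "\<And>x. x \<in> carrier M \<Longrightarrow> L x \<in> bivectors M x" "\<And>x. x \<notin> carrier M \<Longrightarrow> L x = 0"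
    and smooth: "\<And>f g. f \<in> smooth_functions M \<Longrightarrow> g \<in> smooth_functions M \<Longrightarrow>
      (\<lambda>x. L x (differential M f x) (differential M g x)) \<in> smooth_functions M"
  shows "L \<in> bivector_fields M"
proof -
  have "smooth_on (\<phi> ` U) ((\<lambda>p. L p (coord_covec M (U, \<phi>) \<eta> p) (coord_covec M (U, \<phi>) \<theta> p)) \<circ> inv_into U \<phi>)"
    if U: "(U, \<phi>) \<in> M" for U \<phi> \<eta> \<theta>
  proof -
    have "msmooth M U (\<lambda>p. L p (coord_covec M (U, \<phi>) \<eta> p) (coord_covec M (U, \<phi>) \<theta> p))"
    proof (rule msmooth_local)
      fix x assume x: "x \<in> U"
      obtain G Y where G: "coords U \<phi> Y G" "x \<in> Y" by (rule coords_exist[OF gchart_chart[OF U] x])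
      have "msmooth M Y (\<lambda>p. L p (differential M (G \<eta>) p) (differential M (G \<theta>) p))"
        by (intro smooth_functions_msmooth smooth coordsD[OF G(1)] mfd_open_subset)
      then have "msmooth M Y (\<lambda>p. L p (coord_covec M (U, \<phi>) \<eta> p) (coord_covec M (U, \<phi>) \<theta> p))"
        by (rule msmooth_cong[OF coordsD(2)[OF G(1)], rotated]) (simp add: coord_covec_coords[OF G(1)])
      then show "\<exists>Y. mfd_open M Y \<and> x \<in> Y \<and>
          msmooth M Y (\<lambda>p. L p (coord_covec M (U, \<phi>) \<eta> p) (coord_covec M (U, \<phi>) \<theta> p))"
        using G(2) coordsD(2)[OF G(1)] by blast
    qed
    then show ?thesis using U unfolding msmooth_def by (metis (no_types, lifting) Int_absorb case_prodD)
  qed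
  then show ?thesis using L by (auto simp: bivector_fields_def)
qed

end

section \<open>Jacobi brackets and generating sets of functions\<close>

text \<open>What is used of the affine functions from here on: constants adjust the value at a
  point, and coordinates in \<open>S\<close> realise every differential.\<close>

locale jet_generated_mfd = mfd M
  for M :: "('m, 'e::finite_dim_inner) atlas" +
  fixes S :: "('m \<Rightarrow> real) set"
  assumes gen_smooth: "a \<in> S \<Longrightarrow> a \<in> smooth_functions M"
    and gen_const: "(\<lambda>x. c) \<in> S"
    and gen_coords: "x \<in> carrier M \<Longrightarrow> \<exists>U \<phi> Y G. coords U \<phi> Y G \<and> x \<in> Y \<and> (\<forall>b. G b \<in> S)"
begin

lemma gen_tangent_eqI:
  assumes x: "x \<in> carrier M" and v: "v \<in> tangent_space M x" "w \<in> tangent_space M x"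
    and eq: "\<And>a. a \<in> S \<Longrightarrow> v a = w a"
  shows "v = w"
  using gen_coords[OF x] tangent_eqI[OF _ _ v] eq by metis

lemma gen_cotangent:
  assumes x: "x \<in> carrier M" and \<alpha>: "\<alpha> \<in> cotangent_space M x"
  obtains a where "a \<in> S" "\<alpha> = differential M a x"
  using gen_coords[OF x] cotangent_coords[OF _ _ \<alpha>] by metis

text \<open>In coordinates taken from \<open>S\<close>, \<open>V x f\<close> is a combination of the
  smooth functions \<open>V x (G b)\<close> with the partial derivatives of \<open>f\<close> as
  coefficients.\<close>

lemma gen_smooth_tangent:
  assumes V: "\<And>x. x \<in> carrier M \<Longrightarrow> V x \<in> tangent_space M x"
    and S: "\<And>a. a \<in> S \<Longrightarrow> (\<lambda>x. V x a) \<in> smooth_functions M" and f: "f \<in> smooth_functions M"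
  shows "(\<lambda>x. V x f) \<in> smooth_functions M"
  unfolding smooth_functions_iff
proof (rule msmooth_local)
  fix x assume "x \<in> carrier M"
  then obtain U \<phi> Y G where G: "coords U \<phi> Y G" "x \<in> Y" "\<And>b. G b \<in> S" using gen_coords by blast
  note Y = coordsD(2)[OF G(1)]
  have sm: "msmooth M Y (\<lambda>y. \<Sum>b\<in>onb. partial U \<phi> b f y * V y (G b))"
    by (intro msmooth_sum msmooth_mult Y smooth_functions_msmooth[OF S[OF G(3)]] mfd_open_subset
        msmooth_mono[OF msmooth_partial[OF coordsD(1)[OF G(1)] f] coordsD(3)[OF G(1)]])
  have "msmooth M Y (\<lambda>y. V y f)"
    by (rule msmooth_cong[OF Y _ sm]) (rule tangent_expand[OF G(1) _ V f, symmetric], assumption, rule coordsD(7)[OF G(1)])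
  then show "\<exists>Y. mfd_open M Y \<and> x \<in> Y \<and> msmooth M Y (\<lambda>y. V y f)" using Y G(2) by blast
qed

lemma gen_smooth_bivector:
  assumes L: "\<And>x. x \<in> carrier M \<Longrightarrow> L x \<in> bivectors M x"
    and S: "\<And>a b. a \<in> S \<Longrightarrow> b \<in> S \<Longrightarrow> (\<lambda>x. L x (differential M a x) (differential M b x)) \<in> smooth_functions M"
    and f: "f \<in> smooth_functions M" and g: "g \<in> smooth_functions M"
  shows "(\<lambda>x. L x (differential M f x) (differential M g x)) \<in> smooth_functions M"
  unfolding smooth_functions_iff
proof (rule msmooth_local)
  fix x assume "x \<in> carrier M"
  then obtain U \<phi> Y G where G: "coords U \<phi> Y G" "x \<in> Y" "\<And>b. G b \<in> S" using gen_coords by blast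
  note Y = coordsD(2)[OF G(1)]
  have sm: "msmooth M Y (\<lambda>y. \<Sum>b\<in>onb. \<Sum>c\<in>onb. partial U \<phi> b f y * partial U \<phi> c g y *
      L y (differential M (G b) y) (differential M (G c) y))"
    by (intro msmooth_sum msmooth_mult Y smooth_functions_msmooth[OF S[OF G(3) G(3)]] mfd_open_subset
        msmooth_mono[OF msmooth_partial[OF coordsD(1)[OF G(1)] f] coordsD(3)[OF G(1)]]
        msmooth_mono[OF msmooth_partial[OF coordsD(1)[OF G(1)] g] coordsD(3)[OF G(1)]])
  have "msmooth M Y (\<lambda>y. L y (differential M f y) (differential M g y))"
    by (rule msmooth_cong[OF Y _ sm]) (rule bivector_expand[OF G(1) _ L f g, symmetric], assumption, rule coordsD(7)[OF G(1)])
  then show "\<exists>Y. mfd_open M Y \<and> x \<in> Y \<and> msmooth M Y (\<lambda>y. L y (differential M f y) (differential M g y))"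
    using Y G(2) by blast
qed

end

section \<open>First-order differential operators\<close>

context mfd
begin

lemma partial_rules:
  assumes G: "coords U \<phi> Y G" and y: "y \<in> Y"
  shows "partial U \<phi> b (\<lambda>y. c) y = 0"
    and "f \<in> smooth_functions M \<Longrightarrow> g \<in> smooth_functions M \<Longrightarrow>
      partial U \<phi> b (\<lambda>y. f y + g y) y = partial U \<phi> b f y + partial U \<phi> b g y"
    and "f \<in> smooth_functions M \<Longrightarrow> g \<in> smooth_functions M \<Longrightarrow>
      partial U \<phi> b (\<lambda>y. f y * g y) y = f y * partial U \<phi> b g y + partial U \<phi> b f y * g y"
    and "f \<in> smooth_functions M \<Longrightarrow> partial U \<phi> b (\<lambda>y. - f y) y = - partial U \<phi> b f y"
    and "(\<And>i. i \<in> I \<Longrightarrow> F i \<in> smooth_functions M) \<Longrightarrow>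
      partial U \<phi> b (\<lambda>y. \<Sum>i\<in>I. F i y) y = (\<Sum>i\<in>I. partial U \<phi> b (F i) y)"
    and "partial U \<phi> b (G c0) y = c0 \<bullet> b"
proof -
  have v: "y \<in> carrier M" "dir_deriv M (U, \<phi>) y b \<in> tangent_space M y"
    by (rule coordsD(7)[OF G y], rule dir_deriv_in_tangent_space[OF coordsD(1)[OF G] coordsD(6)[OF G y]])
  show "partial U \<phi> b (\<lambda>y. c) y = 0"
    unfolding partial_def by (rule tangent_const[OF v])
  show "f \<in> smooth_functions M \<Longrightarrow> g \<in> smooth_functions M \<Longrightarrow>
      partial U \<phi> b (\<lambda>y. f y + g y) y = partial U \<phi> b f y + partial U \<phi> b g y"
    unfolding partial_def by (rule tangent_add[OF v])
  show "f \<in> smooth_functions M \<Longrightarrow> g \<in> smooth_functions M \<Longrightarrow>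
      partial U \<phi> b (\<lambda>y. f y * g y) y = f y * partial U \<phi> b g y + partial U \<phi> b f y * g y"
    unfolding partial_def by (rule tangent_mult[OF v])
  show "f \<in> smooth_functions M \<Longrightarrow> partial U \<phi> b (\<lambda>y. - f y) y = - partial U \<phi> b f y"
    unfolding partial_def using tangent_cmult[OF v, of f "-1"] by simp
  show "(\<And>i. i \<in> I \<Longrightarrow> F i \<in> smooth_functions M) \<Longrightarrow>
      partial U \<phi> b (\<lambda>y. \<Sum>i\<in>I. F i y) y = (\<Sum>i\<in>I. partial U \<phi> b (F i) y)"
    unfolding partial_def by (rule tangent_sum[OF v])
  show "partial U \<phi> b (G c0) y = c0 \<bullet> b"
    unfolding partial_def by (rule coords_dir_deriv[OF G y])
qed

lemma partial_local:
  assumes G: "coords U \<phi> Y G" and y: "y \<in> Y"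
    and "f \<in> smooth_functions M" "g \<in> smooth_functions M"
    and "mfd_open M Z" "y \<in> Z" "\<And>z. z \<in> Z \<Longrightarrow> f z = g z"
  shows "partial U \<phi> b f y = partial U \<phi> b g y"
  unfolding partial_def
  by (rule tangent_local[OF dir_deriv_in_tangent_space[OF coordsD(1)[OF G] coordsD(6)[OF G y]] assms(3-7)])

text \<open>\<open>P1\<close> holds the coefficients of the derivatives and \<open>P0\<close> that
  of the function itself. They are required to be global smooth functions because composing two such
  operators differentiates them.\<close>

definition first_order ::
  "'m set \<Rightarrow> ('m \<Rightarrow> 'e) \<Rightarrow> 'm set \<Rightarrow> (('m \<Rightarrow> real) \<Rightarrow> 'm \<Rightarrow> real) \<Rightarrow> ('e \<Rightarrow> 'm \<Rightarrow> real) \<Rightarrow> ('m \<Rightarrow> real) \<Rightarrow> bool"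
  where "first_order U \<phi> Y P P1 P0 \<longleftrightarrow> (\<forall>b. P1 b \<in> smooth_functions M) \<and> P0 \<in> smooth_functions M \<and>
    (\<forall>h\<in>smooth_functions M. P h \<in> smooth_functions M \<and>
      (\<forall>y\<in>Y. P h y = (\<Sum>b\<in>onb. partial U \<phi> b h y * P1 b y) + h y * P0 y))"

lemma first_orderD:
  assumes "first_order U \<phi> Y P P1 P0"
  shows "P1 b \<in> smooth_functions M" "P0 \<in> smooth_functions M"
    "h \<in> smooth_functions M \<Longrightarrow> P h \<in> smooth_functions M"
    "h \<in> smooth_functions M \<Longrightarrow> y \<in> Y \<Longrightarrow> P h y = (\<Sum>b\<in>onb. partial U \<phi> b h y * P1 b y) + h y * P0 y"
  using assms unfolding first_order_def by blast+

text \<open>Supplies the global functions that \<open>partial_commute\<close> asks for; a cutoff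
  inside \<open>Y\<close> makes them agree with the partial derivatives near
  \<open>x\<close>.\<close>

lemma partial_globalize:
  assumes G: "coords U \<phi> Y G" and x: "x \<in> Y" and f: "f \<in> smooth_functions M"
  obtains g Z where "\<And>b. g b \<in> smooth_functions M" "mfd_open M Z" "x \<in> Z" "Z \<subseteq> Y"
    "\<And>z b. z \<in> Z \<Longrightarrow> g b z = partial U \<phi> b f z"
proof -
  obtain \<kappa> Z K where c: "\<kappa> \<in> smooth_functions M" "mfd_open M Z" "x \<in> Z" "Z \<subseteq> K" "K \<subseteq> Y"
    "mfd_open M (carrier M - K)" "\<And>y. y \<in> Z \<Longrightarrow> \<kappa> y = 1" "\<And>y. y \<notin> K \<Longrightarrow> \<kappa> y = (0::real)"
    using cutoff_exists[OF coordsD(2)[OF G] x] by metis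
  show ?thesis
  proof (rule that)
    show "(\<lambda>y. if y \<in> Y then \<kappa> y * partial U \<phi> b f y else 0) \<in> smooth_functions M" for b
      by (rule msmooth_cutoff[OF coordsD(2)[OF G] c(5,6,1) _
            msmooth_mono[OF msmooth_partial[OF coordsD(1)[OF G] f] coordsD(3)[OF G]]]) (simp add: c)
    show "(if z \<in> Y then \<kappa> z * partial U \<phi> b f z else 0) = partial U \<phi> b f z" if "z \<in> Z" for b z
      using that c by auto
  qed (use c in auto)
qed

text \<open>The second-order terms of the commutator cancel by the symmetry of second derivatives.\<close>

lemma first_order_commutator:
  assumes G: "coords U \<phi> Y G" and x: "x \<in> Y"
    and P: "first_order U \<phi> Y P P1 P0" and Q: "first_order U \<phi> Y Q Q1 Q0"
  obtains C C0 where "\<And>h. h \<in> smooth_functions M \<Longrightarrow>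
    P (Q h) x - Q (P h) x = (\<Sum>b\<in>onb. partial U \<phi> b h x * C b) + h x * C0"
proof -
  let ?d = "partial U \<phi>"
  note rules = partial_rules[OF G x]
  \<comment> \<open>\<open>H\<close> is the matrix of second partial derivatives of \<open>h\<close>
    at \<open>x\<close>; all that is remembered of it is symmetry.\<close>
  have main: "\<exists>H. (\<forall>b\<in>onb. \<forall>c\<in>onb. H b c = H c b) \<and>
      P (Q h) x - Q (P h) x =
      (\<Sum>b\<in>onb. ?d b h x * (\<Sum>c\<in>onb. ?d c (Q1 b) x * P1 c x - ?d c (P1 b) x * Q1 c x)) +
      h x * (\<Sum>c\<in>onb. ?d c Q0 x * P1 c x - ?d c P0 x * Q1 c x) +
      ((\<Sum>c\<in>onb. \<Sum>b\<in>onb. H c b * Q1 b x * P1 c x) - (\<Sum>c\<in>onb. \<Sum>b\<in>onb. H c b * P1 b x * Q1 c x))"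
    if h: "h \<in> smooth_functions M" for h
  proof -
    obtain g Z where g: "\<And>b. g b \<in> smooth_functions M" and Z: "mfd_open M Z" "x \<in> Z" "Z \<subseteq> Y"
      and gZ: "\<And>z b. z \<in> Z \<Longrightarrow> g b z = ?d b h z"
      by (rule partial_globalize[OF G x h]) blast
    have sym: "?d c (g b) x = ?d b (g c) x" for b c
      by (rule partial_commute[OF G x h g Z(1,2) gZ])
    \<comment> \<open>Near \<open>x\<close> the partial derivatives of \<open>h\<close> are replaced
      by the global \<open>g b\<close>, so that the product rule for global functions
      applies.\<close>
    have dQ: "?d c (F h) x = (\<Sum>b\<in>onb. ?d b h x * ?d c (F1 b) x + ?d c (g b) x * F1 b x) + (h x * ?d c F0 x + ?d c h x * F0 x)"
      if F: "first_order U \<phi> Y F F1 F0" for F F1 F0 c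
    proof -
      note F' = first_orderD[OF F]
      have sm: "(\<lambda>y. \<Sum>b\<in>onb. g b y * F1 b y) \<in> smooth_functions M" "(\<lambda>y. h y * F0 y) \<in> smooth_functions M"
        by (intro smooth_sum smooth_mult g F' h) (intro smooth_mult F' h)
      have "?d c (F h) x = ?d c (\<lambda>y. (\<Sum>b\<in>onb. g b y * F1 b y) + h y * F0 y) x"
        by (rule partial_local[OF G x F'(3)[OF h] smooth_add[OF sm] Z(1,2)])
          (use F'(4)[OF h] Z(3) gZ in \<open>auto intro!: sum.cong\<close>)
      also have "\<dots> = (\<Sum>b\<in>onb. ?d c (\<lambda>y. g b y * F1 b y) x) + ?d c (\<lambda>y. h y * F0 y) x"
        by (subst rules(2)[OF sm]) (subst rules(5); simp add: smooth_mult g F')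
      also have "\<dots> = (\<Sum>b\<in>onb. g b x * ?d c (F1 b) x + ?d c (g b) x * F1 b x) + (h x * ?d c F0 x + ?d c h x * F0 x)"
        by (simp add: rules(3) g F' h)
      finally show ?thesis using gZ[OF Z(2)] by simp
    qed
    \<comment> \<open>Stated for arbitrary operators in order to be used for both compositions. The
      last summand in parentheses is symmetric under exchange of the two operators and so cancels in
      the commutator.\<close>
    have PQ: "E (F h) x = (\<Sum>b\<in>onb. ?d b h x * (\<Sum>c\<in>onb. ?d c (F1 b) x * E1 c x)) +
        h x * (\<Sum>c\<in>onb. ?d c F0 x * E1 c x) + (\<Sum>c\<in>onb. \<Sum>b\<in>onb. ?d c (g b) x * F1 b x * E1 c x) +
        (F0 x * (\<Sum>c\<in>onb. ?d c h x * E1 c x) + E0 x * (\<Sum>b\<in>onb. ?d b h x * F1 b x) + h x * F0 x * E0 x)"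
      if E: "first_order U \<phi> Y E E1 E0" and F: "first_order U \<phi> Y F F1 F0" for E E1 E0 F F1 F0
    proof -
      have "E (F h) x = (\<Sum>c\<in>onb. ?d c (F h) x * E1 c x) + F h x * E0 x"
        by (rule first_orderD(4)[OF E first_orderD(3)[OF F h] x])
      also have "(\<Sum>c\<in>onb. ?d c (F h) x * E1 c x) =
          (\<Sum>c\<in>onb. \<Sum>b\<in>onb. ?d b h x * (?d c (F1 b) x * E1 c x)) + (\<Sum>c\<in>onb. \<Sum>b\<in>onb. ?d c (g b) x * F1 b x * E1 c x) +
          (h x * (\<Sum>c\<in>onb. ?d c F0 x * E1 c x) + F0 x * (\<Sum>c\<in>onb. ?d c h x * E1 c x))"
        unfolding dQ[OF F]
        by (simp add: sum.distrib distrib_right distrib_left sum_distrib_right sum_distrib_left mult_ac)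
      also have "(\<Sum>c\<in>onb. \<Sum>b\<in>onb. ?d b h x * (?d c (F1 b) x * E1 c x)) =
          (\<Sum>b\<in>onb. ?d b h x * (\<Sum>c\<in>onb. ?d c (F1 b) x * E1 c x))"
        by (subst sum.swap) (simp add: sum_distrib_left)
      also have "F h x = (\<Sum>b\<in>onb. ?d b h x * F1 b x) + h x * F0 x"
        by (rule first_orderD(4)[OF F h x])
      finally show ?thesis by (simp add: algebra_simps)
    qed
    have "P (Q h) x - Q (P h) x =
      (\<Sum>b\<in>onb. ?d b h x * (\<Sum>c\<in>onb. ?d c (Q1 b) x * P1 c x - ?d c (P1 b) x * Q1 c x)) +
      h x * (\<Sum>c\<in>onb. ?d c Q0 x * P1 c x - ?d c P0 x * Q1 c x) +
      ((\<Sum>c\<in>onb. \<Sum>b\<in>onb. ?d c (g b) x * Q1 b x * P1 c x) - (\<Sum>c\<in>onb. \<Sum>b\<in>onb. ?d c (g b) x * P1 b x * Q1 c x))"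
      unfolding PQ[OF P Q] PQ[OF Q P] by (simp add: sum_subtractf right_diff_distrib algebra_simps)
    then show ?thesis using sym by (intro exI[of _ "\<lambda>c b. ?d c (g b) x"]) auto
  qed
  have "P (Q h) x - Q (P h) x =
      (\<Sum>b\<in>onb. ?d b h x * (\<Sum>c\<in>onb. ?d c (Q1 b) x * P1 c x - ?d c (P1 b) x * Q1 c x)) +
      h x * (\<Sum>c\<in>onb. ?d c Q0 x * P1 c x - ?d c P0 x * Q1 c x)" if h: "h \<in> smooth_functions M" for h
  proof -
    obtain H where H: "\<And>b c. b \<in> onb \<Longrightarrow> c \<in> onb \<Longrightarrow> H b c = H c b" and
      eq: "P (Q h) x - Q (P h) x =
      (\<Sum>b\<in>onb. ?d b h x * (\<Sum>c\<in>onb. ?d c (Q1 b) x * P1 c x - ?d c (P1 b) x * Q1 c x)) +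
      h x * (\<Sum>c\<in>onb. ?d c Q0 x * P1 c x - ?d c P0 x * Q1 c x) +
      ((\<Sum>c\<in>onb. \<Sum>b\<in>onb. H c b * Q1 b x * P1 c x) - (\<Sum>c\<in>onb. \<Sum>b\<in>onb. H c b * P1 b x * Q1 c x))"
      using main[OF h] by blast
    \<comment> \<open>Exchanging the summations and using the symmetry of \<open>H\<close>
      identifies the two second-order sums.\<close>
    have "(\<Sum>c\<in>onb. \<Sum>b\<in>onb. H c b * P1 b x * Q1 c x) = (\<Sum>b\<in>onb. \<Sum>c\<in>onb. H c b * P1 b x * Q1 c x)"
      by (rule sum.swap)
    also have "\<dots> = (\<Sum>c\<in>onb. \<Sum>b\<in>onb. H c b * Q1 b x * P1 c x)"
      by (intro sum.cong refl) (simp add: H mult_ac)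
    finally show ?thesis unfolding eq by simp
  qed
  then show ?thesis by (rule that)
qed

end

text \<open>A candidate for a Jacobi structure: the pointwise algebra is given, smoothness is known
  on the generators only, and the Jacobi identity is left open.\<close>

locale almost_jacobi = jet_generated_mfd M S
  for M :: "('m, 'e::finite_dim_inner) atlas" and S +
  fixes L :: "'m \<Rightarrow> 'm bivec" and E :: "'m \<Rightarrow> 'm tvec"
  assumes L_bivector: "x \<in> carrier M \<Longrightarrow> L x \<in> bivectors M x"
    and L_0: "x \<notin> carrier M \<Longrightarrow> L x = 0"
    and E_tangent: "x \<in> carrier M \<Longrightarrow> E x \<in> tangent_space M x"
    and E_0: "x \<notin> carrier M \<Longrightarrow> E x = 0"
    and L_gen: "a \<in> S \<Longrightarrow> b \<in> S \<Longrightarrow> (\<lambda>x. L x (differential M a x) (differential M b x)) \<in> smooth_functions M"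
    and E_gen: "a \<in> S \<Longrightarrow> (\<lambda>x. E x a) \<in> smooth_functions M"
begin

abbreviation "bracket \<equiv> jacobi_bracket M (L, E)"

lemma L_smooth: "f \<in> smooth_functions M \<Longrightarrow> g \<in> smooth_functions M \<Longrightarrow>
    (\<lambda>x. L x (differential M f x) (differential M g x)) \<in> smooth_functions M"
  using gen_smooth_bivector[OF L_bivector L_gen] by blast

lemma E_smooth: "f \<in> smooth_functions M \<Longrightarrow> (\<lambda>x. E x f) \<in> smooth_functions M"
  using gen_smooth_tangent[OF E_tangent E_gen] by blast

lemma L_bivector_field: "L \<in> bivector_fields M"
  by (rule bivector_fieldsI[OF L_bivector L_0 L_smooth])

lemma E_vector_field: "E \<in> vector_fields M"
  by (rule vector_fieldsI[OF E_tangent E_0 E_smooth])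

lemma bracket_eq: "bracket f g x = L x (differential M f x) (differential M g x) + f x * E x g - g x * E x f"
  by (simp add: jacobi_bracket_def)

lemma bracket_smooth: "f \<in> smooth_functions M \<Longrightarrow> g \<in> smooth_functions M \<Longrightarrow> bracket f g \<in> smooth_functions M"
  unfolding jacobi_bracket_def fst_conv snd_conv
  by (intro smooth_diff smooth_add smooth_mult L_smooth E_smooth)

lemma bracket_skew: "bracket f g = (\<lambda>x. - bracket g f x)"
proof
  fix x
  have "L x (differential M f x) (differential M g x) = - L x (differential M g x) (differential M f x)"
  proof (cases "x \<in> carrier M")
    case True
    then show ?thesis
      using L_bivector[OF True] differential_in_cotangent_space[OF True] unfolding bivectors_def by blast
  qed (simp add: L_0)
  then show "bracket f g x = - bracket g f x" by (simp add: bracket_eq)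
qed

lemma bracket_first_order:
  assumes G: "coords U \<phi> Y G" and f: "f \<in> smooth_functions M"
  shows "first_order U \<phi> Y (bracket f)
    (\<lambda>b x. L x (differential M f x) (differential M (G b) x) + f x * E x (G b)) (\<lambda>x. - E x f)"
  unfolding first_order_def
proof (intro conjI allI ballI)
  show "(\<lambda>x. L x (differential M f x) (differential M (G b) x) + f x * E x (G b)) \<in> smooth_functions M" for b
    by (intro smooth_add smooth_mult L_smooth E_smooth f coordsD(4)[OF G])
  show "(\<lambda>x. - E x f) \<in> smooth_functions M" by (intro smooth_uminus E_smooth f)
  fix h assume h: "h \<in> smooth_functions M"
  show "bracket f h \<in> smooth_functions M" by (rule bracket_smooth[OF f h])
  fix y assume y: "y \<in> Y"
  note yc = coordsD(7)[OF G y]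
  have "L y (differential M f y) (differential M h y) =
      (\<Sum>b\<in>onb. partial U \<phi> b h y * L y (differential M f y) (differential M (G b) y))"
    \<comment> \<open>A one-element first sum reduces the bilinear expansion to linearity in the
      second argument.\<close>
    using bivector_sum[OF L_bivector[OF yc], of "{()}" "\<lambda>_. differential M f y" onb "\<lambda>b. differential M (G b) y"
        "\<lambda>_. 1" "\<lambda>b. partial U \<phi> b h y"] differential_in_cotangent_space[OF yc]
    by (simp add: differential_expand[OF G y h])
  moreover have "E y h = (\<Sum>b\<in>onb. partial U \<phi> b h y * E y (G b))"
    by (rule tangent_expand[OF G y E_tangent[OF yc] h])
  ultimately show "bracket f h y = (\<Sum>b\<in>onb. partial U \<phi> b h y *
      (L y (differential M f y) (differential M (G b) y) + f y * E y (G b))) + h y * (- E y f)"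
    by (simp add: bracket_eq distrib_left sum.distrib sum_distrib_left mult_ac)
qed

section \<open>The Jacobiator\<close>

definition jacobiator :: "('m \<Rightarrow> real) \<Rightarrow> ('m \<Rightarrow> real) \<Rightarrow> ('m \<Rightarrow> real) \<Rightarrow> 'm \<Rightarrow> real"
  where "jacobiator f g h x = bracket f (bracket g h) x + bracket g (bracket h f) x + bracket h (bracket f g) x"

lemma jacobiator_cyclic: "jacobiator f g h x = jacobiator g h f x"
  by (simp add: jacobiator_def)

text \<open>As an operator on its last argument the Jacobiator is the commutator of the brackets
  with \<open>f\<close> and with \<open>g\<close>, minus the bracket with
  \<open>bracket f g\<close>. So at \<open>x\<close> it is a combination of value and first
  derivatives, and constants and coordinates from \<open>S\<close> detect every coefficient.\<close>

lemma jacobiator_gen: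
  assumes f: "f \<in> smooth_functions M" and g: "g \<in> smooth_functions M" and h: "h \<in> smooth_functions M"
    and x: "x \<in> carrier M" and gen: "\<And>a. a \<in> S \<Longrightarrow> jacobiator f g a x = 0"
  shows "jacobiator f g h x = 0"
proof -
  obtain U \<phi> Y G where G: "coords U \<phi> Y G" "x \<in> Y" "\<And>b. G b \<in> S" using gen_coords[OF x] by blast
  note fo = bracket_first_order[OF G(1)]
  note rules = partial_rules[OF G(1,2)]
  have eq: "jacobiator f g k x = bracket f (bracket g k) x - bracket g (bracket f k) x - bracket (bracket f g) k x"
    if k: "k \<in> smooth_functions M" for k
  proof -
    have fk: "bracket f k \<in> smooth_functions M" by (rule bracket_smooth[OF f k])
    have "bracket g (\<lambda>y. - bracket f k y) x = - bracket g (bracket f k) x"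
      unfolding first_orderD(4)[OF fo[OF g] smooth_uminus[OF fk] G(2)] first_orderD(4)[OF fo[OF g] fk G(2)]
      by (simp add: rules(4)[OF fk] sum_negf)
    then show ?thesis
      unfolding jacobiator_def using bracket_skew[of k f] fun_cong[OF bracket_skew[of k "bracket f g"], of x] by simp
  qed
  obtain C C0 where C: "\<And>k. k \<in> smooth_functions M \<Longrightarrow>
      bracket f (bracket g k) x - bracket g (bracket f k) x = (\<Sum>b\<in>onb. partial U \<phi> b k x * C b) + k x * C0"
    by (rule first_order_commutator[OF G(1,2) fo[OF f] fo[OF g]]) blast
  define R where "R = (\<lambda>b. L x (differential M (bracket f g) x) (differential M (G b) x) + bracket f g x * E x (G b))"
  define D where "D = (\<lambda>b. C b - R b)"
  define D0 where "D0 = C0 + E x (bracket f g)"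
  have jac: "jacobiator f g k x = (\<Sum>b\<in>onb. partial U \<phi> b k x * D b) + k x * D0"
    if k: "k \<in> smooth_functions M" for k
    unfolding eq[OF k] C[OF k] first_orderD(4)[OF fo[OF bracket_smooth[OF f g]] k G(2)]
    by (simp add: D_def D0_def R_def right_diff_distrib sum_subtractf distrib_left)
  \<comment> \<open>The constant 1 has no derivatives and isolates \<open>D0\<close>. This comes
    first because a coordinate function may be nonzero at \<open>x\<close> and would otherwise mix
    \<open>D0\<close> with \<open>D c\<close>.\<close>
  have "D0 = 0" using jac[OF smooth_const, of 1] gen[OF gen_const, of 1] by (simp add: rules(1))
  moreover have "D c = 0" if c: "c \<in> onb" for c
  proof -
    have "(\<Sum>b\<in>onb. partial U \<phi> b (G c) x * D b) = (\<Sum>b\<in>onb. if b = c then D c else 0)"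
      using c by (intro sum.cong) (auto simp: rules(6) onb(2))
    also have "\<dots> = D c" using c by (simp add: onb(1))
    finally show ?thesis using jac[OF coordsD(4)[OF G(1)], of c] gen[OF G(3), of c] \<open>D0 = 0\<close> by simp
  qed
  ultimately show ?thesis by (simp add: jac[OF h])
qed

lemma jacobi_structureI:
  assumes gen: "\<And>a b c x. a \<in> S \<Longrightarrow> b \<in> S \<Longrightarrow> c \<in> S \<Longrightarrow> x \<in> carrier M \<Longrightarrow> jacobiator a b c x = 0"
  shows "jacobi_structure M (L, E)"
proof -
  \<comment> \<open>Each round frees one more argument; cyclic symmetry brings it into the last
    place.\<close>
  have 1: "jacobiator a b h x = 0" if "a \<in> S" "b \<in> S" "h \<in> smooth_functions M" "x \<in> carrier M" for a b h x
    by (rule jacobiator_gen[OF gen_smooth gen_smooth]) (use that gen in auto)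
  have 2: "jacobiator a g h x = 0" if "a \<in> S" "g \<in> smooth_functions M" "h \<in> smooth_functions M" "x \<in> carrier M" for a g h x
    using jacobiator_gen[OF that(3) gen_smooth[OF that(1)] that(2,4)] that 1 jacobiator_cyclic by metis
  have 3: "jacobiator f g h x = 0" if "f \<in> smooth_functions M" "g \<in> smooth_functions M" "h \<in> smooth_functions M" "x \<in> carrier M" for f g h x
    by (rule jacobiator_gen[OF that]) (use that 2 jacobiator_cyclic in metis)
  show ?thesis
    unfolding jacobi_structure_def using L_bivector_field E_vector_field 3
    by (simp add: jacobiator_def)
qed

end

section \<open>Affine bundles\<close>

text \<open>Continuity of \<open>h\<close> is given through chart domains only. Open preimages and
  smooth pullbacks are therefore obtained together, from small open sets \<open>Z\<close> that
  \<open>h\<close> maps into a single chart.\<close>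

lemma msmooth_smooth_map:
  assumes M: "mfd M" and N: "mfd N" and h: "smooth_map M N h" and X: "mfd_open N X" and g: "msmooth N X g"
  shows "mfd_open M (carrier M \<inter> h -` X)" "msmooth M (carrier M \<inter> h -` X) (\<lambda>x. g (h x))"
proof -
  interpret M: mfd M by (rule M)
  interpret N: mfd N by (rule N)
  have *: "\<exists>Z. mfd_open M Z \<and> x \<in> Z \<and> Z \<subseteq> carrier M \<inter> h -` X \<and> msmooth M Z (\<lambda>x. g (h x))"
    if x: "x \<in> carrier M" "h x \<in> X" for x
  proof -
    obtain V \<psi> where V: "(V, \<psi>) \<in> N" "h x \<in> V"
      by (rule chartE[OF subsetD[OF mfd_open_subset[OF X] x(2)]])
    let ?Y = "carrier M \<inter> h -` V"
    have Y: "mfd_open M ?Y" "msmooth M ?Y (\<lambda>x. \<psi> (h x))"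
      using h V(1) unfolding smooth_map_iff o_def by blast+
    define Z where "Z = ?Y \<inter> (\<lambda>x. \<psi> (h x)) -` (\<psi> ` (V \<inter> X))"
    have VX: "open (\<psi> ` (V \<inter> X))" by (rule mfd_open_image[OF X V(1)])
    have Z: "mfd_open M Z" unfolding Z_def by (rule M.open_vimage[OF Y VX])
    have ZX: "h z \<in> V \<inter> X" if "z \<in> Z" for z
      using that inj_onD[OF N.chart_inj[OF V(1)]] unfolding Z_def by blast
    have gV: "smooth_on (\<psi> ` (V \<inter> X)) (g \<circ> inv_into V \<psi>)" using g V(1) unfolding msmooth_def by blast
    have "msmooth M Z (\<lambda>x. (g \<circ> inv_into V \<psi>) (\<psi> (h x)))"
      by (rule M.msmooth_compose[OF Z VX _ gV msmooth_mono[OF Y(2)]]) (auto simp: Z_def)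
    then have "msmooth M Z (\<lambda>x. g (h x))"
      by (rule M.msmooth_cong[OF Z, rotated]) (use ZX N.chart_inj[OF V(1)] in auto)
    moreover have "x \<in> Z" using x V by (auto simp: Z_def)
    moreover have "Z \<subseteq> carrier M \<inter> h -` X" using ZX by (auto simp: Z_def)
    ultimately show ?thesis using Z by blast
  qed
  show "mfd_open M (carrier M \<inter> h -` X)"
    by (rule M.openI) (use * in blast)
  show "msmooth M (carrier M \<inter> h -` X) (\<lambda>x. g (h x))"
    by (rule M.msmooth_local) (use * in blast)
qed

lemma carrier_open_atlas: "carrier (open_atlas M W) = carrier M \<inter> W"
proof -
  have "open_atlas M W = (\<lambda>(U, \<phi>). (U \<inter> W, \<phi>)) ` M" unfolding open_atlas_def by auto
  then show ?thesis unfolding carrier_def by auto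
qed

lemma carrier_prod_linear: "carrier (prod_atlas M (linear_atlas :: ('f, 'f) atlas)) = carrier M \<times> UNIV"
proof -
  have "prod_atlas M (linear_atlas :: ('f, 'f) atlas) = (\<lambda>(U, \<phi>). (U \<times> UNIV, map_prod \<phi> id)) ` M"
    unfolding prod_atlas_def linear_atlas_def by auto
  then show ?thesis unfolding carrier_def by auto
qed

lemma smooth_mapD:
  assumes "smooth_map M N f" "(U, \<phi>) \<in> M" "(V, \<psi>) \<in> N"
  shows "open (\<phi> ` (U \<inter> f -` V))" "smooth_on (\<phi> ` (U \<inter> f -` V)) (\<psi> \<circ> f \<circ> inv_into U \<phi>)"
  using assms unfolding smooth_map_def by blast+

locale affine_bdl =
  fixes A :: "('m, 'e::finite_dim_inner, 'a, 'f::finite_dim_inner, 'v::real_vector) affine_bundle_data"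
  assumes affine_bundle: "affine_bundle A"
begin

sublocale B: mfd "base A" using affine_bundle by unfold_locales (simp add: affine_bundle_def)
sublocale N: mfd "total A" using affine_bundle by unfold_locales (simp add: affine_bundle_def)

lemma proj_smooth: "smooth_map (total A) (base A) (proj A)"
  using affine_bundle by (simp add: affine_bundle_def)

lemma proj_carrier: "x \<in> carrier (total A) \<Longrightarrow> proj A x \<in> carrier (base A)"
  using proj_smooth by (auto simp: smooth_map_def)

lemma afibre_iff: "x \<in> afibre A p \<longleftrightarrow> x \<in> carrier (total A) \<and> proj A x = p"
  by (simp add: afibre_def)

lemma afibre_empty: "p \<notin> carrier (base A) \<Longrightarrow> afibre A p = {}"
  using proj_carrier by (auto simp: afibre_iff)

lemma translate_afibre:
  "p \<in> carrier (base A) \<Longrightarrow> x \<in> afibre A p \<Longrightarrow> v \<in> vfibre A p \<Longrightarrow> translate A x v \<in> afibre A p"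
  using affine_bundle unfolding affine_bundle_def by blast

lemma translate_exists:
  "p \<in> carrier (base A) \<Longrightarrow> x \<in> afibre A p \<Longrightarrow> y \<in> afibre A p \<Longrightarrow> \<exists>v\<in>vfibre A p. y = translate A x v"
  using affine_bundle unfolding affine_bundle_def by blast

lemma subspace_vfibre: "p \<in> carrier (base A) \<Longrightarrow> subspace (vfibre A p)"
  using affine_bundle unfolding affine_bundle_def vector_bundle_def by blast

lemma pull_open: "mfd_open (base A) X \<Longrightarrow> mfd_open (total A) (carrier (total A) \<inter> proj A -` X)"
  \<comment> \<open>The constant function is a dummy; only the openness half is wanted.\<close>
  using msmooth_smooth_map(1)[OF N.mfd_axioms B.mfd_axioms proj_smooth _ msmooth_const[of _ _ "0::real"]] .

lemma pull_msmooth: "mfd_open (base A) X \<Longrightarrow> msmooth (base A) X g \<Longrightarrow>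
    msmooth (total A) (carrier (total A) \<inter> proj A -` X) (\<lambda>x. g (proj A x))"
  by (rule msmooth_smooth_map(2)[OF N.mfd_axioms B.mfd_axioms proj_smooth])

lemma pull_smooth: "f \<in> smooth_functions (base A) \<Longrightarrow> (\<lambda>x. f (proj A x)) \<in> smooth_functions (total A)"
proof -
  assume f: "f \<in> smooth_functions (base A)"
  have "carrier (total A) \<inter> proj A -` carrier (base A) = carrier (total A)" using proj_carrier by blast
  then show ?thesis
    using pull_msmooth[OF B.open_carrier, of f] f
    by (simp add: B.smooth_functions_iff N.smooth_functions_iff)
qed

section \<open>Trivializations and functions affine on the fibres\<close>

lemma triv_open: "affine_trivialization A W t \<Longrightarrow> mfd_open (base A) W"
  by (simp add: affine_trivialization_def)

lemma triv_bij:
  assumes t: "affine_trivialization A W t"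
  shows "bij_betw (\<lambda>x. (proj A x, t x)) (carrier (total A) \<inter> proj A -` W) (W \<times> UNIV)"
proof -
  have "carrier (base A) \<inter> W = W" using mfd_open_subset[OF triv_open[OF t]] by blast
  then show ?thesis
    using t unfolding affine_trivialization_def diffeo_def carrier_open_atlas carrier_prod_linear by simp
qed

lemma triv_surj:
  assumes t: "affine_trivialization A W t" and p: "p \<in> W"
  obtains x where "x \<in> afibre A p" "t x = k"
proof -
  have "(p, k) \<in> (\<lambda>x. (proj A x, t x)) ` (carrier (total A) \<inter> proj A -` W)"
    using bij_betw_imp_surj_on[OF triv_bij[OF t]] p by simp
  then show ?thesis using that by (auto simp: afibre_iff)
qed

text \<open>The vector bundle trivialization identifies the model fibre linearly with the typical
  fibre, where Riesz turns the linear part into an inner product. Both implications need the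
  identification: surjectivity and injectivity to transport \<open>l\<close>, linearity to get
  back.\<close>

lemma affine_on_fibre_iff:
  assumes t: "affine_trivialization A W t" and p: "p \<in> W"
  shows "affine_on_fibre A p f \<longleftrightarrow> (\<exists>w c. \<forall>x\<in>afibre A p. f x = w \<bullet> t x + c)"
proof -
  have pc: "p \<in> carrier (base A)" using mfd_open_subset[OF triv_open[OF t]] p by blast
  obtain \<tau> where \<tau>: "vb_trivialization (base A) (vfibre A) (vtotal A) W \<tau>"
    "\<And>x v. x \<in> afibre A p \<Longrightarrow> v \<in> vfibre A p \<Longrightarrow> t (translate A x v) = t x + \<tau> (p, v)"
    using t p unfolding affine_trivialization_def by blast
  define \<sigma> where "\<sigma> = (\<lambda>v. \<tau> (p, v))"
  have lin: "lin_on (vfibre A p) \<sigma>" using \<tau>(1) p unfolding vb_trivialization_def \<sigma>_def by blast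
  have bij: "bij_betw \<sigma> (vfibre A p) UNIV"
  proof -
    have "carrier (vtotal A) = Sigma (carrier (base A)) (vfibre A)"
      using affine_bundle unfolding affine_bundle_def vector_bundle_def by blast
    moreover have "carrier (base A) \<inter> W = W" using mfd_open_subset[OF triv_open[OF t]] by blast
    ultimately have b: "bij_betw (\<lambda>x. (fst x, \<tau> x)) (Sigma (carrier (base A)) (vfibre A) \<inter> fst -` W) (W \<times> UNIV)"
      using \<tau>(1) unfolding vb_trivialization_def diffeo_def carrier_open_atlas carrier_prod_linear by simp
    show ?thesis
      unfolding bij_betw_def
    proof
      show "inj_on \<sigma> (vfibre A p)"
        using inj_onD[OF bij_betw_imp_inj_on[OF b]] pc p unfolding inj_on_def \<sigma>_def by fastforce
      show "\<sigma> ` vfibre A p = UNIV"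
      proof (intro set_eqI iffI UNIV_I)
        fix k
        have "(p, k) \<in> (\<lambda>x. (fst x, \<tau> x)) ` (Sigma (carrier (base A)) (vfibre A) \<inter> fst -` W)"
          using bij_betw_imp_surj_on[OF b] p by simp
        then show "k \<in> \<sigma> ` vfibre A p" by (auto simp: \<sigma>_def)
      qed
    qed
  qed
  note inv = bij_betw_inv_into_left[OF bij] bij_betw_inv_into_right[OF bij UNIV_I]
  have inv_in: "inv_into (vfibre A p) \<sigma> k \<in> vfibre A p" for k
    using bij_betw_apply[OF bij_betw_inv_into[OF bij]] by simp
  show ?thesis
  proof
    assume "affine_on_fibre A p f"
    then obtain l where l: "lin_on (vfibre A p) l"
      "\<And>x v. x \<in> afibre A p \<Longrightarrow> v \<in> vfibre A p \<Longrightarrow> f (translate A x v) = f x + l v"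
      unfolding affine_on_fibre_def by blast
    note S = subspace_vfibre[OF pc]
    have "linear (\<lambda>k. l (inv_into (vfibre A p) \<sigma> k))"
    proof (rule linearI)
      fix k k' :: 'f and r :: real
      let ?i = "inv_into (vfibre A p) \<sigma>"
      have "?i (\<sigma> (?i k + ?i k')) = ?i k + ?i k'" "?i (\<sigma> (r *\<^sub>R ?i k)) = r *\<^sub>R ?i k"
        by (rule inv(1)[OF subspace_add[OF S inv_in inv_in]], rule inv(1)[OF subspace_scale[OF S inv_in]])
      then have i: "?i (k + k') = ?i k + ?i k'" "?i (r *\<^sub>R k) = r *\<^sub>R ?i k"
        by (simp_all add: lin_on_add[OF lin inv_in inv_in] lin_on_scale[OF lin inv_in] inv(2))
      show "l (?i (k + k')) = l (?i k) + l (?i k')" "l (?i (r *\<^sub>R k)) = r *\<^sub>R l (?i k)"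
        unfolding i by (simp_all add: lin_on_add[OF l(1) inv_in inv_in] lin_on_scale[OF l(1) inv_in])
    qed
    then obtain w where w: "\<And>k. l (inv_into (vfibre A p) \<sigma> k) = w \<bullet> k" using riesz by blast
    \<comment> \<open>The point with fibre coordinate 0 serves as origin of the affine fibre; its
      value is the constant term.\<close>
    obtain x0 where x0: "x0 \<in> afibre A p" "t x0 = 0" by (rule triv_surj[OF t p])
    have "f x = w \<bullet> t x + f x0" if x: "x \<in> afibre A p" for x
    proof -
      obtain v where v: "v \<in> vfibre A p" "x = translate A x0 v" using translate_exists[OF pc x0(1) x] by blast
      then have "t x = \<sigma> v" using \<tau>(2)[OF x0(1) v(1)] x0 by (simp add: \<sigma>_def)
      then have "w \<bullet> t x = l v" using w[of "\<sigma> v"] inv(1)[OF v(1)] by simp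
      then show ?thesis using l(2)[OF x0(1) v(1)] v by simp
    qed
    then show "\<exists>w c. \<forall>x\<in>afibre A p. f x = w \<bullet> t x + c" by blast
  next
    assume "\<exists>w c. \<forall>x\<in>afibre A p. f x = w \<bullet> t x + c"
    then obtain w c where wc: "\<And>x. x \<in> afibre A p \<Longrightarrow> f x = w \<bullet> t x + c" by blast
    have "f (translate A x v) = f x + w \<bullet> \<sigma> v" if "x \<in> afibre A p" "v \<in> vfibre A p" for x v
      using wc[OF that(1)] wc[OF translate_afibre[OF pc that]] \<tau>(2)[OF that]
      by (simp add: inner_add_right \<sigma>_def)
    moreover have "lin_on (vfibre A p) (\<lambda>v. w \<bullet> \<sigma> v)"
      using lin by (simp add: lin_on_def inner_add_right)
    ultimately show "affine_on_fibre A p f" unfolding affine_on_fibre_def by blast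
  qed
qed

lemma affine_on_fibre_cong:
  assumes "p \<in> carrier (base A)" "\<And>x. x \<in> afibre A p \<Longrightarrow> f x = g x" "affine_on_fibre A p f"
  shows "affine_on_fibre A p g"
  using assms(2,3) translate_afibre[OF assms(1)] unfolding affine_on_fibre_def by metis

lemma affine_on_fibre_add: "affine_on_fibre A p f \<Longrightarrow> affine_on_fibre A p g \<Longrightarrow> affine_on_fibre A p (\<lambda>x. f x + g x)"
proof -
  assume "affine_on_fibre A p f" "affine_on_fibre A p g"
  then obtain l m where l: "lin_on (vfibre A p) l" "\<forall>x\<in>afibre A p. \<forall>v\<in>vfibre A p. f (translate A x v) = f x + l v"
    and m: "lin_on (vfibre A p) m" "\<forall>x\<in>afibre A p. \<forall>v\<in>vfibre A p. g (translate A x v) = g x + m v"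
    unfolding affine_on_fibre_def by blast
  show ?thesis unfolding affine_on_fibre_def
    by (rule exI[of _ "\<lambda>v. l v + m v"]) (use l m in \<open>auto simp: lin_on_def algebra_simps\<close>)
qed

lemma affine_on_fibre_cmult: "affine_on_fibre A p f \<Longrightarrow> affine_on_fibre A p (\<lambda>x. c * f x)"
proof -
  assume "affine_on_fibre A p f"
  then obtain l where l: "lin_on (vfibre A p) l" "\<forall>x\<in>afibre A p. \<forall>v\<in>vfibre A p. f (translate A x v) = f x + l v"
    unfolding affine_on_fibre_def by blast
  show ?thesis unfolding affine_on_fibre_def
    by (rule exI[of _ "\<lambda>v. c * l v"]) (use l in \<open>auto simp: lin_on_def algebra_simps\<close>)
qed

lemma affine_on_fibre_const: "affine_on_fibre A p (\<lambda>x. c)"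
  unfolding affine_on_fibre_def by (rule exI[of _ "\<lambda>v. 0"]) (simp add: lin_on_def)

lemma affine_functions_smooth: "a \<in> affine_functions A \<Longrightarrow> a \<in> smooth_functions (total A)"
  by (simp add: affine_functions_def)

lemma affine_functions_add:
  "a \<in> affine_functions A \<Longrightarrow> b \<in> affine_functions A \<Longrightarrow> (\<lambda>x. a x + b x) \<in> affine_functions A"
  by (simp add: affine_functions_def N.smooth_add affine_on_fibre_add)

lemma affine_functions_const: "(\<lambda>x. c) \<in> affine_functions A"
  by (simp add: affine_functions_def N.smooth_const affine_on_fibre_const)

lemma affine_functions_cmult: "a \<in> affine_functions A \<Longrightarrow> (\<lambda>x. c * a x) \<in> affine_functions A"
  by (simp add: affine_functions_def N.smooth_mult N.smooth_const affine_on_fibre_cmult)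

lemma affine_functions_sum:
  "(\<And>i. i \<in> I \<Longrightarrow> a i \<in> affine_functions A) \<Longrightarrow> (\<lambda>x. \<Sum>i\<in>I. a i x) \<in> affine_functions A"
  by (induction I rule: infinite_finite_induct) (auto intro: affine_functions_add affine_functions_const)

text \<open>A function pulled back from the base is constant on each fibre, so affine functions form
  a module over the functions on the base.\<close>

lemma affine_functions_pull_mult:
  assumes f: "f \<in> smooth_functions (base A)" and a: "a \<in> affine_functions A"
  shows "(\<lambda>x. f (proj A x) * a x) \<in> affine_functions A"
proof -
  have "affine_on_fibre A p (\<lambda>x. f (proj A x) * a x)" if p: "p \<in> carrier (base A)" for p
    by (rule affine_on_fibre_cong[OF p, of "\<lambda>x. f p * a x"])
      (use a p in \<open>auto simp: afibre_iff affine_functions_def intro: affine_on_fibre_cmult\<close>)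
  then show ?thesis
    using N.smooth_mult[OF pull_smooth[OF f] affine_functions_smooth[OF a]] by (simp add: affine_functions_def)
qed

section \<open>Charts adapted to the bundle\<close>

definition adapted_dom :: "'m set \<Rightarrow> 'm set \<Rightarrow> 'a set"
  where "adapted_dom U W = carrier (total A) \<inter> proj A -` (U \<inter> W)"

text \<open>Base coordinates paired with fibre coordinates: over a fixed base point, an affine
  function becomes an affine function of the second component.\<close>

definition adapted :: "('m \<Rightarrow> 'e) \<Rightarrow> ('a \<Rightarrow> 'f) \<Rightarrow> 'a \<Rightarrow> 'e \<times> 'f"
  where "adapted \<phi> t = (\<lambda>x. (\<phi> (proj A x), t x))"

lemma adapted_inj:
  assumes U: "(U, \<phi>) \<in> base A" and t: "affine_trivialization A W t"
  shows "inj_on (adapted \<phi> t) (adapted_dom U W)"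
proof (rule inj_onI)
  fix x y assume x: "x \<in> adapted_dom U W" and y: "y \<in> adapted_dom U W" and eq: "adapted \<phi> t x = adapted \<phi> t y"
  then have "proj A x = proj A y"
    using inj_onD[OF B.chart_inj[OF U], of "proj A x" "proj A y"] by (auto simp: adapted_dom_def adapted_def)
  then show "x = y"
    using inj_onD[OF bij_betw_imp_inj_on[OF triv_bij[OF t]], of x y] x y eq by (auto simp: adapted_dom_def adapted_def)
qed

lemma adapted_range:
  assumes U: "(U, \<phi>) \<in> base A" and t: "affine_trivialization A W t"
  shows "adapted \<phi> t ` adapted_dom U W = \<phi> ` (U \<inter> W) \<times> UNIV"
proof
  show "\<phi> ` (U \<inter> W) \<times> UNIV \<subseteq> adapted \<phi> t ` adapted_dom U W"
  proof clarify
    fix p k assume p: "p \<in> U" "p \<in> W"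
    obtain x where "x \<in> afibre A p" "t x = k" by (rule triv_surj[OF t p(2)])
    then show "(\<phi> p, k) \<in> adapted \<phi> t ` adapted_dom U W"
      using p by (intro image_eqI[of _ _ x]) (auto simp: afibre_iff adapted_dom_def adapted_def)
  qed
qed (auto simp: adapted_dom_def adapted_def)

text \<open>The trivialization is a diffeomorphism onto a product, and in the product chart
  \<open>map_prod \<phi> id\<close> it becomes the adapted chart. Its smoothness gives one direction
  of compatibility with the atlas, that of its inverse \<open>g\<close> the other.\<close>

lemma adapted_gchart:
  assumes U: "(U, \<phi>) \<in> base A" and t: "affine_trivialization A W t"
  shows "gchart (total A) (adapted_dom U W) (adapted \<phi> t)"
proof -
  let ?E = "open_atlas (total A) (proj A -` W)" and ?P = "prod_atlas (open_atlas (base A) W) (linear_atlas :: ('f, 'f) atlas)"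
  let ?h = "\<lambda>x. (proj A x, t x)" and ?D = "adapted_dom U W" and ?z = "adapted \<phi> t"
  define g where "g = inv_into (carrier ?E) ?h"
  have cE: "carrier ?E = carrier (total A) \<inter> proj A -` W" by (rule carrier_open_atlas)
  have h: "smooth_map ?E ?P ?h" and g: "smooth_map ?P ?E g"
    using t unfolding affine_trivialization_def diffeo_def g_def by blast+
  have gh: "g (?h x) = x" if "x \<in> carrier (total A)" "proj A x \<in> W" for x
    using bij_betw_inv_into_left[OF triv_bij[OF t], of x] that unfolding g_def cE by simp
  have hg: "g (p, k) \<in> carrier (total A)" "proj A (g (p, k)) = p" "t (g (p, k)) = k" if "p \<in> W" for p k
    using bij_betw_inv_into_right[OF triv_bij[OF t], of "(p, k)"]
      bij_betw_apply[OF bij_betw_inv_into[OF triv_bij[OF t]], of "(p, k)"] that unfolding g_def cE by auto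
  have Pc: "((U \<inter> W) \<times> UNIV, map_prod \<phi> id) \<in> ?P"
    using U unfolding prod_atlas_def open_atlas_def linear_atlas_def by blast
  have Ec: "(V \<inter> proj A -` W, \<psi>) \<in> ?E" if "(V, \<psi>) \<in> total A" for V \<psi>
    using that unfolding open_atlas_def by blast
  have smz: "open (\<psi> ` (V \<inter> ?D)) \<and> smooth_on (\<psi> ` (V \<inter> ?D)) (?z \<circ> inv_into V \<psi>)" if V: "(V, \<psi>) \<in> total A" for V \<psi>
  proof -
    have eq: "V \<inter> proj A -` W \<inter> ?h -` ((U \<inter> W) \<times> UNIV) = V \<inter> ?D"
      using chart_subset_carrier[OF V] by (auto simp: adapted_dom_def)
    note 1 = smooth_mapD[OF h Ec[OF V] Pc, unfolded eq]
    have inj: "inj_on \<psi> V" by (rule N.chart_inj[OF V])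
    \<comment> \<open>The charts of \<open>open_atlas\<close> have shrunken domains, which
      \<open>inv_into\<close> sees; on the image of \<open>?D\<close> the two inverses
      agree.\<close>
    have "inv_into (V \<inter> proj A -` W) \<psi> (\<psi> x) = inv_into V \<psi> (\<psi> x)" if "x \<in> V \<inter> ?D" for x
      using that inj inv_into_f_f[OF inj_on_subset[OF inj Int_lower1], of x "proj A -` W"] by (auto simp: adapted_dom_def)
    then have "smooth_on (\<psi> ` (V \<inter> ?D)) (?z \<circ> inv_into V \<psi>)"
      by (intro smooth_on_cong[OF 1(1) _ 1(2)]) (auto simp: adapted_def)
    then show ?thesis using 1 by blast
  qed
  have "open (?z ` (?D \<inter> V)) \<and> smooth_on (?z ` (?D \<inter> V)) (\<psi> \<circ> inv_into ?D ?z)" if V: "(V, \<psi>) \<in> total A" for V \<psi>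
  proof -
    note 1 = smooth_mapD[OF g Pc Ec[OF V]]
    have eq: "map_prod \<phi> id ` ((U \<inter> W) \<times> UNIV \<inter> g -` (V \<inter> proj A -` W)) = ?z ` (?D \<inter> V)"
    proof
      show "map_prod \<phi> id ` ((U \<inter> W) \<times> UNIV \<inter> g -` (V \<inter> proj A -` W)) \<subseteq> ?z ` (?D \<inter> V)"
      proof
        fix y assume "y \<in> map_prod \<phi> id ` ((U \<inter> W) \<times> UNIV \<inter> g -` (V \<inter> proj A -` W))"
        then obtain p k where p: "p \<in> U" "p \<in> W" "g (p, k) \<in> V" and y: "y = (\<phi> p, k)" by auto
        then show "y \<in> ?z ` (?D \<inter> V)"
          by (intro image_eqI[of _ _ "g (p, k)"]) (auto simp: hg adapted_def adapted_dom_def)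
      qed
      show "?z ` (?D \<inter> V) \<subseteq> map_prod \<phi> id ` ((U \<inter> W) \<times> UNIV \<inter> g -` (V \<inter> proj A -` W))"
      proof
        fix y assume "y \<in> ?z ` (?D \<inter> V)"
        then obtain x where "x \<in> ?D" "x \<in> V" and y: "y = ?z x" by auto
        then show "y \<in> map_prod \<phi> id ` ((U \<inter> W) \<times> UNIV \<inter> g -` (V \<inter> proj A -` W))"
          by (intro image_eqI[of _ _ "?h x"]) (auto simp: gh adapted_def adapted_dom_def)
      qed
    qed
    note 2 = 1[unfolded eq]
    have injp: "inj_on (map_prod \<phi> id) ((U \<inter> W) \<times> (UNIV :: 'f set))"
      using inj_on_subset[OF B.chart_inj[OF U] Int_lower1, of W] by (intro map_prod_inj_on) auto
    have "g (inv_into ((U \<inter> W) \<times> UNIV) (map_prod \<phi> id) (?z x)) = inv_into ?D ?z (?z x)" if x: "x \<in> ?D" for x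
    proof -
      have "inv_into ((U \<inter> W) \<times> UNIV) (map_prod \<phi> id) (map_prod \<phi> id (?h x)) = ?h x"
        by (rule inv_into_f_f[OF injp]) (use x in \<open>auto simp: adapted_dom_def\<close>)
      then show ?thesis
        using inv_into_f_f[OF adapted_inj[OF U t] x] gh[of x] x by (simp add: adapted_def adapted_dom_def)
    qed
    then have "smooth_on (?z ` (?D \<inter> V)) (\<psi> \<circ> inv_into ?D ?z)"
      by (intro smooth_on_cong[OF 2(1) _ 2(2)]) auto
    then show ?thesis using 2 by blast
  qed
  moreover have "mfd_open (total A) ?D" using smz by (auto simp: mfd_open_def adapted_dom_def)
  moreover have "msmooth (total A) ?D ?z" using smz by (auto simp: msmooth_def)
  ultimately show ?thesis using adapted_inj[OF U t] by (auto simp: gchart_def)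
qed

lemma adaptedE:
  assumes "p \<in> carrier (base A)"
  obtains U \<phi> W t where "(U, \<phi>) \<in> base A" "affine_trivialization A W t" "p \<in> U" "p \<in> W"
proof -
  obtain U \<phi> where "(U, \<phi>) \<in> base A" "p \<in> U" by (rule chartE[OF assms])
  moreover obtain W t where "affine_trivialization A W t" "p \<in> W"
    using affine_bundle assms unfolding affine_bundle_def by blast
  ultimately show ?thesis using that by blast
qed

text \<open>The domain is a union of whole fibres and the cutoff is constant on each, so every fibre
  carries either a multiple of \<open>f\<close> or 0.\<close>

lemma affine_cutoff:
  assumes U: "(U, \<phi>) \<in> base A" and t: "affine_trivialization A W t"
    and K: "K \<subseteq> U \<inter> W" "mfd_open (base A) (carrier (base A) - K)"
    and \<kappa>: "\<kappa> \<in> smooth_functions (base A)" "\<And>q. q \<notin> K \<Longrightarrow> \<kappa> q = 0"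
    and f: "msmooth (total A) (adapted_dom U W) f" "\<And>q. q \<in> U \<inter> W \<Longrightarrow> affine_on_fibre A q f"
  shows "(\<lambda>y. if y \<in> adapted_dom U W then \<kappa> (proj A y) * f y else 0) \<in> affine_functions A"
proof -
  let ?g = "\<lambda>y. if y \<in> adapted_dom U W then \<kappa> (proj A y) * f y else 0"
  have "?g \<in> smooth_functions (total A)"
  proof (rule N.msmooth_cutoff[OF N.gchart_open[OF adapted_gchart[OF U t]] _ _ pull_smooth[OF \<kappa>(1)] _ f(1)])
    show "carrier (total A) \<inter> proj A -` K \<subseteq> adapted_dom U W" using K by (auto simp: adapted_dom_def)
    have "carrier (total A) - (carrier (total A) \<inter> proj A -` K) =
        carrier (total A) \<inter> proj A -` (carrier (base A) - K)" using proj_carrier by blast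
    then show "mfd_open (total A) (carrier (total A) - (carrier (total A) \<inter> proj A -` K))"
      using pull_open[OF K(2)] by simp
  qed (use \<kappa> in auto)
  moreover have "affine_on_fibre A q ?g" if q: "q \<in> carrier (base A)" for q
  proof (cases "q \<in> U \<inter> W")
    case True
    show ?thesis
      by (rule affine_on_fibre_cong[OF q _ affine_on_fibre_cmult[OF f(2)[OF True], of "\<kappa> q"]])
        (use True in \<open>auto simp: afibre_iff adapted_dom_def\<close>)
  next
    case False
    show ?thesis
      by (rule affine_on_fibre_cong[OF q _ affine_on_fibre_const[of _ 0]])
        (use False in \<open>auto simp: afibre_iff adapted_dom_def\<close>)
  qed
  ultimately show ?thesis by (simp add: affine_functions_def)
qed

text \<open>Linear functions of an adapted chart are affine on fibres, with the base component
  contributing only a constant there. The set on which the cut-off functions are genuine coordinates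
  consists of whole fibres, since the cutoff equals 1 over an open set of the base.\<close>

lemma affine_coords_exist:
  assumes x: "x \<in> carrier (total A)"
  shows "\<exists>U \<phi> Y G. N.coords U \<phi> Y G \<and> x \<in> Y \<and> (\<forall>b. G b \<in> affine_functions A)"
proof -
  obtain U \<phi> W t where U: "(U, \<phi>) \<in> base A" and t: "affine_trivialization A W t"
    and p: "proj A x \<in> U" "proj A x \<in> W" by (rule adaptedE[OF proj_carrier[OF x]])
  note gc = adapted_gchart[OF U t]
  obtain \<kappa> Z K where c: "\<kappa> \<in> smooth_functions (base A)" "mfd_open (base A) Z" "proj A x \<in> Z" "Z \<subseteq> K" "K \<subseteq> U \<inter> W"
    "mfd_open (base A) (carrier (base A) - K)" "\<And>y. y \<in> Z \<Longrightarrow> \<kappa> y = 1" "\<And>y. y \<notin> K \<Longrightarrow> \<kappa> y = (0::real)"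
    using B.cutoff_exists[OF B.open_Int[OF B.open_chart[OF U] triv_open[OF t]]] p by (metis IntI)
  define G where "G = (\<lambda>b y. if y \<in> adapted_dom U W then \<kappa> (proj A y) * (b \<bullet> adapted \<phi> t y) else 0)"
  have "G b \<in> affine_functions A" for b
    unfolding G_def
  proof (rule affine_cutoff[OF U t c(5,6,1,8)])
    show "msmooth (total A) (adapted_dom U W) (\<lambda>y. b \<bullet> adapted \<phi> t y)"
      by (rule N.msmooth_inner[OF N.gchart_open[OF gc] msmooth_const N.gchart_msmooth[OF gc]])
    fix q assume q: "q \<in> U \<inter> W"
    have "\<forall>y\<in>afibre A q. b \<bullet> adapted \<phi> t y = snd b \<bullet> t y + fst b \<bullet> \<phi> q"
      by (auto simp: afibre_iff adapted_def inner_prod_def)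
    then show "affine_on_fibre A q (\<lambda>y. b \<bullet> adapted \<phi> t y)"
      using affine_on_fibre_iff[OF t, of q] q by blast
  qed
  moreover have "N.coords (adapted_dom U W) (adapted \<phi> t) (carrier (total A) \<inter> proj A -` Z) G"
    unfolding N.coords_def using gc pull_open[OF c(2)] c calculation affine_functions_smooth
    by (auto simp: G_def adapted_dom_def)
  ultimately show ?thesis using x c(3) by blast
qed

sublocale J: jet_generated_mfd "total A" "affine_functions A"
  by unfold_locales (use affine_functions_smooth affine_functions_const affine_coords_exist in blast)+

text \<open>The trivialization maps the fibre onto the whole typical fibre, hence an affine function
  determines its coefficients. This gives the charts of \<open>dual_total\<close> a unique witness
  for their description operator.\<close>

lemma the_coeffs:
  assumes t: "affine_trivialization A W t" and p: "p \<in> W" and f: "\<And>x. x \<in> afibre A p \<Longrightarrow> f x = w \<bullet> t x + c"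
  shows "(THE wc. \<forall>x\<in>afibre A p. f x = fst wc \<bullet> t x + snd wc) = (w, c)"
proof (rule the_equality)
  show "\<forall>x\<in>afibre A p. f x = fst (w, c) \<bullet> t x + snd (w, c)" using f by simp
  fix wc assume wc: "\<forall>x\<in>afibre A p. f x = fst wc \<bullet> t x + snd wc"
  have eq: "fst wc \<bullet> k + snd wc = w \<bullet> k + c" for k
  proof -
    obtain x where "x \<in> afibre A p" "t x = k" by (rule triv_surj[OF t p])
    then show ?thesis using f wc by metis
  qed
  have c: "snd wc = c" using eq[of 0] by simp
  have "fst wc = w" by (rule inner_eqI) (use eq c in \<open>simp add: inner_commute\<close>)
  then show "wc = (w, c)" using c by (simp add: prod_eq_iff)
qed

text \<open>An affine function is fibrewise affine in an adapted chart; its coefficients depend smoothly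
  on the base point because they are differences of its values along local sections with
  constant fibre coordinate.\<close>

definition local_rep :: "'m set \<Rightarrow> ('m \<Rightarrow> 'e) \<Rightarrow> 'm set \<Rightarrow> ('a \<Rightarrow> 'f) \<Rightarrow> ('a \<Rightarrow> real) \<Rightarrow> 'f \<Rightarrow> 'm \<Rightarrow> real"
  where "local_rep U \<phi> W t a k p = (a \<circ> inv_into (adapted_dom U W) (adapted \<phi> t)) (\<phi> p, k)"

lemma local_rep_eq:
  assumes U: "(U, \<phi>) \<in> base A" and t: "affine_trivialization A W t" and x: "x \<in> adapted_dom U W"
  shows "local_rep U \<phi> W t a (t x) (proj A x) = a x"
  using inv_into_f_f[OF adapted_inj[OF U t] x] by (simp add: local_rep_def adapted_def)

lemma local_rep_affine:
  assumes U: "(U, \<phi>) \<in> base A" and t: "affine_trivialization A W t" and p: "p \<in> U" "p \<in> W"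
    and wc: "\<And>x. x \<in> afibre A p \<Longrightarrow> a x = w \<bullet> t x + c"
  shows "local_rep U \<phi> W t a k p = w \<bullet> k + c"
proof -
  obtain x where x: "x \<in> afibre A p" "t x = k" by (rule triv_surj[OF t p(2)])
  then have "x \<in> adapted_dom U W" using p by (simp add: afibre_iff adapted_dom_def)
  from local_rep_eq[OF U t this, of a] show ?thesis using x wc[OF x(1)] by (simp add: afibre_iff)
qed

lemma msmooth_local_rep:
  assumes U: "(U, \<phi>) \<in> base A" and t: "affine_trivialization A W t" and a: "a \<in> smooth_functions (total A)"
  shows "msmooth (base A) (U \<inter> W) (local_rep U \<phi> W t a k)"
  unfolding local_rep_def[abs_def]
proof (rule B.msmooth_compose[OF B.open_Int[OF B.open_chart[OF U] triv_open[OF t]],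
      where f = "\<lambda>p. (\<phi> p, k)" and g = "a \<circ> inv_into (adapted_dom U W) (adapted \<phi> t)"])
  note gc = adapted_gchart[OF U t]
  show "open (adapted \<phi> t ` adapted_dom U W)" by (rule N.gchart_open_range[OF gc])
  show "(\<lambda>p. (\<phi> p, k)) ` (U \<inter> W) \<subseteq> adapted \<phi> t ` adapted_dom U W" unfolding adapted_range[OF U t] by auto
  show "smooth_on (adapted \<phi> t ` adapted_dom U W) (a \<circ> inv_into (adapted_dom U W) (adapted \<phi> t))"
    by (rule N.gchart_smooth_function[OF gc a])
  show "msmooth (base A) (U \<inter> W) (\<lambda>p. (\<phi> p, k))"
    by (intro B.msmooth_Pair B.open_Int B.open_chart[OF U] triv_open[OF t] msmooth_const
        msmooth_mono[OF B.gchart_msmooth[OF B.gchart_chart[OF U]]] Int_lower1)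
qed

section \<open>Affine functions as sections of the bundle of affine functions\<close>

lemma tilde_dual_fibre:
  assumes a: "a \<in> affine_functions A" and p: "p \<in> carrier (base A)"
  shows "tilde A a p \<in> dual_fibre A p"
  using affine_on_fibre_cong[OF p, of a "tilde A a p"] a p
  by (simp add: dual_fibre_def tilde_def affine_functions_def)

lemma tilde_section:
  assumes a: "a \<in> affine_functions A"
  shows "tilde A a \<in> sections (base A) (dual_fibre A) (dual_total A)"
proof -
  note fib = tilde_dual_fibre[OF a]
  have "smooth_map (base A) (dual_total A) (\<lambda>p. (p, tilde A a p))"
    unfolding smooth_map_iff
  proof (intro conjI ballI)
    show "(\<lambda>p. (p, tilde A a p)) ` carrier (base A) \<subseteq> carrier (dual_total A)"
    proof clarify
      fix p assume p: "p \<in> carrier (base A)"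
      obtain U \<phi> W t where U: "(U, \<phi>) \<in> base A" "affine_trivialization A W t" "p \<in> U" "p \<in> W" by (rule adaptedE[OF p])
      then have "Sigma (U \<inter> W) (dual_fibre A) \<in> fst ` dual_total A"
        by (force simp: dual_total_def)
      then show "(p, tilde A a p) \<in> carrier (dual_total A)"
        using U fib[OF p] unfolding carrier_def by blast
    qed
  next
    fix c assume "c \<in> dual_total A"
    then obtain U \<phi> W t where c: "c = (Sigma (U \<inter> W) (dual_fibre A),
       \<lambda>(p, f). (\<phi> p, THE wc. \<forall>x\<in>afibre A p. f x = fst wc \<bullet> t x + snd wc))"
      and U: "(U, \<phi>) \<in> base A" and t: "affine_trivialization A W t"
      unfolding dual_total_def by blast
    have op: "mfd_open (base A) (U \<inter> W)" by (rule B.open_Int[OF B.open_chart[OF U] triv_open[OF t]])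
    have eq: "carrier (base A) \<inter> (\<lambda>p. (p, tilde A a p)) -` Sigma (U \<inter> W) (dual_fibre A) = U \<inter> W"
      using chart_subset_carrier[OF U] fib by auto
    let ?r = "local_rep U \<phi> W t a"
    have sm: "msmooth (base A) (U \<inter> W) (\<lambda>p. (\<phi> p, (\<Sum>k\<in>onb. (?r k p - ?r 0 p) *\<^sub>R k, ?r 0 p)))"
      by (intro B.msmooth_Pair B.msmooth_sum B.msmooth_scaleR B.msmooth_diff op msmooth_local_rep[OF U t]
          affine_functions_smooth[OF a] msmooth_const
          msmooth_mono[OF B.gchart_msmooth[OF B.gchart_chart[OF U]]] Int_lower1)
    have "(\<Sum>k\<in>onb. (?r k p - ?r 0 p) *\<^sub>R k, ?r 0 p) =
        (THE wc. \<forall>x\<in>afibre A p. tilde A a p x = fst wc \<bullet> t x + snd wc)" if p: "p \<in> U \<inter> W" for p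
    proof -
      have "affine_on_fibre A p a" using a p chart_subset_carrier[OF U] by (auto simp: affine_functions_def)
      then obtain w c where wc: "\<And>x. x \<in> afibre A p \<Longrightarrow> a x = w \<bullet> t x + c"
        using affine_on_fibre_iff[OF t, of p] p by auto
      have "(THE wc. \<forall>x\<in>afibre A p. tilde A a p x = fst wc \<bullet> t x + snd wc) = (w, c)"
        by (rule the_coeffs[OF t]) (use p wc in \<open>auto simp: tilde_def\<close>)
      moreover have "?r k p = w \<bullet> k + c" for k
        by (rule local_rep_affine[OF U t]) (use p wc in auto)
      ultimately show ?thesis using onb_expand[of w] by simp
    qed
    then have "msmooth (base A) (U \<inter> W) (\<lambda>p. (\<phi> p, THE wc. \<forall>x\<in>afibre A p. tilde A a p x = fst wc \<bullet> t x + snd wc))"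
      by (intro B.msmooth_cong[OF op _ sm]) simp
    then show "case c of (V, \<psi>) \<Rightarrow> mfd_open (base A) (carrier (base A) \<inter> (\<lambda>p. (p, tilde A a p)) -` V) \<and>
        msmooth (base A) (carrier (base A) \<inter> (\<lambda>p. (p, tilde A a p)) -` V) (\<psi> \<circ> (\<lambda>p. (p, tilde A a p)))"
      by (simp add: c eq op o_def)
  qed
  then show ?thesis
    using fib afibre_empty by (auto simp: sections_def tilde_def)
qed

text \<open>In an adapted chart the function is the inner product of a coefficient vector with
  \<open>t\<close>, plus a coefficient; both coefficients are coordinates of the section in
  \<open>dual_total\<close>, hence smooth.\<close>

lemma section_affine:
  assumes s: "s \<in> sections (base A) (dual_fibre A) (dual_total A)"
  shows "(\<lambda>x. s (proj A x) x) \<in> affine_functions A"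
proof -
  have fib: "s p \<in> dual_fibre A p" if "p \<in> carrier (base A)" for p
    using s that by (simp add: sections_def)
  have "(\<lambda>x. s (proj A x) x) \<in> smooth_functions (total A)"
    unfolding N.smooth_functions_iff
  proof (rule N.msmooth_local)
    fix x assume x: "x \<in> carrier (total A)"
    obtain U \<phi> W t where U: "(U, \<phi>) \<in> base A" and t: "affine_trivialization A W t"
      and p: "proj A x \<in> U" "proj A x \<in> W" by (rule adaptedE[OF proj_carrier[OF x]])
    note gc = adapted_gchart[OF U t] and D = N.gchart_open[OF adapted_gchart[OF U t]]
    let ?c = "\<lambda>p. THE wc. \<forall>x\<in>afibre A p. s p x = fst wc \<bullet> t x + snd wc"
    have op: "mfd_open (base A) (U \<inter> W)" by (rule B.open_Int[OF B.open_chart[OF U] triv_open[OF t]])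
    have mem: "(Sigma (U \<inter> W) (dual_fibre A),
       \<lambda>(p, f). (\<phi> p, THE wc. \<forall>x\<in>afibre A p. f x = fst wc \<bullet> t x + snd wc)) \<in> dual_total A"
      using U t unfolding dual_total_def by blast
    have eq: "carrier (base A) \<inter> (\<lambda>p. (p, s p)) -` Sigma (U \<inter> W) (dual_fibre A) = U \<inter> W"
      using chart_subset_carrier[OF U] fib by auto
    have "smooth_map (base A) (dual_total A) (\<lambda>p. (p, s p))" using s by (simp add: sections_def)
    then have "msmooth (base A) (U \<inter> W) (\<lambda>p. (\<phi> p, ?c p))"
      using mem eq unfolding smooth_map_iff o_def by fastforce
    from pull_msmooth[OF op this] have 1: "msmooth (total A) (adapted_dom U W) (\<lambda>x. (\<phi> (proj A x), ?c (proj A x)))"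
      by (simp add: adapted_dom_def)
    have c: "msmooth (total A) (adapted_dom U W) (\<lambda>x. ?c (proj A x))"
      using N.msmooth_bounded_linear[OF D bounded_linear_snd 1] by simp
    have tt: "msmooth (total A) (adapted_dom U W) t"
      using N.msmooth_bounded_linear[OF D bounded_linear_snd N.gchart_msmooth[OF gc]] by (simp add: adapted_def)
    have sm: "msmooth (total A) (adapted_dom U W) (\<lambda>x. fst (?c (proj A x)) \<bullet> t x + snd (?c (proj A x)))"
      by (intro N.msmooth_add D N.msmooth_inner tt
          N.msmooth_bounded_linear[OF D bounded_linear_snd c] N.msmooth_bounded_linear[OF D bounded_linear_fst c])
    have "fst (?c (proj A y)) \<bullet> t y + snd (?c (proj A y)) = s (proj A y) y" if y: "y \<in> adapted_dom U W" for y
    proof -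
      have yW: "proj A y \<in> W" and yc: "proj A y \<in> carrier (base A)" and yf: "y \<in> afibre A (proj A y)"
        using y proj_carrier by (auto simp: adapted_dom_def afibre_iff)
      have "affine_on_fibre A (proj A y) (s (proj A y))" using fib[OF yc] by (simp add: dual_fibre_def)
      then obtain w c where wc: "\<And>x. x \<in> afibre A (proj A y) \<Longrightarrow> s (proj A y) x = w \<bullet> t x + c"
        using affine_on_fibre_iff[OF t yW] by blast
      show ?thesis using the_coeffs[OF t yW wc] wc[OF yf] by simp
    qed
    from N.msmooth_cong[OF D this sm]
    show "\<exists>Y. mfd_open (total A) Y \<and> x \<in> Y \<and> msmooth (total A) Y (\<lambda>x. s (proj A x) x)"
      using D x p by (intro exI[of _ "adapted_dom U W"]) (auto simp: adapted_dom_def)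
  qed
  moreover have "affine_on_fibre A p (\<lambda>x. s (proj A x) x)" if p: "p \<in> carrier (base A)" for p
    by (rule affine_on_fibre_cong[OF p, of "s p"]) (use fib[OF p] in \<open>auto simp: dual_fibre_def afibre_iff\<close>)
  ultimately show ?thesis by (simp add: affine_functions_def)
qed

text \<open>Equality at all arguments rests on the normalisations: elements of
  \<open>dual_fibre\<close> vanish off their fibre, and sections vanish off the base.\<close>

lemma tilde_of_section:
  assumes s: "s \<in> sections (base A) (dual_fibre A) (dual_total A)"
  shows "tilde A (\<lambda>x. s (proj A x) x) = s"
proof (rule ext, rule ext)
  fix p x
  show "tilde A (\<lambda>x. s (proj A x) x) p x = s p x"
  proof (cases "p \<in> carrier (base A)")
    case True
    then have "s p \<in> dual_fibre A p" using s by (simp add: sections_def)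
    then show ?thesis by (auto simp: tilde_def dual_fibre_def afibre_iff)
  next
    case False
    then have "s p = 0" using s by (simp add: sections_def)
    then show ?thesis using afibre_empty[OF False] by (simp add: tilde_def)
  qed
qed

end

section \<open>The affine Jacobi structure of a Lie algebroid\<close>

locale affine_algebroid = affine_bdl A
  for A :: "('m, 'e::finite_dim_inner, 'a, 'f::finite_dim_inner, 'v::real_vector) affine_bundle_data" +
  fixes br :: "('m \<Rightarrow> 'a \<Rightarrow> real) \<Rightarrow> ('m \<Rightarrow> 'a \<Rightarrow> real) \<Rightarrow> 'm \<Rightarrow> 'a \<Rightarrow> real"
    and \<rho> :: "'m \<Rightarrow> ('a \<Rightarrow> real) \<Rightarrow> 'm tvec"
  assumes algebroid: "lie_algebroid_structure (base A) (dual_fibre A) (dual_total A) br \<rho>"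
begin

section \<open>The bracket transported to affine functions\<close>

definition lie :: "('a \<Rightarrow> real) \<Rightarrow> ('a \<Rightarrow> real) \<Rightarrow> 'a \<Rightarrow> real"
  where "lie a b x = br (tilde A a) (tilde A b) (proj A x) x"

abbreviation "aff \<equiv> affine_functions A"
abbreviation "sect \<equiv> sections (base A) (dual_fibre A) (dual_total A)"

lemma lie_bracket: "lie_bracket_on sect br"
  using algebroid by (simp add: lie_algebroid_structure_def)

lemma br_section: "X \<in> sect \<Longrightarrow> Y \<in> sect \<Longrightarrow> br X Y \<in> sect"
  using lie_bracket by (simp add: lie_bracket_on_def)

lemma lie_affine:
  assumes "a \<in> aff" "b \<in> aff"
  shows "lie a b \<in> aff"
  using section_affine[OF br_section[OF tilde_section[OF assms(1)] tilde_section[OF assms(2)]]]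
  by (simp add: lie_def[abs_def])

lemma tilde_lie:
  assumes "a \<in> aff" "b \<in> aff"
  shows "tilde A (lie a b) = br (tilde A a) (tilde A b)"
  using tilde_of_section[OF br_section[OF tilde_section[OF assms(1)] tilde_section[OF assms(2)]]]
  by (simp add: lie_def[abs_def])

lemma tilde_cong: "(\<And>x. x \<in> carrier (total A) \<Longrightarrow> a x = b x) \<Longrightarrow> tilde A a = tilde A b"
  by (auto simp: tilde_def afibre_iff fun_eq_iff)

lemma lie_cong:
  assumes "\<And>x. x \<in> carrier (total A) \<Longrightarrow> a x = a' x" "\<And>x. x \<in> carrier (total A) \<Longrightarrow> b x = b' x"
  shows "lie a b = lie a' b'"
  using tilde_cong[OF assms(1)] tilde_cong[OF assms(2)] by (simp add: lie_def[abs_def])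

lemma tilde_add: "tilde A (\<lambda>x. a x + b x) = tilde A a + tilde A b"
  by (auto simp: tilde_def fun_eq_iff)

lemma tilde_cmult: "tilde A (\<lambda>x. c * a x) = c *\<^sub>R tilde A a"
  by (auto simp: tilde_def fun_eq_iff scaleR_fun_def)

lemma lie_add: "c \<in> aff \<Longrightarrow> a \<in> aff \<Longrightarrow> b \<in> aff \<Longrightarrow> lie c (\<lambda>x. a x + b x) x = lie c a x + lie c b x"
  using lie_bracket tilde_section
  by (simp add: lie_def tilde_add lie_bracket_on_def lin_on_add[of sect])

lemma lie_cmult:
  assumes "c \<in> aff" "a \<in> aff"
  shows "lie c (\<lambda>x. r * a x) x = r * lie c a x"
proof -
  have "br (tilde A c) (r *\<^sub>R tilde A a) = r *\<^sub>R br (tilde A c) (tilde A a)"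
    using lie_bracket tilde_section assms by (intro lin_on_scale[of sect]) (auto simp: lie_bracket_on_def)
  then show ?thesis by (simp add: lie_def tilde_cmult scaleR_fun_def)
qed

lemma lie_self: "a \<in> aff \<Longrightarrow> lie a a x = 0"
  using lie_bracket tilde_section by (simp add: lie_def lie_bracket_on_def)

lemma lie_add_left: "c \<in> aff \<Longrightarrow> a \<in> aff \<Longrightarrow> b \<in> aff \<Longrightarrow> lie (\<lambda>x. a x + b x) c x = lie a c x + lie b c x"
  using lie_bracket tilde_section
  by (simp add: lie_def tilde_add lie_bracket_on_def lin_on_add[of sect "\<lambda>X. br X _"])

text \<open>Polarisation of \<open>lie_self\<close>.\<close>

lemma lie_skew:
  assumes a: "a \<in> aff" and b: "b \<in> aff"
  shows "lie a b x = - lie b a x"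
proof -
  note ab = affine_functions_add[OF a b]
  have "lie (\<lambda>x. a x + b x) (\<lambda>x. a x + b x) x = 0" by (rule lie_self[OF ab])
  then have "lie a a x + lie a b x + (lie b a x + lie b b x) = 0"
    by (simp add: lie_add[OF ab a b] lie_add_left[OF _ a b] a b)
  then show ?thesis by (simp add: lie_self a b)
qed

lemma lie_jacobi:
  assumes "a \<in> aff" "b \<in> aff" "c \<in> aff"
  shows "lie a (lie b c) x + lie b (lie c a) x + lie c (lie a b) x = 0"
proof -
  have "br (tilde A a) (br (tilde A b) (tilde A c)) + br (tilde A b) (br (tilde A c) (tilde A a)) +
      br (tilde A c) (br (tilde A a) (tilde A b)) = 0"
    using lie_bracket tilde_section assms unfolding lie_bracket_on_def by blast
  from fun_cong[OF fun_cong[OF this, of "proj A x"], of x] show ?thesis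
    using assms by (simp add: lie_def[of a "lie b c"] lie_def[of b "lie c a"] lie_def[of c "lie a b"] tilde_lie)
qed

lemma lie_sum:
  assumes c: "c \<in> aff" and a: "\<And>i. i \<in> I \<Longrightarrow> a i \<in> aff"
  shows "lie c (\<lambda>x. \<Sum>i\<in>I. a i x) x = (\<Sum>i\<in>I. lie c (a i) x)"
proof -
  have 0: "lie c (\<lambda>x. 0) x = 0" using lie_cmult[OF c affine_functions_const[of 0], of 0 x] by simp
  show ?thesis
    using a
  proof (induction I rule: infinite_finite_induct)
    case (insert i I)
    then have "lie c (\<lambda>x. a i x + (\<Sum>i\<in>I. a i x)) x = lie c (a i) x + lie c (\<lambda>x. \<Sum>i\<in>I. a i x) x"
      by (intro lie_add c affine_functions_sum) auto
    then show ?case using insert by simp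
  qed (simp_all add: 0)
qed

definition anchor :: "('a \<Rightarrow> real) \<Rightarrow> 'm \<Rightarrow> 'm tvec"
  where "anchor a p = \<rho> p (tilde A a p)"

lemma anchor_tangent: "a \<in> aff \<Longrightarrow> p \<in> carrier (base A) \<Longrightarrow> anchor a p \<in> tangent_space (base A) p"
  using algebroid tilde_dual_fibre unfolding lie_algebroid_structure_def vb_morphism_def anchor_def by blast

lemma lie_leibniz:
  assumes f: "f \<in> smooth_functions (base A)" and c: "c \<in> aff" and a: "a \<in> aff" and x: "x \<in> carrier (total A)"
  shows "lie c (\<lambda>y. f (proj A y) * a y) x = f (proj A x) * lie c a x + anchor c (proj A x) f * a x"
proof -
  have "tilde A (\<lambda>y. f (proj A y) * a y) = (\<lambda>q. f q *\<^sub>R tilde A a q)"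
    by (auto simp: tilde_def fun_eq_iff scaleR_fun_def afibre_iff)
  moreover have "br (tilde A c) (\<lambda>q. f q *\<^sub>R tilde A a q) (proj A x) =
      f (proj A x) *\<^sub>R br (tilde A c) (tilde A a) (proj A x) + \<rho> (proj A x) (tilde A c (proj A x)) f *\<^sub>R tilde A a (proj A x)"
    using algebroid tilde_section[OF c] tilde_section[OF a] f proj_carrier[OF x]
    unfolding lie_algebroid_structure_def by blast
  ultimately show ?thesis using x
    by (simp add: lie_def anchor_def scaleR_fun_def tilde_def[of A a] afibre_iff)
qed

text \<open>The bracket at \<open>x\<close> depends only on the 1-jets at \<open>x\<close>: after multiplication with the square of
  a cutoff function, which does not affect the bracket at a zero of \<open>a\<close>, \<open>a\<close> is expanded as
  \<open>c0 + w_1 y_1 + ... + w_r y_r\<close> in fibre coordinates centred at \<open>x\<close>, and Leibniz applies to each term.\<close>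

lemma lie_eq_0:
  assumes c: "c \<in> aff" and a: "a \<in> aff" and x: "x \<in> carrier (total A)"
    and ax: "a x = 0" and da: "\<And>v. v \<in> tangent_space (total A) x \<Longrightarrow> v a = 0"
  shows "lie c a x = 0"
proof -
  let ?p = "proj A x"
  have pc: "?p \<in> carrier (base A)" by (rule proj_carrier[OF x])
  obtain U \<phi> W t where U: "(U, \<phi>) \<in> base A" and t: "affine_trivialization A W t"
    and p: "?p \<in> U" "?p \<in> W" by (rule adaptedE[OF pc])
  let ?z = "adapted \<phi> t" and ?D = "adapted_dom U W"
  let ?a = "a \<circ> inv_into ?D ?z"
  note gc = adapted_gchart[OF U t] and D = N.gchart_open[OF adapted_gchart[OF U t]]
  have xD: "x \<in> ?D" using x p by (simp add: adapted_dom_def)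
  have op: "mfd_open (base A) (U \<inter> W)" by (rule B.open_Int[OF B.open_chart[OF U] triv_open[OF t]])
  note as = affine_functions_smooth[OF a]
  obtain \<kappa> Z K where k: "\<kappa> \<in> smooth_functions (base A)" "mfd_open (base A) Z" "?p \<in> Z" "Z \<subseteq> K" "K \<subseteq> U \<inter> W"
    "mfd_open (base A) (carrier (base A) - K)" "\<And>y. y \<in> Z \<Longrightarrow> \<kappa> y = 1" "\<And>y. y \<notin> K \<Longrightarrow> \<kappa> y = (0::real)"
    using B.cutoff_exists[OF op] p by (metis IntI)
  \<comment> \<open>On each fibre over \<open>U \<inter> W\<close>, \<open>a\<close> is an inner
    product with \<open>t\<close> plus a constant. Up to the cutoff, \<open>f0\<close> is the value
    of \<open>a\<close> at fibre coordinate \<open>t x\<close>, \<open>f j\<close> is the slope in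
    direction \<open>j\<close>, and \<open>y j\<close> is the \<open>j\<close>-th fibre coordinate
    centred at \<open>x\<close>.\<close>
  define r where "r = local_rep U \<phi> W t a"
  define f0 where "f0 = (\<lambda>q. if q \<in> U \<inter> W then \<kappa> q * r (t x) q else 0)"
  define f where "f = (\<lambda>j q. if q \<in> U \<inter> W then \<kappa> q * (r (t x + j) q - r (t x) q) else 0)"
  define y where "y = (\<lambda>j z. if z \<in> ?D then \<kappa> (proj A z) * (j \<bullet> (t z - t x)) else 0)"
  have rs: "msmooth (base A) (U \<inter> W) (r k)" for k unfolding r_def by (rule msmooth_local_rep[OF U t as])
  have f0s: "f0 \<in> smooth_functions (base A)"
    unfolding f0_def by (rule B.msmooth_cutoff[OF op k(5,6,1)]) (use k rs in auto)
  have fs: "f j \<in> smooth_functions (base A)" for j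
    unfolding f_def by (rule B.msmooth_cutoff[OF op k(5,6,1)]) (use k in \<open>auto intro!: B.msmooth_diff op rs\<close>)
  have ts: "msmooth (total A) ?D t"
    using N.msmooth_bounded_linear[OF D bounded_linear_snd N.gchart_msmooth[OF gc]] by (simp add: adapted_def)
  have ya: "y j \<in> aff" for j
    unfolding y_def
  proof (rule affine_cutoff[OF U t k(5,6,1,8)])
    show "msmooth (total A) ?D (\<lambda>z. j \<bullet> (t z - t x))"
      by (intro N.msmooth_inner N.msmooth_diff D msmooth_const ts)
    fix q assume q: "q \<in> U \<inter> W"
    have "\<forall>z\<in>afibre A q. j \<bullet> (t z - t x) = j \<bullet> t z + - (j \<bullet> t x)" by (simp add: inner_diff_right)
    then show "affine_on_fibre A q (\<lambda>z. j \<bullet> (t z - t x))"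
      using affine_on_fibre_iff[OF t, of q] q by blast
  qed
  have \<kappa>a: "(\<lambda>z. \<kappa> (proj A z)) \<in> aff"
    using affine_functions_pull_mult[OF k(1) affine_functions_const[of 1]] by simp
  \<comment> \<open>The square of the cutoff appears because both factors of each product,
    coefficient and coordinate, have to be made global separately.\<close>
  have expand: "\<kappa> (proj A z) * (\<kappa> (proj A z) * a z) =
      f0 (proj A z) * \<kappa> (proj A z) + (\<Sum>j\<in>onb. f j (proj A z) * y j z)" if z: "z \<in> carrier (total A)" for z
  proof (cases "z \<in> ?D")
    case True
    then have q: "proj A z \<in> U" "proj A z \<in> W" by (auto simp: adapted_dom_def)
    have "affine_on_fibre A (proj A z) a" using a proj_carrier[OF z] by (simp add: affine_functions_def)
    then obtain w e where we: "\<And>x. x \<in> afibre A (proj A z) \<Longrightarrow> a x = w \<bullet> t x + e"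
      using affine_on_fibre_iff[OF t q(2)] by blast
    have az: "a z = w \<bullet> t z + e" by (rule we) (simp add: afibre_iff z)
    have r: "r k (proj A z) = w \<bullet> k + e" for k
      unfolding r_def by (rule local_rep_affine[OF U t q we])
    have "(\<Sum>j\<in>onb. (w \<bullet> j) * (j \<bullet> (t z - t x))) = (\<Sum>j\<in>onb. (w \<bullet> j) *\<^sub>R j) \<bullet> (t z - t x)"
      by (simp add: inner_sum_left)
    then have s: "(\<Sum>j\<in>onb. (w \<bullet> j) * (j \<bullet> (t z - t x))) = w \<bullet> (t z - t x)" by (simp add: onb_expand)
    have fy: "(\<Sum>j\<in>onb. f j (proj A z) * y j z) = \<kappa> (proj A z) * \<kappa> (proj A z) * (w \<bullet> (t z - t x))"
      unfolding s[symmetric] using True q by (simp add: f_def y_def r inner_add_right sum_distrib_left mult_ac)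
    show ?thesis
      unfolding fy using q by (simp add: az f0_def r inner_diff_right algebra_simps)
  next
    case False
    then have "proj A z \<notin> K" using k(5) z by (auto simp: adapted_dom_def)
    then show ?thesis using False by (simp add: y_def k(8))
  qed
  have da_z: "(?a has_derivative (\<lambda>w. 0)) (at (?z x))"
    using N.gchart_has_derivative[OF gc xD as] da[OF N.dir_deriv_in_tangent_space[OF gc xD]] by simp
  have rx: "r (t x) ?p = 0" using local_rep_eq[OF U t xD, of a] ax by (simp add: r_def)
  have f0p: "f0 ?p = 0" by (simp add: f0_def rx)
  \<comment> \<open>On the fibre through \<open>x\<close>, \<open>a\<close> is affine with slope
    \<open>w \<bullet> j\<close> in direction \<open>j\<close>, and this slope is a directional
    derivative of \<open>a\<close> at \<open>x\<close>, which vanishes by \<open>da\<close>.\<close>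
  have fp: "f j ?p = 0" for j
  proof -
    have "affine_on_fibre A ?p a" using a pc by (simp add: affine_functions_def)
    then obtain w e where we: "\<And>x. x \<in> afibre A ?p \<Longrightarrow> a x = w \<bullet> t x + e"
      using affine_on_fibre_iff[OF t p(2)] by blast
    have r: "r k ?p = w \<bullet> k + e" for k
      unfolding r_def by (rule local_rep_affine[OF U t p we])
    have "(?a has_derivative (\<lambda>w. 0)) (at (?z x + 0 *\<^sub>R (0, j)))"
      using da_z by (simp only: scaleR_zero_left add_0_right)
    from has_real_derivative_line[OF this]
    have d1: "((\<lambda>s. ?a (?z x + s *\<^sub>R (0, j))) has_real_derivative 0) (at 0)" .
    have eq: "?a (?z x + s *\<^sub>R (0, j)) = w \<bullet> t x + s * (w \<bullet> j) + e" for s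
      using r[of "t x + s *\<^sub>R j"] unfolding r_def local_rep_def adapted_def by (simp add: inner_add_right)
    have "((\<lambda>s. w \<bullet> t x + s * (w \<bullet> j) + e) has_real_derivative w \<bullet> j) (at 0)"
      by (auto intro!: derivative_eq_intros)
    then have "w \<bullet> j = 0" using DERIV_unique d1 unfolding eq by blast
    then show ?thesis by (simp add: f_def r inner_add_right)
  qed
  \<comment> \<open>Near the base point \<open>f0\<close> is \<open>a\<close> restricted to the
    local section with constant fibre coordinate \<open>t x\<close>, so the chain rule passes on the
    vanishing derivative.\<close>
  have df0: "v f0 = 0" if v: "v \<in> tangent_space (base A) ?p" for v
  proof -
    obtain w where w: "v = dir_deriv (base A) (U, \<phi>) ?p w"
      by (rule B.tangentE[OF B.gchart_chart[OF U] p(1) v])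
    have 1: "((\<lambda>u. (u, t x)) has_derivative (\<lambda>w. (w, 0))) (at (\<phi> ?p))"
      by (auto intro!: derivative_eq_intros)
    have "(?a \<circ> (\<lambda>u. (u, t x)) has_derivative (\<lambda>w. 0)) (at (\<phi> ?p))"
      using diff_chain_at[OF 1, of ?a "\<lambda>w. 0"] da_z by (simp add: o_def adapted_def)
    then have "(f0 \<circ> inv_into U \<phi> has_derivative (\<lambda>w. 0)) (at (\<phi> ?p))"
    proof (rule has_derivative_transform_within_open[OF _ mfd_open_image[OF B.open_Int[OF op k(2)] U]])
      show "\<phi> ?p \<in> \<phi> ` (U \<inter> (U \<inter> W \<inter> Z))" using p k by blast
      fix u assume "u \<in> \<phi> ` (U \<inter> (U \<inter> W \<inter> Z))"
      then obtain q where q: "q \<in> U" "q \<in> W" "q \<in> Z" "u = \<phi> q" by blast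
      then show "(?a \<circ> (\<lambda>u. (u, t x))) u = (f0 \<circ> inv_into U \<phi>) u"
        using B.chart_inj[OF U] k(7) by (simp add: f0_def r_def local_rep_def)
    qed
    from B.dir_derivI[OF this f0s] show ?thesis by (simp add: w)
  qed
  have \<kappa>p: "\<kappa> ?p = 1" using k by blast
  have yx: "y j x = 0" for j by (simp add: y_def)
  have "lie c a x = lie c (\<lambda>z. \<kappa> (proj A z) * (\<kappa> (proj A z) * a z)) x"
    by (simp add: lie_leibniz[OF k(1) c affine_functions_pull_mult[OF k(1) a] x] lie_leibniz[OF k(1) c a x] ax \<kappa>p)
  also have "\<dots> = lie c (\<lambda>z. f0 (proj A z) * \<kappa> (proj A z) + (\<Sum>j\<in>onb. f j (proj A z) * y j z)) x"
    by (rule fun_cong[OF lie_cong]) (simp_all add: expand)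
  also have "\<dots> = lie c (\<lambda>z. f0 (proj A z) * \<kappa> (proj A z)) x + (\<Sum>j\<in>onb. lie c (\<lambda>z. f j (proj A z) * y j z) x)"
    unfolding lie_add[OF c affine_functions_pull_mult[OF f0s \<kappa>a] affine_functions_sum[OF affine_functions_pull_mult[OF fs ya]]]
    by (subst lie_sum[OF c affine_functions_pull_mult[OF fs ya]]) simp
  also have "lie c (\<lambda>z. f0 (proj A z) * \<kappa> (proj A z)) x = 0"
    by (simp add: lie_leibniz[OF f0s c \<kappa>a x] f0p df0[OF anchor_tangent[OF c pc]])
  \<comment> \<open>In each product both factors vanish, \<open>f j\<close> at the base point and
    \<open>y j\<close> at \<open>x\<close>, so both Leibniz terms are 0 whatever the derivative of
    \<open>f j\<close>.\<close>
  also have "(\<Sum>j\<in>onb. lie c (\<lambda>z. f j (proj A z) * y j z) x) = 0"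
    by (simp add: lie_leibniz[OF fs c ya x] fp yx)
  finally show ?thesis by simp
qed

lemma lie_diff: "c \<in> aff \<Longrightarrow> a \<in> aff \<Longrightarrow> b \<in> aff \<Longrightarrow> lie c (\<lambda>x. a x - b x) x = lie c a x - lie c b x"
  using lie_add[of c a "\<lambda>x. -1 * b x" x] lie_cmult[of c b "-1" x] affine_functions_cmult[of b "-1"] by simp

lemma affine_functions_diff: "a \<in> aff \<Longrightarrow> b \<in> aff \<Longrightarrow> (\<lambda>x. a x - b x) \<in> aff"
  using affine_functions_add[of a "\<lambda>x. -1 * b x"] affine_functions_cmult[of b "-1"] by simp

text \<open>The difference of \<open>a\<close> and \<open>b\<close> has zero 1-jet at
  \<open>x\<close>; skew-symmetry transfers the result to the left argument.\<close>

lemma lie_jet_cong: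
  assumes c: "c \<in> aff" and a: "a \<in> aff" and b: "b \<in> aff" and x: "x \<in> carrier (total A)"
    and ab: "a x = b x" and d: "\<And>v. v \<in> tangent_space (total A) x \<Longrightarrow> v a = v b"
  shows "lie c a x = lie c b x" "lie a c x = lie b c x"
proof -
  have "lie c (\<lambda>y. a y - b y) x = 0"
  proof (rule lie_eq_0[OF c affine_functions_diff[OF a b] x])
    show "v (\<lambda>y. a y - b y) = 0" if "v \<in> tangent_space (total A) x" for v
      using N.tangent_diff[OF x that affine_functions_smooth[OF a] affine_functions_smooth[OF b]] d[OF that] by simp
  qed (simp add: ab)
  then show "lie c a x = lie c b x" by (simp add: lie_diff c a b)
  then show "lie a c x = lie b c x" using lie_skew[OF a c] lie_skew[OF b c] by simp
qed

section \<open>Construction of the vector field and the bivector field\<close>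

abbreviation "one \<equiv> \<lambda>_::'a. 1::real"

definition Efield :: "'a \<Rightarrow> 'a tvec"
  where "Efield x = (if x \<in> carrier (total A)
    then THE v. v \<in> tangent_space (total A) x \<and> (\<forall>a\<in>aff. v a = lie one a x) else 0)"

text \<open>Since \<open>lie one one\<close> is 0, \<open>lie one a x\<close> ignores the value of
  \<open>a\<close> at \<open>x\<close> and depends linearly on its differential there. A linear
  functional on covectors is a tangent vector, found by Riesz in coordinates.\<close>

lemma Efield:
  assumes x: "x \<in> carrier (total A)"
  shows "Efield x \<in> tangent_space (total A) x" "a \<in> aff \<Longrightarrow> Efield x a = lie one a x"
proof -
  note one = affine_functions_const[of 1]
  obtain U \<phi> Y G where G: "N.coords U \<phi> Y G" "x \<in> Y" "\<And>b. G b \<in> aff"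
    using affine_coords_exist[OF x] by blast
  note gc = N.coordsD(1)[OF G(1)] and xU = N.coordsD(6)[OF G(1,2)]
  have jet: "lie one a x = lie one (G b) x" if a: "a \<in> aff" and ab: "\<And>v. v \<in> tangent_space (total A) x \<Longrightarrow> v a = v (G b)" for a b
  proof -
    \<comment> \<open>The constant shift makes the values at \<open>x\<close> agree as well, so that
      the full 1-jets coincide; \<open>lie one\<close> does not see it.\<close>
    let ?h = "\<lambda>y. G b y + (a x - G b x)"
    have h: "?h \<in> aff" by (intro affine_functions_add G(3) affine_functions_const)
    have "v a = v ?h" if v: "v \<in> tangent_space (total A) x" for v
      using N.tangent_add[OF x v affine_functions_smooth[OF G(3)] N.smooth_const] N.tangent_const[OF x v]
      by (simp add: ab[OF v])
    from lie_jet_cong(1)[OF one a h x _ this] have "lie one a x = lie one ?h x" by simp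
    also have "\<dots> = lie one (G b) x + (a x - G b x) * lie one one x"
      using lie_cmult[OF one one, of "a x - G b x" x] by (simp add: lie_add[OF one G(3) affine_functions_const])
    finally show ?thesis by (simp add: lie_self[OF one])
  qed
  have dG: "v (G b) = b \<bullet> w" if "v = dir_deriv (total A) (U, \<phi>) x w" for v b w
    unfolding that by (rule N.coords_dir_deriv[OF G(1,2)])
  \<comment> \<open>The functions \<open>G b\<close> depend linearly on \<open>b\<close> only on
    \<open>Y\<close>, not globally; equal differentials at \<open>x\<close> are enough.\<close>
  have Gjet: "lie one (\<lambda>y. r * G b y + G b' y) x = lie one (G (r *\<^sub>R b + b')) x" for r b b'
  proof (rule jet)
    show "(\<lambda>y. r * G b y + G b' y) \<in> aff" by (intro affine_functions_add affine_functions_cmult G(3))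
    fix v assume v: "v \<in> tangent_space (total A) x"
    obtain w where w: "v = dir_deriv (total A) (U, \<phi>) x w" by (rule N.tangentE[OF gc xU v])
    have "v (\<lambda>y. r * G b y + G b' y) = r * v (G b) + v (G b')"
      using N.tangent_add[OF x v N.smooth_mult[OF N.smooth_const affine_functions_smooth[OF G(3)]] affine_functions_smooth[OF G(3)]]
        N.tangent_cmult[OF x v affine_functions_smooth[OF G(3)]] by simp
    then show "v (\<lambda>y. r * G b y + G b' y) = v (G (r *\<^sub>R b + b'))"
      by (simp add: dG[OF w] inner_add_left)
  qed
  have comb: "lie one (G (r *\<^sub>R b + b')) x = r * lie one (G b) x + lie one (G b') x" for r b b'
    unfolding Gjet[symmetric]
    by (simp add: lie_add[OF one affine_functions_cmult[OF G(3)] G(3)] lie_cmult[OF one G(3)])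
  \<comment> \<open>With factor -1 and both indices 0, the left side is
    \<open>lie one (G 0) x\<close> and the right side is its negative plus itself.\<close>
  have z: "lie one (G 0) x = 0" using comb[of "-1" 0 0] by simp
  have "linear (\<lambda>b. lie one (G b) x)"
    by (rule linearI) (use comb[of 1] comb[of _ _ 0] z in auto)
  then obtain w where w: "\<And>b. lie one (G b) x = w \<bullet> b" using riesz by blast
  define v where "v = dir_deriv (total A) (U, \<phi>) x w"
  have v: "v \<in> tangent_space (total A) x" unfolding v_def by (rule N.dir_deriv_in_tangent_space[OF gc xU])
  have va: "v a = lie one a x" if a: "a \<in> aff" for a
  proof -
    obtain b where b: "differential (total A) a x = differential (total A) (G b) x"
      by (rule N.cotangent_coords[OF G(1,2) N.differential_in_cotangent_space[OF x]])
    have ab: "v' a = v' (G b)" if "v' \<in> tangent_space (total A) x" for v'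
      using fun_cong[OF b, of v'] that by (simp add: differential_def)
    have "lie one a x = b \<bullet> w" using jet[OF a ab] w[of b] by (simp add: inner_commute)
    then show ?thesis using ab[OF v] dG[OF v_def] by simp
  qed
  have "Efield x = v"
  proof -
    have "(THE v. v \<in> tangent_space (total A) x \<and> (\<forall>a\<in>aff. v a = lie one a x)) = v"
    proof (rule the_equality)
      fix v' assume v': "v' \<in> tangent_space (total A) x \<and> (\<forall>a\<in>aff. v' a = lie one a x)"
      show "v' = v" by (rule J.gen_tangent_eqI[OF x _ v]) (use v' va in auto)
    qed (use v va in blast)
    then show ?thesis using x by (simp add: Efield_def)
  qed
  then show "Efield x \<in> tangent_space (total A) x" "a \<in> aff \<Longrightarrow> Efield x a = lie one a x"
    using v va by auto
qed

lemma differential_diff_const: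
  assumes x: "x \<in> carrier (total A)" and a: "a \<in> aff"
  shows "differential (total A) (\<lambda>y. a y - c) x = differential (total A) a x"
proof (rule N.differential_eqI)
  fix v assume v: "v \<in> tangent_space (total A) x"
  show "v (\<lambda>y. a y - c) = v a"
    using N.tangent_diff[OF x v affine_functions_smooth[OF a] N.smooth_const] N.tangent_const[OF x v] by simp
qed

text \<open>Representatives are centred so that the two terms with E drop out of the Jacobi bracket
  at \<open>x\<close>. Which one is chosen is immaterial by \<open>lie_jet_cong\<close>.\<close>

definition jet_rep :: "'a \<Rightarrow> 'a covec \<Rightarrow> 'a \<Rightarrow> real"
  where "jet_rep x \<alpha> = (SOME a. a \<in> aff \<and> a x = 0 \<and> differential (total A) a x = \<alpha>)"

lemma jet_rep:
  assumes x: "x \<in> carrier (total A)" and \<alpha>: "\<alpha> \<in> cotangent_space (total A) x"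
  shows "jet_rep x \<alpha> \<in> aff" "jet_rep x \<alpha> x = 0" "differential (total A) (jet_rep x \<alpha>) x = \<alpha>"
proof -
  obtain a where a: "a \<in> aff" "\<alpha> = differential (total A) a x" by (rule J.gen_cotangent[OF x \<alpha>])
  have "differential (total A) (\<lambda>y. a y - a x) x = \<alpha>"
    unfolding a(2) by (rule differential_diff_const[OF x a(1)])
  then have "\<exists>a. a \<in> aff \<and> a x = 0 \<and> differential (total A) a x = \<alpha>"
    using affine_functions_diff[OF a(1) affine_functions_const] by (intro exI[of _ "\<lambda>y. a y - a x"]) simp
  from someI_ex[OF this] show "jet_rep x \<alpha> \<in> aff" "jet_rep x \<alpha> x = 0" "differential (total A) (jet_rep x \<alpha>) x = \<alpha>"
    unfolding jet_rep_def by blast+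
qed

definition Lfield :: "'a \<Rightarrow> 'a bivec"
  where "Lfield x \<alpha> \<beta> = (if x \<in> carrier (total A) \<and> \<alpha> \<in> cotangent_space (total A) x \<and> \<beta> \<in> cotangent_space (total A) x
    then lie (jet_rep x \<alpha>) (jet_rep x \<beta>) x else 0)"

lemma differential_eqD: "differential M f x = differential M g x \<Longrightarrow> v \<in> tangent_space M x \<Longrightarrow> v f = v g"
  by (metis differential_def)

lemma Lfield_centred:
  assumes x: "x \<in> carrier (total A)" and a: "a \<in> aff" "a x = 0" and b: "b \<in> aff" "b x = 0"
  shows "Lfield x (differential (total A) a x) (differential (total A) b x) = lie a b x"
proof -
  note da = N.differential_in_cotangent_space[OF x, of a] and db = N.differential_in_cotangent_space[OF x, of b]
  note ra = jet_rep[OF x da] and rb = jet_rep[OF x db]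
  have "lie (jet_rep x (differential (total A) a x)) (jet_rep x (differential (total A) b x)) x =
      lie (jet_rep x (differential (total A) a x)) b x"
    by (rule lie_jet_cong(1)[OF ra(1) rb(1) b(1) x]) (use rb b differential_eqD[OF rb(3)] in auto)
  also have "\<dots> = lie a b x"
    by (rule lie_jet_cong(2)[OF b(1) ra(1) a(1) x]) (use ra a differential_eqD[OF ra(3)] in auto)
  finally show ?thesis using x da db by (simp add: Lfield_def)
qed

text \<open>Subtracting the values at \<open>x\<close> gives functions with a zero there, and
  bilinearity of \<open>lie\<close> expands the result. The formula is that of the Jacobi bracket
  solved for the bivector term; smoothness, existence and uniqueness all use it.\<close>

lemma Lfield_eq:
  assumes x: "x \<in> carrier (total A)" and a: "a \<in> aff" and b: "b \<in> aff"
  shows "Lfield x (differential (total A) a x) (differential (total A) b x) =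
    lie a b x - a x * lie one b x + b x * lie one a x"
proof -
  note one = affine_functions_const[of 1]
  let ?c = "\<lambda>a y. a y - a x"
  have c: "?c a \<in> aff" if "a \<in> aff" for a by (intro affine_functions_diff affine_functions_const that)
  note d = differential_diff_const[OF x]
  have s: "lie e (?c a) x = lie e a x - a x * lie e one x" if "a \<in> aff" "e \<in> aff" for a e
    using lie_cmult[OF that(2) one, of "a x" x] by (simp add: lie_diff[OF that(2,1) affine_functions_const])
  have "Lfield x (differential (total A) a x) (differential (total A) b x) = lie (?c a) (?c b) x"
    using Lfield_centred[OF x c[OF a] _ c[OF b]] by (simp add: d a b)
  also have "\<dots> = lie (?c a) b x - b x * lie (?c a) one x" by (rule s[OF b c[OF a]])
  also have "\<dots> = - (lie b a x - a x * lie b one x) + b x * (lie one a x - a x * lie one one x)"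
    unfolding lie_skew[OF c[OF a] b] lie_skew[OF c[OF a] one] s[OF a b] s[OF a one]
    by (simp add: algebra_simps)
  finally show ?thesis using lie_skew[OF b a, of x] lie_skew[OF b one, of x] lie_self[OF one, of x] by simp
qed

text \<open>Sums and multiples of centred representatives are centred representatives of the sum and
  multiple of the covectors, so linearity and skew-symmetry are inherited from
  \<open>lie\<close>.\<close>

lemma Lfield_bivector:
  assumes x: "x \<in> carrier (total A)"
  shows "Lfield x \<in> bivectors (total A) x"
proof -
  let ?T = "cotangent_space (total A) x"
  note S = subspace_cotangent_space[of "total A" x]
  have skew: "Lfield x \<alpha> \<beta> = - Lfield x \<beta> \<alpha>" if "\<alpha> \<in> ?T" "\<beta> \<in> ?T" for \<alpha> \<beta>
    using that x lie_skew[OF jet_rep(1)[OF x that(1)] jet_rep(1)[OF x that(2)]] by (simp add: Lfield_def)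
  have lin: "lin_on ?T (Lfield x \<alpha>)" if \<alpha>: "\<alpha> \<in> ?T" for \<alpha>
  proof -
    note ra = jet_rep[OF x \<alpha>]
    have eq: "Lfield x \<alpha> (differential (total A) b x) = lie (jet_rep x \<alpha>) b x" if "b \<in> aff" "b x = 0" for b
      using Lfield_centred[OF x ra(1,2) that] by (simp add: ra(3))
    have "Lfield x \<alpha> (\<beta> + \<gamma>) = Lfield x \<alpha> \<beta> + Lfield x \<alpha> \<gamma>" if b: "\<beta> \<in> ?T" and c: "\<gamma> \<in> ?T" for \<beta> \<gamma>
    proof -
      note rb = jet_rep[OF x b] and rc = jet_rep[OF x c]
      let ?h = "\<lambda>y. jet_rep x \<beta> y + jet_rep x \<gamma> y"
      have "differential (total A) ?h x v = (differential (total A) (jet_rep x \<beta>) x + differential (total A) (jet_rep x \<gamma>) x) v" for v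
        using N.tangent_add[OF x _ affine_functions_smooth[OF rb(1)] affine_functions_smooth[OF rc(1)]]
        by (simp add: differential_def)
      then have "differential (total A) ?h x = \<beta> + \<gamma>" using rb(3) rc(3) by (simp add: fun_eq_iff)
      then show ?thesis
        using eq[OF affine_functions_add[OF rb(1) rc(1)]] eq[OF rb(1,2)] eq[OF rc(1,2)] rb rc
        by (simp add: lie_add[OF ra(1) rb(1) rc(1)])
    qed
    moreover have "Lfield x \<alpha> (r *\<^sub>R \<beta>) = r *\<^sub>R Lfield x \<alpha> \<beta>" if b: "\<beta> \<in> ?T" for \<beta> r
    proof -
      note rb = jet_rep[OF x b]
      let ?h = "\<lambda>y. r * jet_rep x \<beta> y"
      have "differential (total A) ?h x v = (r *\<^sub>R differential (total A) (jet_rep x \<beta>) x) v" for v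
        using N.tangent_cmult[OF x _ affine_functions_smooth[OF rb(1)]]
        by (simp add: differential_def scaleR_fun_def)
      then have "differential (total A) ?h x = r *\<^sub>R \<beta>" using rb(3) by (simp add: fun_eq_iff)
      then show ?thesis
        using eq[OF affine_functions_cmult[OF rb(1), of r]] eq[OF rb(1,2)] rb
        by (simp add: lie_cmult[OF ra(1) rb(1)])
    qed
    ultimately show ?thesis by (simp add: lin_on_def)
  qed
  have zero: "Lfield x \<alpha> \<beta> = 0" if "\<alpha> \<notin> ?T \<or> \<beta> \<notin> ?T" for \<alpha> \<beta>
    using that by (auto simp: Lfield_def)
  show ?thesis unfolding bivectors_def using skew lin zero by blast
qed

sublocale almost_jacobi "total A" "affine_functions A" Lfield Efield
proof
  note one = affine_functions_const[of 1]
  show "Lfield x \<in> bivectors (total A) x" if "x \<in> carrier (total A)" for x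
    by (rule Lfield_bivector[OF that])
  show "Lfield x = 0" if "x \<notin> carrier (total A)" for x using that by (simp add: fun_eq_iff Lfield_def)
  show "Efield x \<in> tangent_space (total A) x" if "x \<in> carrier (total A)" for x by (rule Efield(1)[OF that])
  show "Efield x = 0" if "x \<notin> carrier (total A)" for x using that by (simp add: Efield_def)
  show "(\<lambda>x. Lfield x (differential (total A) a x) (differential (total A) b x)) \<in> smooth_functions (total A)"
    if a: "a \<in> aff" and b: "b \<in> aff" for a b
  proof (rule N.smooth_cong)
    show "(\<lambda>x. lie a b x - a x * lie one b x + b x * lie one a x) \<in> smooth_functions (total A)"
      by (intro N.smooth_add N.smooth_diff N.smooth_mult affine_functions_smooth lie_affine a b one)
  qed (simp add: Lfield_eq a b)
  show "(\<lambda>x. Efield x a) \<in> smooth_functions (total A)" if a: "a \<in> aff" for a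
    by (rule N.smooth_cong[OF affine_functions_smooth[OF lie_affine[OF one a]]]) (simp add: Efield a)
qed

section \<open>Existence and uniqueness\<close>

lemma bracket_affine:
  assumes a: "a \<in> aff" and b: "b \<in> aff"
  shows "bracket a b = lie a b"
proof
  fix x
  show "bracket a b x = lie a b x"
  proof (cases "x \<in> carrier (total A)")
    case True
    then show ?thesis by (simp add: bracket_eq Lfield_eq a b Efield)
  next
    \<comment> \<open>The equation is one of functions on the whole type; off the total space the
      bracket is 0 by normalisation of the fields, and \<open>lie\<close> is 0 because it is a
      bracket of normalised sections.\<close>
    case False
    have "tilde A (lie a b) (proj A x) x = 0" using False by (simp add: tilde_def afibre_iff)
    then have "lie a b x = 0" by (simp add: tilde_lie[OF a b] lie_def)
    then show ?thesis using False by (simp add: bracket_eq L_0 E_0)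
  qed
qed

lemma affine_jacobi: "affine_jacobi_structure A (Lfield, Efield)"
proof -
  have "jacobi_structure (total A) (Lfield, Efield)"
    by (rule jacobi_structureI) (simp add: jacobiator_def bracket_affine lie_affine lie_jacobi)
  then show ?thesis by (simp add: affine_jacobi_structure_def bracket_affine lie_affine)
qed

text \<open>The bracket with the constant 1 gives E on affine functions, and these determine a
  tangent vector. Once E is known, the bracket gives the bivector on differentials of affine
  functions, which are all covectors.\<close>

lemma affine_jacobi_unique:
  assumes J: "jacobi_structure (total A) J"
    and eq: "\<And>a b. a \<in> aff \<Longrightarrow> b \<in> aff \<Longrightarrow> tilde A (jacobi_bracket (total A) J a b) = br (tilde A a) (tilde A b)"
  shows "J = (Lfield, Efield)"
proof -
  note one = affine_functions_const[of 1]
  have lie: "jacobi_bracket (total A) J a b x = lie a b x" if "a \<in> aff" "b \<in> aff" "x \<in> carrier (total A)" for a b x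
    using fun_cong[OF fun_cong[OF eq[OF that(1,2)], of "proj A x"], of x] that(3)
    by (simp add: lie_def tilde_def[of A "jacobi_bracket (total A) J a b"] afibre_iff)
  have L: "fst J x \<in> bivectors (total A) x" and E: "snd J x \<in> tangent_space (total A) x"
    if "x \<in> carrier (total A)" for x
    using J that by (auto simp: jacobi_structure_def bivector_fields_def vector_fields_def sections_def)
  have L0: "fst J x = 0" and E0: "snd J x = 0" if "x \<notin> carrier (total A)" for x
    using J that by (auto simp: jacobi_structure_def bivector_fields_def vector_fields_def sections_def)
  have Ea: "snd J x a = lie one a x" if x: "x \<in> carrier (total A)" and a: "a \<in> aff" for x a
  proof -
    have "differential (total A) one x = (\<lambda>v. 0)"
      using N.tangent_const[OF x] by (auto simp: differential_def)
    moreover have "fst J x (0 *\<^sub>R differential (total A) one x) \<beta> = 0" if "\<beta> \<in> cotangent_space (total A) x" for \<beta>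
      \<comment> \<open>An empty first sum expresses that a bivector vanishes when its first
        argument is the covector 0.\<close>
      using N.bivector_sum[OF L[OF x], of "{}" "\<lambda>_::nat. \<beta>" "{()}" "\<lambda>_. \<beta>" _ "\<lambda>_. 1"] that
      by simp
    ultimately have "fst J x (differential (total A) one x) (differential (total A) a x) = 0"
      using N.differential_in_cotangent_space[OF x] by (simp add: zero_fun_def)
    then show ?thesis
      using lie[OF one a x] N.tangent_const[OF x E[OF x]] by (simp add: jacobi_bracket_def)
  qed
  have "snd J x = Efield x" for x
  proof (cases "x \<in> carrier (total A)")
    case True
    show ?thesis
      by (rule J.gen_tangent_eqI[OF True E[OF True] Efield(1)[OF True]]) (simp add: Ea Efield True)
  qed (simp add: E0 E_0)
  moreover have "fst J x \<alpha> \<beta> = Lfield x \<alpha> \<beta>" for x \<alpha> \<beta>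
  proof (cases "x \<in> carrier (total A) \<and> \<alpha> \<in> cotangent_space (total A) x \<and> \<beta> \<in> cotangent_space (total A) x")
    case True
    then have x: "x \<in> carrier (total A)" by blast
    obtain a where a: "a \<in> aff" "\<alpha> = differential (total A) a x" using J.gen_cotangent[OF x] True by blast
    obtain b where b: "b \<in> aff" "\<beta> = differential (total A) b x" using J.gen_cotangent[OF x] True by blast
    show ?thesis
      using lie[OF a(1) b(1) x] Lfield_eq[OF x a(1) b(1)] Ea[OF x a(1)] Ea[OF x b(1)]
      by (simp add: a(2) b(2) jacobi_bracket_def)
  next
    case False
    then show ?thesis
    proof (cases "x \<in> carrier (total A)")
      case True
      then show ?thesis using False L[OF True] by (auto simp: bivectors_def Lfield_def)
    qed (auto simp: L0 Lfield_def)
  qed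
  ultimately show ?thesis by (auto simp: prod_eq_iff fun_eq_iff)
qed

end

theorem theorem3p5:
  fixes A :: "('m, 'e::finite_dim_inner, 'a, 'f::finite_dim_inner, 'v::real_vector) affine_bundle_data"
    and br :: "('m \<Rightarrow> 'a \<Rightarrow> real) \<Rightarrow> ('m \<Rightarrow> 'a \<Rightarrow> real) \<Rightarrow> 'm \<Rightarrow> 'a \<Rightarrow> real"
    and \<rho> :: "'m \<Rightarrow> ('a \<Rightarrow> real) \<Rightarrow> 'm tvec"
  assumes "affine_bundle A"
    and "affine_bundle_rank A > 0"
    and "lie_algebroid_structure (base A) (dual_fibre A) (dual_total A) br \<rho>"
  shows "\<exists>!J. affine_jacobi_structure A J \<and>
     (\<forall>a\<in>affine_functions A. \<forall>b\<in>affine_functions A.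
        tilde A (jacobi_bracket (total A) J a b) = br (tilde A a) (tilde A b))"
proof -
  interpret affine_algebroid A br \<rho>
    using assms(1,3) by unfold_locales
  show ?thesis
  proof (rule ex1I[of _ "(Lfield, Efield)"])
    show "affine_jacobi_structure A (Lfield, Efield) \<and>
     (\<forall>a\<in>aff. \<forall>b\<in>aff. tilde A (bracket a b) = br (tilde A a) (tilde A b))"
      by (simp add: affine_jacobi bracket_affine tilde_lie)
  qed (simp add: affine_jacobi_unique affine_jacobi_structure_def)
qed

end
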